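(* Assume that $\varphi$ is non-contractive, let $(S,\iota)$ be a free analytic 1-submanifold of $M$ with $S\notin\mathcal F(S)$, assume that $S$ is positive, and let $\Sigma\in\mathcal M(S)$ be compact with $\Sigma\subset\mathrm{int}[S]$, with a fixed $\Sigma$-decomposition $\mathcal S$ of $S$ with classes $[g_k]$. Then the class $[g_1]$ (whose powers give all classes of the decomposition) is the same for each $\mathcal S$-oriented decomposition: for each compact $\Sigma'\in\mathcal M(S)$ with $\Sigma'\subset\mathrm{int}[S]$, the classes $[g'_k]$ of the $\mathcal S$-oriented $\Sigma'$-decomposition of $S$ satisfy $[g_1']=[g_1]$, so that, for each $g\in[g_1]$, $[g'_k]=[g^k]$ for all indices $k$ of that decomposition.
   Context: Basic setting. Manifolds and Lie groups are finite-dimensional, Hausdorff, real analytic, without boundary unless stated otherwise, and not assumed second countable. $\varphi\colon G\times M\to M$, $(g,x)\mapsto g\cdot x$, is a left action of a Lie group $G$ on an analytic manifold $M$ such that $g\mapsto g\cdot x$ is continuous for each $x\in M$. $\varphi$ is analytic in $M$ if $x\mapsto g\cdot x$ is analytic for each $g\in G$; it is non-contractive if it is analytic in $M$ and for each $C\subseteq M$ with $|C|\ge 2$ and each $x\in M\setminus C$ there is a neighbourhood $U$ of $x$ with $g\cdot C\not\subseteq U$ for all $g\in G$. An analytic 1-submanifold $(S,\iota)$ of $M$ consists of a connected, Hausdorff, second countable 1-dimensional analytic manifold $S$ with (possibly empty) boundary and an injective analytic immersion $\iota\colon S\to M$. There is a homeomorphism $\upsilon\colon B\to S$ where either $B=U(1)$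 (written $S\cong U(1)$) or $B=D\subseteq\mathbb R$ is a nondegenerate interval (written $S\cong D$). A segment is a connected subset of $S$ with more than one point; $\mathrm{Seg}(S)$ is the set of segments. For $\Sigma\in\mathrm{Seg}(S)$: $\mathrm{int}[\Sigma]:=\upsilon(\text{topological interior of }\upsilon^{-1}(\Sigma)\text{ in }U(1)\text{ resp. }\mathbb R)$ and $\partial_\Sigma:=\Sigma\setminus\mathrm{int}[\Sigma]$. A boundary segment of $\Sigma$ is a segment $\Sigma'\subseteq\Sigma$ with $\Sigma\setminus\Sigma'$ connected (possibly empty). The symbol $\subset$ means proper inclusion. $g\cdot\iota$ denotes $z\mapsto g\cdot\iota(z)$; $G_x$ is the stabilizer of $x\in M$, $G_z:=G_{\iota(z)}$ for $z\in S$, $G_S:=\bigcap_{z\in S}G_{\iota(z)}$, $\mathcal H(S):=G/G_S$ (left cosets), and $[g]\in\mathcal H(S)$ is the class of $g$. For $\Sigma,\Sigma'\in\mathrm{Seg}(S)$ and $g\in G$, write $g\cdot\iota|_\Sigma\sim_\circ\iota|_{\Sigma'}$ if $g\cdot\iota(O)=\iota(O')$ for open (in $S$) segments $O\subseteq\Sigma$, $O'\subseteq\Sigma'$ on which $\iota$ is an embedding. $\Sigma\in\mathrm{Seg}(S)$ is a free segment, $\Sigma\in\mathcal F(S)$, if for $g\in G$: $g\cdot\iota|_\Sigma\sim_\circ\iota|_\Sigma\Leftrightarrow g\in G_S$. $\mathcal M(S)$ is the set of inclusion-maximal elements of $\mathcal F(S)$. $(S,\iota)$ is free if $\mathcal F(S)\neq\emptyset$.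 Positive. Let $\Sigma\in\mathcal M(S)$ be compact with $\Sigma\subset S$. For $z\in\partial_\Sigma\cap\mathrm{int}[S]$ (this set is non-empty) let $[g_z]\neq[e]$ be the unique class in $\mathcal H(S)$ for which there exist a compact segment $\Sigma_b\subseteq\Sigma$ with $b\in\partial_\Sigma\cap\partial_{\Sigma_b}$ and a compact $\Sigma_z\in\mathcal F(S)$ with $\Sigma\cap\Sigma_z=\partial_\Sigma\cap\partial_{\Sigma_z}=\{z\}$ such that $g_z\cdot\iota(\Sigma_b)=\iota(\Sigma_z)$ and $g_z\cdot\iota(b)=\iota(z)$. $\Sigma$ is positive if $g_z\notin G_z$ for every $z\in\partial_\Sigma\cap\mathrm{int}[S]$. $S$ is called positive if $S$ admits no $z$-decomposition and each compact $\Sigma\in\mathcal M(S)$ is positive. Here (only for $S\cong D$, $z\in\mathrm{int}[S]$) a $z$-decomposition is a class $[e]\neq[g]\in\mathcal H(S)$ with $g\in G_z$ such that there are compact segments $K_\pm\subseteq S$ with $g\cdot\iota(K_-)=\iota(K_+)$, $K_-\cap K_+=\{z\}$, and $\Sigma_\pm\in\mathcal F(S)$ for the unique boundary segments $\Sigma_\pm$ of $S$ with $S=\Sigma_-\cup\Sigma_+$, $\Sigma_-\cap\Sigma_+=\{z\}$, $K_\pm\subseteq\Sigma_\pm$. $\Sigma$-decomposition, $S\cong U(1)$. For $\Sigma\in\mathcal M(S)$, $\Sigma\subset S$: a $\Sigma$-decomposition consists of (compact) $\Sigma_0,\dots,\Sigma_n\in\mathcal M(S)$, $n\ge1$, and classes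 $[g_0],\dots,[g_n]\in\mathcal H(S)$ with $\Sigma_0=\Sigma$, $S=\bigcup_{k=0}^n\Sigma_k$, $g_k\cdot\iota(\Sigma_0)=\iota(\Sigma_k)$ for $0\le k\le n$; if $n=1$, $\Sigma_0\cap\Sigma_1=\partial_{\Sigma_0}\cap\partial_{\Sigma_1}$ consists of the two boundary points of $\Sigma_0$ and $\Sigma_1$; if $n\ge2$, $\Sigma_p\cap\Sigma_q=\partial_{\Sigma_p}\cap\partial_{\Sigma_q}$ is a singleton for $|p-q|\in\{1,n\}$ and empty for $2\le|p-q|\le n-1$. (The number $n$ is the same for all $\Sigma\in\mathcal M(S)$.) We set $\Sigma_{n+1}:=\Sigma_0$. $\Sigma$-decomposition, $S\cong D$. For compact $\Sigma\in\mathcal M(S)$, $\Sigma\subset\mathrm{int}[S]$: a $\Sigma$-decomposition is a pair $(\{\Sigma_n\}_{n\in\mathfrak n},\{[g_n]\}_{n\in\mathfrak n})$ with $\mathfrak n=\{n\in\mathbb Z\mid\mathfrak n_-\le n\le\mathfrak n_+\}$, $\mathfrak n_\pm\in\mathbb Z_{\ne0}\cup\{-\infty,\infty\}$, $\mathfrak n_-<0<\mathfrak n_+$, $[g_n]\in\mathcal H(S)$, and segments $\Sigma_n$ on which $\iota$ is an embedding, such that: $\Sigma_0=\Sigma$, and $\Sigma_{\mathfrak n_\pm}$ is a boundary segment of $S$ if $\mathfrak n_\pm\ne\pm\infty$; $\Sigma_p\cap\Sigma_q=\partial_{\Sigma_p}\cap\partial_{\Sigma_q}$ is a singleton for $|p-q|=1$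 and empty for $|p-q|\ge2$; $g_n\cdot\iota(\Sigma_0)=\iota(\Sigma_n)$ for $\mathfrak n_-<n<\mathfrak n_+$, and $g_{\mathfrak n_\pm}\cdot\iota(\Sigma_\pm)=\iota(\Sigma_{\mathfrak n_\pm})$ if $\mathfrak n_\pm\neq\pm\infty$, for certain boundary segments $\Sigma_\pm$ of $\Sigma_0$. $\mathcal S$-oriented $\Sigma'$-decomposition. Let $\mathcal S$ be the fixed $\Sigma$-decomposition, with segments $\Sigma_k$ and classes $[g_k]$, and let $\Sigma'\in\mathcal M(S)$ be compact with $\Sigma'\subset\mathrm{int}[S]$. (A) If $\Sigma'=\Sigma_p$ for some $p$: for $S\cong U(1)$ it is $\Sigma'_k:=\Sigma_{\zeta(k)}$, $[g_k']:=[g_{\zeta(k)}\cdot g_p^{-1}]$, $0\le k\le n$, with $\zeta(k):=p+k$ for $0\le k\le n-p$ and $\zeta(k):=k-(n-p+1)$ for $n-p+1\le k\le n$; for $S\cong D$ it is $\Sigma'_n:=\Sigma_{n+p}$, $[g'_n]:=[g_{n+p}\cdot g_p^{-1}]$ for $\mathfrak n_--p\le n\le\mathfrak n_+-p$. (B) Otherwise, there are an index $p$ ($0\le p\le n$ if $S\cong U(1)$; $\mathfrak n_-\le p<\mathfrak n_+$ if $S\cong D$) and $z\in\partial_{\Sigma_p}\cap\partial_{\Sigma_{p+1}}$ such that each of $\mathrm{int}[\Sigma_p]$, $\mathrm{int}[\Sigma_{p+1}]$ contains exactly one boundary point of $\Sigma'$, $\Sigma'\subset\mathrm{int}[\Sigma_p\cup\Sigma_{p+1}]$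 and $z\in\mathrm{int}[\Sigma']$. Let $z_+$ be the boundary point of $\Sigma'$ in $\mathrm{int}[\Sigma_{p+1}]$. The $\mathcal S$-oriented $\Sigma'$-decomposition is the unique $\Sigma'$-decomposition with segments $\Sigma'_k$ such that $z_+\in\partial_{\Sigma'_1}$ (if $S\cong U(1)$ and $n=1$, there is only one $\Sigma'$-decomposition at all). *)

theory Defs
  imports
    "HOL-Analysis.Analysis"
    "HOL-Algebra.Group_Action"
    "HOL-Library.Extended"
begin

section \<open>Real analytic manifolds\<close>

text \<open>
  Points of $\mathbb R^n$ are the points of the library space \<^const>\<open>Euclidean_space\<close> n, that is,
  functions on the naturals vanishing from n on.  This includes n = 0, so discrete groups are
  Lie groups.  A function on a subset A of $\mathbb R^n$ is analytic if near each point of A it is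
  the restriction to A of a power series converging (absolutely) on a full open box; for A open
  this is the usual notion, and for A relatively open in a half-space it is
  analyticity up to the boundary.
\<close>

definition multi_indices :: "nat \<Rightarrow> (nat \<Rightarrow> nat) set" where
  "multi_indices n = {\<alpha>. \<forall>i\<ge>n. \<alpha> i = 0}"

definition real_analytic_on :: "nat \<Rightarrow> (nat \<Rightarrow> real) set \<Rightarrow> ((nat \<Rightarrow> real) \<Rightarrow> real) \<Rightarrow> bool" where
  "real_analytic_on n A f \<longleftrightarrow>
     (\<forall>x\<in>A. \<exists>r>0. \<exists>c :: (nat \<Rightarrow> nat) \<Rightarrow> real.
        \<forall>y\<in>topspace (Euclidean_space n). (\<forall>i<n. \<bar>y i - x i\<bar> < r) \<longrightarrow>
          (\<lambda>\<alpha>. c \<alpha> * (\<Prod>i<n. (y i - x i) ^ \<alpha> i)) summable_on multi_indices n \<and>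
          (y \<in> A \<longrightarrow> f y = (\<Sum>\<^sub>\<infinity>\<alpha>\<in>multi_indices n. c \<alpha> * (\<Prod>i<n. (y i - x i) ^ \<alpha> i))))"

text \<open>A chart is a pair of its domain and its coordinate map; \<open>charts\<close> is an analytic atlas,
  not necessarily a maximal one.\<close>

record 'a manifold =
  mtop :: "'a topology"
  mdim :: nat
  charts :: "('a set \<times> ('a \<Rightarrow> nat \<Rightarrow> real)) set"

abbreviation points :: "'a manifold \<Rightarrow> 'a set" where
  "points X \<equiv> topspace (mtop X)"

definition is_chart ::
  "(nat \<Rightarrow> real) topology \<Rightarrow> 'a topology \<Rightarrow> 'a set \<Rightarrow> ('a \<Rightarrow> nat \<Rightarrow> real) \<Rightarrow> bool" where
  "is_chart H X U \<phi> \<longleftrightarrow> openin X U \<and> openin H (\<phi> ` U) \<and>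
     homeomorphic_map (subtopology X U) (subtopology H (\<phi> ` U)) \<phi>"

definition manifold_modelled_on :: "(nat \<Rightarrow> real) topology \<Rightarrow> 'a manifold \<Rightarrow> bool" where
  "manifold_modelled_on H X \<longleftrightarrow>
     Hausdorff_space (mtop X) \<and>
     (\<forall>(U, \<phi>)\<in>charts X. is_chart H (mtop X) U \<phi>) \<and>
     (\<Union>(U, \<phi>)\<in>charts X. U) = points X \<and>
     (\<forall>(U, \<phi>)\<in>charts X. \<forall>(V, \<psi>)\<in>charts X. \<forall>i<mdim X.
        real_analytic_on (mdim X) (\<phi> ` (U \<inter> V)) (\<lambda>t. \<psi> (inv_into U \<phi> t) i))"

definition analytic_manifold :: "'a manifold \<Rightarrow> bool" where
  "analytic_manifold X \<longleftrightarrow> manifold_modelled_on (Euclidean_space (mdim X)) X"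

text \<open>Manifolds with (possibly empty) boundary; interior charts take values in open subsets of
  the open half-space.\<close>

definition half_space :: "nat \<Rightarrow> (nat \<Rightarrow> real) topology" where
  "half_space n = subtopology (Euclidean_space n) {x. x 0 \<ge> 0}"

definition analytic_manifold_with_boundary :: "'a manifold \<Rightarrow> bool" where
  "analytic_manifold_with_boundary X \<longleftrightarrow>
     mdim X \<ge> 1 \<and> manifold_modelled_on (half_space (mdim X)) X"

definition analytic_map :: "'a manifold \<Rightarrow> 'b manifold \<Rightarrow> ('a \<Rightarrow> 'b) \<Rightarrow> bool" where
  "analytic_map X Y f \<longleftrightarrow>
     continuous_map (mtop X) (mtop Y) f \<and>
     (\<forall>(U, \<phi>)\<in>charts X. \<forall>(V, \<psi>)\<in>charts Y. \<forall>i<mdim Y.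
        real_analytic_on (mdim X) (\<phi> ` (U \<inter> f -` V)) (\<lambda>t. \<psi> (f (inv_into U \<phi> t)) i))"

definition prod_manifold :: "'a manifold \<Rightarrow> 'b manifold \<Rightarrow> ('a \<times> 'b) manifold" where
  "prod_manifold X Y =
     \<lparr> mtop = prod_topology (mtop X) (mtop Y),
       mdim = mdim X + mdim Y,
       charts = {(U \<times> V, \<lambda>(x, y) i. if i < mdim X then \<phi> x i else \<psi> y (i - mdim X)) | U \<phi> V \<psi>.
                   (U, \<phi>) \<in> charts X \<and> (V, \<psi>) \<in> charts Y} \<rparr>"

definition lie_group :: "('g, 'b) monoid_scheme \<Rightarrow> 'g manifold \<Rightarrow> bool" where
  "lie_group G L \<longleftrightarrow>
     group G \<and> analytic_manifold L \<and> points L = carrier G \<and>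
     analytic_map (prod_manifold L L) L (\<lambda>(g, h). g \<otimes>\<^bsub>G\<^esub> h) \<and>
     analytic_map L L (\<lambda>g. inv\<^bsub>G\<^esub> g)"


section \<open>Actions and analytic 1-submanifolds\<close>

definition pointwise_continuous_action ::
  "('g, 'b) monoid_scheme \<Rightarrow> 'g manifold \<Rightarrow> ('g \<Rightarrow> 'm \<Rightarrow> 'm) \<Rightarrow> 'm manifold \<Rightarrow> bool" where
  "pointwise_continuous_action G L \<phi> M \<longleftrightarrow>
     group_action G (points M) \<phi> \<and>
     (\<forall>x\<in>points M. continuous_map (mtop L) (mtop M) (\<lambda>g. \<phi> g x))"

text \<open>The condition that C has at least two elements is spelled out, since C may be infinite.\<close>

definition non_contractive ::
  "('g, 'b) monoid_scheme \<Rightarrow> ('g \<Rightarrow> 'm \<Rightarrow> 'm) \<Rightarrow> 'm manifold \<Rightarrow> bool" where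
  "non_contractive G \<phi> M \<longleftrightarrow>
     (\<forall>g\<in>carrier G. analytic_map M M (\<phi> g)) \<and>
     (\<forall>C\<subseteq>points M. (\<exists>a\<in>C. \<exists>b\<in>C. a \<noteq> b) \<longrightarrow>
        (\<forall>x\<in>points M - C. \<exists>U. openin (mtop M) U \<and> x \<in> U \<and>
           (\<forall>g\<in>carrier G. \<not> \<phi> g ` C \<subseteq> U)))"

text \<open>The point of \<^term>\<open>Euclidean_space 1\<close> with coordinate t.\<close>

definition line_point :: "real \<Rightarrow> nat \<Rightarrow> real" where
  "line_point t = (\<lambda>j. if j = 0 then t else 0)"

text \<open>In dimension 1 the differential is injective iff the velocity vector of the coordinate
  representation (one-sided at boundary points) has a non-vanishing component.\<close>

definition analytic_immersion1 :: "'s manifold \<Rightarrow> 'm manifold \<Rightarrow> ('s \<Rightarrow> 'm) \<Rightarrow> bool" where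
  "analytic_immersion1 S M \<iota> \<longleftrightarrow>
     analytic_map S M \<iota> \<and>
     (\<forall>(U, \<phi>)\<in>charts S. \<forall>(V, \<psi>)\<in>charts M. \<forall>z\<in>U. \<iota> z \<in> V \<longrightarrow>
        (\<exists>i<mdim M. \<exists>d. d \<noteq> 0 \<and>
          ((\<lambda>t. \<psi> (\<iota> (inv_into U \<phi> (line_point t))) i) has_real_derivative d)
            (at (\<phi> z 0) within {t. line_point t \<in> \<phi> ` (U \<inter> \<iota> -` V)})))"

definition analytic_submanifold1 :: "'s manifold \<Rightarrow> 'm manifold \<Rightarrow> ('s \<Rightarrow> 'm) \<Rightarrow> bool" where
  "analytic_submanifold1 S M \<iota> \<longleftrightarrow>
     analytic_manifold_with_boundary S \<and> mdim S = 1 \<and>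
     connected_space (mtop S) \<and> second_countable (mtop S) \<and>
     analytic_immersion1 S M \<iota> \<and> inj_on \<iota> (points S)"


section \<open>Segments\<close>

definition circle_param :: "'s manifold \<Rightarrow> (complex \<Rightarrow> 's) \<Rightarrow> bool" where
  "circle_param S \<upsilon> \<longleftrightarrow> homeomorphic_map (top_of_set (sphere 0 1)) (mtop S) \<upsilon>"

definition interval_param :: "'s manifold \<Rightarrow> real set \<Rightarrow> (real \<Rightarrow> 's) \<Rightarrow> bool" where
  "interval_param S D \<upsilon> \<longleftrightarrow>
     is_interval D \<and> (\<exists>a\<in>D. \<exists>b\<in>D. a \<noteq> b) \<and> homeomorphic_map (top_of_set D) (mtop S) \<upsilon>"

definition circle_type :: "'s manifold \<Rightarrow> bool" where
  "circle_type S \<longleftrightarrow> (\<exists>\<upsilon>. circle_param S \<upsilon>)"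

definition interval_type :: "'s manifold \<Rightarrow> bool" where
  "interval_type S \<longleftrightarrow> (\<exists>D \<upsilon>. interval_param S D \<upsilon>)"

text \<open>The interior does not depend on the chosen homeomorphism.  For intervals it is the interior in
  the real line, not in D, so that boundary points of S are never interior.\<close>

definition seg_int :: "'s manifold \<Rightarrow> 's set \<Rightarrow> 's set" where
  "seg_int S \<Sigma> =
     (if circle_type S then
        (let \<upsilon> = (SOME \<upsilon>. circle_param S \<upsilon>)
         in \<upsilon> ` (top_of_set (sphere 0 1) interior_of {t \<in> sphere 0 1. \<upsilon> t \<in> \<Sigma>}))
      else
        (let (D, \<upsilon>) = (SOME (D, \<upsilon>). interval_param S D \<upsilon>)
         in \<upsilon> ` interior {t \<in> D. \<upsilon> t \<in> \<Sigma>}))"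

definition seg_bd :: "'s manifold \<Rightarrow> 's set \<Rightarrow> 's set" where
  "seg_bd S \<Sigma> = \<Sigma> - seg_int S \<Sigma>"

definition segment :: "'s manifold \<Rightarrow> 's set \<Rightarrow> bool" where
  "segment S \<Sigma> \<longleftrightarrow> connectedin (mtop S) \<Sigma> \<and> (\<exists>x\<in>\<Sigma>. \<exists>y\<in>\<Sigma>. x \<noteq> y)"

definition boundary_segment :: "'s manifold \<Rightarrow> 's set \<Rightarrow> 's set \<Rightarrow> bool" where
  "boundary_segment S \<Sigma> \<Sigma>' \<longleftrightarrow>
     segment S \<Sigma>' \<and> \<Sigma>' \<subseteq> \<Sigma> \<and> connectedin (mtop S) (\<Sigma> - \<Sigma>')"

definition embedded_on :: "'s manifold \<Rightarrow> 'm manifold \<Rightarrow> ('s \<Rightarrow> 'm) \<Rightarrow> 's set \<Rightarrow> bool" where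
  "embedded_on S M \<iota> K \<longleftrightarrow> embedding_map (subtopology (mtop S) K) (mtop M) \<iota>"

text \<open>\<open>stab_S\<close> is the pointwise stabilizer of the image of S, and \<open>cls\<close> the class of g modulo it.
  The quotient by it consists of the classes of the elements of the group; below, a class in the
  quotient is given by a representative.\<close>

definition stab_S ::
  "('g, 'b) monoid_scheme \<Rightarrow> ('g \<Rightarrow> 'm \<Rightarrow> 'm) \<Rightarrow> 's manifold \<Rightarrow> ('s \<Rightarrow> 'm) \<Rightarrow> 'g set" where
  "stab_S G \<phi> S \<iota> = (\<Inter>z\<in>points S. stabilizer G \<phi> (\<iota> z))"

definition cls ::
  "('g, 'b) monoid_scheme \<Rightarrow> ('g \<Rightarrow> 'm \<Rightarrow> 'm) \<Rightarrow> 's manifold \<Rightarrow> ('s \<Rightarrow> 'm) \<Rightarrow> 'g \<Rightarrow> 'g set" where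
  "cls G \<phi> S \<iota> g = g <#\<^bsub>G\<^esub> stab_S G \<phi> S \<iota>"

definition overlaps ::
  "('g \<Rightarrow> 'm \<Rightarrow> 'm) \<Rightarrow> 'm manifold \<Rightarrow> 's manifold \<Rightarrow> ('s \<Rightarrow> 'm) \<Rightarrow> 'g \<Rightarrow> 's set \<Rightarrow> 's set \<Rightarrow> bool" where
  "overlaps \<phi> M S \<iota> g \<Sigma> \<Sigma>' \<longleftrightarrow>
     (\<exists>K K'. segment S K \<and> openin (mtop S) K \<and> K \<subseteq> \<Sigma> \<and> embedded_on S M \<iota> K \<and>
             segment S K' \<and> openin (mtop S) K' \<and> K' \<subseteq> \<Sigma>' \<and> embedded_on S M \<iota> K' \<and>
             \<phi> g ` \<iota> ` K = \<iota> ` K')"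

definition free_segments ::
  "('g, 'b) monoid_scheme \<Rightarrow> ('g \<Rightarrow> 'm \<Rightarrow> 'm) \<Rightarrow> 'm manifold \<Rightarrow> 's manifold \<Rightarrow> ('s \<Rightarrow> 'm)
     \<Rightarrow> 's set set" where
  "free_segments G \<phi> M S \<iota> =
     {\<Sigma>. segment S \<Sigma> \<and>
          (\<forall>g\<in>carrier G. overlaps \<phi> M S \<iota> g \<Sigma> \<Sigma> \<longleftrightarrow> g \<in> stab_S G \<phi> S \<iota>)}"

definition maximal_segments ::
  "('g, 'b) monoid_scheme \<Rightarrow> ('g \<Rightarrow> 'm \<Rightarrow> 'm) \<Rightarrow> 'm manifold \<Rightarrow> 's manifold \<Rightarrow> ('s \<Rightarrow> 'm)
     \<Rightarrow> 's set set" where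
  "maximal_segments G \<phi> M S \<iota> =
     {\<Sigma> \<in> free_segments G \<phi> M S \<iota>. \<not> (\<exists>\<Sigma>'\<in>free_segments G \<phi> M S \<iota>. \<Sigma> \<subset> \<Sigma>')}"

definition free_submanifold ::
  "('g, 'b) monoid_scheme \<Rightarrow> ('g \<Rightarrow> 'm \<Rightarrow> 'm) \<Rightarrow> 'm manifold \<Rightarrow> 's manifold \<Rightarrow> ('s \<Rightarrow> 'm) \<Rightarrow> bool" where
  "free_submanifold G \<phi> M S \<iota> \<longleftrightarrow> free_segments G \<phi> M S \<iota> \<noteq> {}"


section \<open>Positivity\<close>

definition boundary_class ::
  "('g, 'b) monoid_scheme \<Rightarrow> ('g \<Rightarrow> 'm \<Rightarrow> 'm) \<Rightarrow> 'm manifold \<Rightarrow> 's manifold \<Rightarrow> ('s \<Rightarrow> 'm)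
     \<Rightarrow> 's set \<Rightarrow> 's \<Rightarrow> 'g set" where
  "boundary_class G \<phi> M S \<iota> \<Sigma> z =
     (THE c. \<exists>g\<in>carrier G. c = cls G \<phi> S \<iota> g \<and> c \<noteq> cls G \<phi> S \<iota> \<one>\<^bsub>G\<^esub> \<and>
        (\<exists>\<Sigma>b b \<Sigma>z.
           segment S \<Sigma>b \<and> compactin (mtop S) \<Sigma>b \<and> \<Sigma>b \<subseteq> \<Sigma> \<and>
           b \<in> seg_bd S \<Sigma> \<inter> seg_bd S \<Sigma>b \<and>
           \<Sigma>z \<in> free_segments G \<phi> M S \<iota> \<and> compactin (mtop S) \<Sigma>z \<and>
           \<Sigma> \<inter> \<Sigma>z = {z} \<and> seg_bd S \<Sigma> \<inter> seg_bd S \<Sigma>z = {z} \<and>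
           \<phi> g ` \<iota> ` \<Sigma>b = \<iota> ` \<Sigma>z \<and> \<phi> g (\<iota> b) = \<iota> z))"

text \<open>The stabilizer of a point of S contains \<open>stab_S\<close>, so membership in it does not depend on the
  representative.\<close>

definition positive_segment ::
  "('g, 'b) monoid_scheme \<Rightarrow> ('g \<Rightarrow> 'm \<Rightarrow> 'm) \<Rightarrow> 'm manifold \<Rightarrow> 's manifold \<Rightarrow> ('s \<Rightarrow> 'm)
     \<Rightarrow> 's set \<Rightarrow> bool" where
  "positive_segment G \<phi> M S \<iota> \<Sigma> \<longleftrightarrow>
     (\<forall>z \<in> seg_bd S \<Sigma> \<inter> seg_int S (points S).
        \<forall>g \<in> boundary_class G \<phi> M S \<iota> \<Sigma> z. g \<notin> stabilizer G \<phi> (\<iota> z))"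

definition z_decomposition ::
  "('g, 'b) monoid_scheme \<Rightarrow> ('g \<Rightarrow> 'm \<Rightarrow> 'm) \<Rightarrow> 'm manifold \<Rightarrow> 's manifold \<Rightarrow> ('s \<Rightarrow> 'm)
     \<Rightarrow> 's \<Rightarrow> 'g \<Rightarrow> bool" where
  "z_decomposition G \<phi> M S \<iota> z g \<longleftrightarrow>
     interval_type S \<and> z \<in> seg_int S (points S) \<and>
     g \<in> stabilizer G \<phi> (\<iota> z) \<and> cls G \<phi> S \<iota> g \<noteq> cls G \<phi> S \<iota> \<one>\<^bsub>G\<^esub> \<and>
     (\<exists>Km Kp \<Sigma>m \<Sigma>p.
        segment S Km \<and> compactin (mtop S) Km \<and>
        segment S Kp \<and> compactin (mtop S) Kp \<and>
        \<phi> g ` \<iota> ` Km = \<iota> ` Kp \<and> Km \<inter> Kp = {z} \<and>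
        boundary_segment S (points S) \<Sigma>m \<and> boundary_segment S (points S) \<Sigma>p \<and>
        points S = \<Sigma>m \<union> \<Sigma>p \<and> \<Sigma>m \<inter> \<Sigma>p = {z} \<and> Km \<subseteq> \<Sigma>m \<and> Kp \<subseteq> \<Sigma>p \<and>
        \<Sigma>m \<in> free_segments G \<phi> M S \<iota> \<and> \<Sigma>p \<in> free_segments G \<phi> M S \<iota>)"

text \<open>Positivity of S is only used when S itself is not free, so that each compact maximal segment
  is a proper subset of S.\<close>

definition positive_submanifold ::
  "('g, 'b) monoid_scheme \<Rightarrow> ('g \<Rightarrow> 'm \<Rightarrow> 'm) \<Rightarrow> 'm manifold \<Rightarrow> 's manifold \<Rightarrow> ('s \<Rightarrow> 'm) \<Rightarrow> bool" where
  "positive_submanifold G \<phi> M S \<iota> \<longleftrightarrow>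
     \<not> (\<exists>z g. z_decomposition G \<phi> M S \<iota> z g) \<and>
     (\<forall>\<Sigma>\<in>maximal_segments G \<phi> M S \<iota>. compactin (mtop S) \<Sigma> \<longrightarrow> positive_segment G \<phi> M S \<iota> \<Sigma>)"


section \<open>Decompositions of circle type\<close>

text \<open>The segments are \<open>Sg k\<close> and the classes those of \<open>g k\<close>, for k at most n.\<close>

definition circle_decomposition ::
  "('g, 'b) monoid_scheme \<Rightarrow> ('g \<Rightarrow> 'm \<Rightarrow> 'm) \<Rightarrow> 'm manifold \<Rightarrow> 's manifold \<Rightarrow> ('s \<Rightarrow> 'm)
     \<Rightarrow> 's set \<Rightarrow> nat \<Rightarrow> (nat \<Rightarrow> 's set) \<Rightarrow> (nat \<Rightarrow> 'g) \<Rightarrow> bool" where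
  "circle_decomposition G \<phi> M S \<iota> \<Sigma> n Sg g \<longleftrightarrow>
     n \<ge> 1 \<and> Sg 0 = \<Sigma> \<and> points S = (\<Union>k\<le>n. Sg k) \<and>
     (\<forall>k\<le>n. Sg k \<in> maximal_segments G \<phi> M S \<iota> \<and> compactin (mtop S) (Sg k) \<and>
            g k \<in> carrier G \<and> \<phi> (g k) ` \<iota> ` Sg 0 = \<iota> ` Sg k) \<and>
     (n = 1 \<longrightarrow>
        Sg 0 \<inter> Sg 1 = seg_bd S (Sg 0) \<inter> seg_bd S (Sg 1) \<and>
        Sg 0 \<inter> Sg 1 = seg_bd S (Sg 0) \<and> Sg 0 \<inter> Sg 1 = seg_bd S (Sg 1) \<and>
        card (Sg 0 \<inter> Sg 1) = 2) \<and>
     (n \<ge> 2 \<longrightarrow>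
        (\<forall>p\<le>n. \<forall>q\<le>n.
          (\<bar>int p - int q\<bar> \<in> {1, int n} \<longrightarrow>
             Sg p \<inter> Sg q = seg_bd S (Sg p) \<inter> seg_bd S (Sg q) \<and> is_singleton (Sg p \<inter> Sg q)) \<and>
          (2 \<le> \<bar>int p - int q\<bar> \<and> \<bar>int p - int q\<bar> \<le> int n - 1 \<longrightarrow> Sg p \<inter> Sg q = {})))"

definition zeta :: "nat \<Rightarrow> nat \<Rightarrow> nat \<Rightarrow> nat" where
  "zeta n p k = (if k \<le> n - p then p + k else k - (n - p + 1))"

definition crosses ::
  "'s manifold \<Rightarrow> 's set \<Rightarrow> 's set \<Rightarrow> 's set \<Rightarrow> bool" where
  "crosses S \<Sigma>' A B \<longleftrightarrow>
     (\<exists>z \<in> seg_bd S A \<inter> seg_bd S B.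
        is_singleton (seg_int S A \<inter> seg_bd S \<Sigma>') \<and> is_singleton (seg_int S B \<inter> seg_bd S \<Sigma>') \<and>
        \<Sigma>' \<subset> seg_int S (A \<union> B) \<and> z \<in> seg_int S \<Sigma>')"

text \<open>\<open>(n', Sg', g')\<close> is an oriented \<open>\<Sigma>'\<close>-decomposition with respect to \<open>(n, Sg, g)\<close>; indices of the
  latter are read modulo n + 1.\<close>

definition oriented_circle_decomposition ::
  "('g, 'b) monoid_scheme \<Rightarrow> ('g \<Rightarrow> 'm \<Rightarrow> 'm) \<Rightarrow> 'm manifold \<Rightarrow> 's manifold \<Rightarrow> ('s \<Rightarrow> 'm)
     \<Rightarrow> nat \<Rightarrow> (nat \<Rightarrow> 's set) \<Rightarrow> (nat \<Rightarrow> 'g)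
     \<Rightarrow> 's set \<Rightarrow> nat \<Rightarrow> (nat \<Rightarrow> 's set) \<Rightarrow> (nat \<Rightarrow> 'g) \<Rightarrow> bool" where
  "oriented_circle_decomposition G \<phi> M S \<iota> n Sg g \<Sigma>' n' Sg' g' \<longleftrightarrow>
     (if \<exists>p\<le>n. \<Sigma>' = Sg p then
        n' = n \<and>
        (\<exists>p\<le>n. \<Sigma>' = Sg p \<and>
           (\<forall>k\<le>n. Sg' k = Sg (zeta n p k) \<and> g' k \<in> carrier G \<and>
              cls G \<phi> S \<iota> (g' k) = cls G \<phi> S \<iota> (g (zeta n p k) \<otimes>\<^bsub>G\<^esub> inv\<^bsub>G\<^esub> g p)))
      else
        circle_decomposition G \<phi> M S \<iota> \<Sigma>' n' Sg' g' \<and>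
        (\<exists>p\<le>n. crosses S \<Sigma>' (Sg p) (Sg ((p + 1) mod (n + 1))) \<and>
           (\<exists>zp \<in> seg_bd S \<Sigma>' \<inter> seg_int S (Sg ((p + 1) mod (n + 1))). zp \<in> seg_bd S (Sg' 1))))"


section \<open>Decompositions of interval type\<close>

definition index_set :: "int extended \<Rightarrow> int extended \<Rightarrow> int set" where
  "index_set nm np = {k. nm \<le> Fin k \<and> Fin k \<le> np}"

definition interval_decomposition ::
  "('g, 'b) monoid_scheme \<Rightarrow> ('g \<Rightarrow> 'm \<Rightarrow> 'm) \<Rightarrow> 'm manifold \<Rightarrow> 's manifold \<Rightarrow> ('s \<Rightarrow> 'm)
     \<Rightarrow> 's set \<Rightarrow> int extended \<Rightarrow> int extended \<Rightarrow> (int \<Rightarrow> 's set) \<Rightarrow> (int \<Rightarrow> 'g) \<Rightarrow> bool" where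
  "interval_decomposition G \<phi> M S \<iota> \<Sigma> nm np Sg g \<longleftrightarrow>
     nm < Fin 0 \<and> Fin 0 < np \<and> Sg 0 = \<Sigma> \<and>
     (\<forall>k\<in>index_set nm np. g k \<in> carrier G \<and> segment S (Sg k) \<and> embedded_on S M \<iota> (Sg k)) \<and>
     (\<forall>p\<in>index_set nm np. \<forall>q\<in>index_set nm np.
        (\<bar>p - q\<bar> = 1 \<longrightarrow>
           Sg p \<inter> Sg q = seg_bd S (Sg p) \<inter> seg_bd S (Sg q) \<and> is_singleton (Sg p \<inter> Sg q)) \<and>
        (2 \<le> \<bar>p - q\<bar> \<longrightarrow> Sg p \<inter> Sg q = {})) \<and>
     (\<forall>k. nm < Fin k \<and> Fin k < np \<longrightarrow> \<phi> (g k) ` \<iota> ` Sg 0 = \<iota> ` Sg k) \<and>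
     (\<forall>k. Fin k = nm \<or> Fin k = np \<longrightarrow>
        boundary_segment S (points S) (Sg k) \<and>
        (\<exists>B. boundary_segment S (Sg 0) B \<and> \<phi> (g k) ` \<iota> ` B = \<iota> ` Sg k))"

definition oriented_interval_decomposition ::
  "('g, 'b) monoid_scheme \<Rightarrow> ('g \<Rightarrow> 'm \<Rightarrow> 'm) \<Rightarrow> 'm manifold \<Rightarrow> 's manifold \<Rightarrow> ('s \<Rightarrow> 'm)
     \<Rightarrow> int extended \<Rightarrow> int extended \<Rightarrow> (int \<Rightarrow> 's set) \<Rightarrow> (int \<Rightarrow> 'g)
     \<Rightarrow> 's set \<Rightarrow> int extended \<Rightarrow> int extended \<Rightarrow> (int \<Rightarrow> 's set) \<Rightarrow> (int \<Rightarrow> 'g) \<Rightarrow> bool" where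
  "oriented_interval_decomposition G \<phi> M S \<iota> nm np Sg g \<Sigma>' nm' np' Sg' g' \<longleftrightarrow>
     (if \<exists>p\<in>index_set nm np. \<Sigma>' = Sg p then
        (\<exists>p\<in>index_set nm np. \<Sigma>' = Sg p \<and> nm' = nm - Fin p \<and> np' = np - Fin p \<and>
           (\<forall>k\<in>index_set nm' np'. Sg' k = Sg (k + p) \<and> g' k \<in> carrier G \<and>
              cls G \<phi> S \<iota> (g' k) = cls G \<phi> S \<iota> (g (k + p) \<otimes>\<^bsub>G\<^esub> inv\<^bsub>G\<^esub> g p)))
      else
        interval_decomposition G \<phi> M S \<iota> \<Sigma>' nm' np' Sg' g' \<and>
        (\<exists>p. nm \<le> Fin p \<and> Fin p < np \<and> crosses S \<Sigma>' (Sg p) (Sg (p + 1)) \<and>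
           (\<exists>zp \<in> seg_bd S \<Sigma>' \<inter> seg_int S (Sg (p + 1)). zp \<in> seg_bd S (Sg' 1))))"

end

theory Submission
  imports Defs "HOL-Complex_Analysis.Conformal_Mappings"
begin

text \<open>
  Parametrize S by an interval, or by the line covering the circle, and follow one-sided germs of
  the resulting curve in M under elements of G.  Since the curve is an analytic immersion, an
  element that carries a germ at an interior point to another one also carries the opposite
  germs to each other.  An element that carries a germ inside a free segment to a germ inside the
  same segment lies in the stabilizer of S, so a class is determined by its effect on one germ.

  Let z be the common endpoint of \<open>\<Sigma>\<close> and its neighbour \<open>\<Sigma>\<^sub>1\<close>.  The point that \<open>g\<^sub>1\<close> moves to z is
  an endpoint of \<open>\<Sigma>\<close>, since otherwise continuation beyond it would put \<open>g\<^sub>1\<close> into the stabilizer;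
  it is not z itself, since then \<open>g\<^sub>1\<close> would represent the boundary class at z and fix z, contrary to
  positivity.  So \<open>g\<^sub>1\<close> is a translation, carrying the far end of \<open>\<Sigma>\<close> to z, and continuation across
  the successive common endpoints shows that its powers relate \<open>\<Sigma>\<close> to all further segments.
  If \<open>\<Sigma>'\<close> overlaps \<open>\<Sigma>\<^sub>p\<close> and its successor, its translation \<open>g'\<^sub>1\<close> carries a germ inside \<open>\<Sigma>\<^sub>p\<close> to one inside
  the next segment, and hence agrees with \<open>g\<^sub>1\<close>.
\<close>

subsection \<open>Analytic functions of one real variable\<close>

text \<open>The stabilizer of S need not be normal, so powers of a class and the cancellation of
  \<open>g p\<close> in \<open>g (k + p) \<otimes> inv g p\<close> depend on representatives unless
  the elements involved normalize it. For a translation this follows from the germs on both sides of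
  an endpoint. Germs are one-sided because the decisive points are endpoints: a two-sided
  neighbourhood leaves the free segment there, while a one-sided germ still contains an open piece
  of it, and freeness speaks of open pieces. Two segments with finite intersection share no germ; as
  a point has only two directions, this fixes the directions at common endpoints. Group elements are
  known through equalities of image sets, not through maps of parameters. Compactness of an arc
  turns such an equality into a reparametrization, which is injective and hence monotone.
  Analyticity along the curve is expressed by a holomorphic extension, which makes composition,
  inversion and the identity theorem statements of complex analysis. On the circle, following the
  segments once around shows that the classes of the powers are periodic.\<close>

definition real_analytic_at :: "(real \<Rightarrow> real) \<Rightarrow> real \<Rightarrow> bool" where
  "real_analytic_at f x \<longleftrightarrow>
     (\<exists>F r. r > 0 \<and> F holomorphic_on ball (complex_of_real x) r \<and>
        (\<forall>y. \<bar>y - x\<bar> < r \<longrightarrow> F (complex_of_real y) = complex_of_real (f y)))"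

lemma real_analytic_at_ident: "real_analytic_at (\<lambda>y. y) x"
  unfolding real_analytic_at_def
  by (intro exI[of _ "\<lambda>z. z"] exI[of _ 1]) auto

lemma real_analytic_at_isCont:
  assumes "real_analytic_at f x"
  shows "isCont f x"
proof -
  obtain F r where r: "r > 0" and F: "F holomorphic_on ball (complex_of_real x) r"
    and Ff: "\<And>y. \<bar>y - x\<bar> < r \<Longrightarrow> F (complex_of_real y) = complex_of_real (f y)"
    using assms unfolding real_analytic_at_def by blast
  have "isCont F (complex_of_real x)"
    using holomorphic_on_imp_continuous_on[OF F] r
    by (simp add: continuous_on_eq_continuous_at)
  then have "isCont (\<lambda>y. F (complex_of_real y)) x"
    by (rule isCont_o2[rotated]) simp
  then have 1: "isCont (\<lambda>y. Re (F (complex_of_real y))) x"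
    by (rule isCont_Re)
  have ev: "\<forall>\<^sub>F y in nhds x. f y = Re (F (complex_of_real y))"
    unfolding eventually_nhds_metric using Ff r by (auto simp: dist_real_def intro!: exI[of _ r])
  show ?thesis
    using 1 unfolding isCont_cong[OF ev] .
qed

text \<open>The multivariate power series, evaluated at complex arguments, converges
  uniformly by the M-test, and hence is holomorphic along the complexified curve.\<close>

lemma real_analytic_at_compose:
  assumes f: "real_analytic_on m A f" and x: "P x \<in> A"
    and P: "\<And>i. i < m \<Longrightarrow> real_analytic_at (\<lambda>t. P t i) x"
    and A: "d > 0" "\<And>t. \<bar>t - x\<bar> < d \<Longrightarrow> P t \<in> A" "A \<subseteq> topspace (Euclidean_space m)"
  shows "real_analytic_at (\<lambda>t. f (P t)) x"
proof -
  define p where "p = P x"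
  obtain r c where r: "r > 0" and
    c: "\<And>y. y \<in> topspace (Euclidean_space m) \<Longrightarrow> (\<And>i. i < m \<Longrightarrow> \<bar>y i - p i\<bar> < r) \<Longrightarrow>
          (\<lambda>\<alpha>. c \<alpha> * (\<Prod>i<m. (y i - p i) ^ \<alpha> i)) summable_on multi_indices m \<and>
          (y \<in> A \<longrightarrow> f y = (\<Sum>\<^sub>\<infinity>\<alpha>\<in>multi_indices m. c \<alpha> * (\<Prod>i<m. (y i - p i) ^ \<alpha> i)))"
    using f x unfolding real_analytic_on_def p_def by meson
  have "\<forall>i. \<exists>F s. i < m \<longrightarrow> s > 0 \<and> F holomorphic_on ball (complex_of_real x) s \<and>
        (\<forall>y. \<bar>y - x\<bar> < s \<longrightarrow> F (complex_of_real y) = complex_of_real (P y i))"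
    using P unfolding real_analytic_at_def by meson
  then obtain F s where Fs: "\<And>i. i < m \<Longrightarrow> s i > 0"
    "\<And>i. i < m \<Longrightarrow> F i holomorphic_on ball (complex_of_real x) (s i)"
    "\<And>i y. i < m \<Longrightarrow> \<bar>y - x\<bar> < s i \<Longrightarrow> F i (complex_of_real y) = complex_of_real (P y i)"
    by metis
  have "\<forall>\<^sub>F z in nhds (complex_of_real x). norm (F i z - complex_of_real (p i)) < r / 2"
    if i: "i < m" for i
  proof -
    have "isCont (F i) (complex_of_real x)"
      using holomorphic_on_imp_continuous_on[OF Fs(2)[OF i]] Fs(1)[OF i]
      by (simp add: continuous_on_eq_continuous_at)
    then have "(F i \<longlongrightarrow> F i (complex_of_real x)) (nhds (complex_of_real x))"
      by (simp add: tendsto_at_iff_tendsto_nhds isCont_def)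
    moreover have "F i (complex_of_real x) = complex_of_real (p i)"
      using Fs(1,3)[OF i] by (simp add: p_def)
    ultimately show ?thesis
      using tendstoD[of "F i" _ "nhds (complex_of_real x)" "r / 2"] r by (simp only: dist_norm half_gt_zero)
  qed
  then have "\<forall>\<^sub>F z in nhds (complex_of_real x). \<forall>i\<in>{..<m}. norm (F i z - complex_of_real (p i)) < r / 2"
    by (intro eventually_ball_finite) auto
  then obtain e1 where e1: "e1 > 0"
    "\<And>z i. dist z (complex_of_real x) < e1 \<Longrightarrow> i < m \<Longrightarrow> norm (F i z - complex_of_real (p i)) < r / 2"
    unfolding eventually_nhds_metric by auto
  define \<mu> where "\<mu> = Min (insert e1 (insert d (s ` {..<m})))"
  define e where "e = \<mu> / 2"
  have "\<mu> > 0" using e1 A(1) Fs(1) unfolding \<mu>_def by (subst Min_gr_iff) auto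
  moreover have "\<mu> \<le> e1" "\<mu> \<le> d" "\<And>i. i < m \<Longrightarrow> \<mu> \<le> s i" unfolding \<mu>_def by (rule Min_le; auto)+
  ultimately have e: "e > 0" "e < e1" "e < d" "\<And>i. i < m \<Longrightarrow> e < s i"
    unfolding e_def by (fastforce intro: less_le_trans)+
  let ?B = "cball (complex_of_real x) e"
  define T where "T = (\<lambda>\<alpha> z. complex_of_real (c \<alpha>) * (\<Prod>i<m. (F i z - complex_of_real (p i)) ^ \<alpha> i))"
  \<comment> \<open>The M-test needs one majorant on the whole disc: the terms at the corner
    \<open>y0\<close> of the box, with every coordinate at distance \<open>r / 2\<close> from
    \<open>p\<close>. The series converges absolutely there, and on the disc each \<open>F i\<close>
    stays within \<open>r / 2\<close> of \<open>p i\<close>.\<close>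
  define y0 where "y0 = (\<lambda>i. if i < m then p i + r / 2 else 0)"
  have "(\<lambda>\<alpha>. c \<alpha> * (\<Prod>i<m. (y0 i - p i) ^ \<alpha> i)) summable_on multi_indices m"
    using c[of y0] r by (auto simp: y0_def topspace_Euclidean_space)
  then have sm: "(\<lambda>\<alpha>. norm (c \<alpha> * (\<Prod>i<m. (y0 i - p i) ^ \<alpha> i))) summable_on multi_indices m"
    by (rule summable_on_iff_abs_summable_on_real[THEN iffD1])
  have bound: "norm (T \<alpha> z) \<le> norm (c \<alpha> * (\<Prod>i<m. (y0 i - p i) ^ \<alpha> i))" if "z \<in> ?B" for \<alpha> z
  proof -
    have "(\<Prod>i<m. norm (F i z - complex_of_real (p i)) ^ \<alpha> i) \<le> (\<Prod>i<m. (r / 2) ^ \<alpha> i)"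
    proof (rule prod_mono)
      fix i assume "i \<in> {..<m}"
      then have "norm (F i z - complex_of_real (p i)) \<le> r / 2"
        using e1(2)[of z i] that e(2) by (auto simp: dist_commute)
      then show "0 \<le> norm (F i z - complex_of_real (p i)) ^ \<alpha> i \<and> norm (F i z - complex_of_real (p i)) ^ \<alpha> i \<le> (r / 2) ^ \<alpha> i"
        by (simp add: power_mono)
    qed
    moreover have "(\<Prod>i<m. (y0 i - p i) ^ \<alpha> i) = (\<Prod>i<m. (r / 2) ^ \<alpha> i)"
      by (rule prod.cong) (auto simp: y0_def)
    moreover have "0 \<le> (\<Prod>i<m. (r / 2) ^ \<alpha> i)" using r by (simp add: prod_nonneg)
    ultimately show ?thesis
      unfolding T_def by (simp add: norm_mult norm_power abs_mult prod_norm[symmetric] mult_left_mono)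
  qed
  have ul: "uniform_limit ?B (\<lambda>X z. \<Sum>\<alpha>\<in>X. T \<alpha> z) (\<lambda>z. \<Sum>\<^sub>\<infinity>\<alpha>\<in>multi_indices m. T \<alpha> z)
      (finite_subsets_at_top (multi_indices m))"
    by (rule Weierstrass_m_test_general[OF bound sm])
  have hol: "T \<alpha> holomorphic_on cball (complex_of_real x) e" for \<alpha>
    unfolding T_def
    by (intro holomorphic_intros holomorphic_on_subset[OF Fs(2)]) (use e in force)+
  have "(\<lambda>z. \<Sum>\<^sub>\<infinity>\<alpha>\<in>multi_indices m. T \<alpha> z) holomorphic_on ball (complex_of_real x) e"
  proof (rule holomorphic_uniform_limit[OF _ ul])
    show "\<forall>\<^sub>F X in finite_subsets_at_top (multi_indices m).
       continuous_on ?B (\<lambda>z. \<Sum>\<alpha>\<in>X. T \<alpha> z) \<and> (\<lambda>z. \<Sum>\<alpha>\<in>X. T \<alpha> z) holomorphic_on ball (complex_of_real x) e"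
      by (intro always_eventually allI conjI holomorphic_on_imp_continuous_on holomorphic_on_sum hol
          holomorphic_on_subset[OF hol ball_subset_cball])
  qed simp_all
  moreover have "(\<Sum>\<^sub>\<infinity>\<alpha>\<in>multi_indices m. T \<alpha> (complex_of_real y)) = complex_of_real (f (P y))"
    if y: "\<bar>y - x\<bar> < e" for y
  proof -
    have Fy: "F i (complex_of_real y) = complex_of_real (P y i)" if "i < m" for i
      using Fs(3)[OF that] y e(4)[OF that] by simp
    have yB: "complex_of_real y \<in> ?B"
      using y by (simp add: dist_norm abs_minus_commute flip: of_real_diff)
    have "\<bar>P y i - p i\<bar> < r" if "i < m" for i
    proof -
      have "dist (complex_of_real y) (complex_of_real x) < e1"
        using yB e(2) by (auto simp: dist_commute)
      then have "norm (F i (complex_of_real y) - complex_of_real (p i)) < r / 2"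
        using e1(2) that by blast
      then show ?thesis
        using r unfolding Fy[OF that] by (simp flip: of_real_diff)
    qed
    then have "((\<lambda>\<alpha>. c \<alpha> * (\<Prod>i<m. (P y i - p i) ^ \<alpha> i)) has_sum f (P y)) (multi_indices m)"
      using c[of "P y"] A(2)[of y] A(3) y e(3) by (auto intro: has_sum_infsum)
    then have "complex_of_real (f (P y)) = (\<Sum>\<^sub>\<infinity>\<alpha>\<in>multi_indices m. complex_of_real (c \<alpha> * (\<Prod>i<m. (P y i - p i) ^ \<alpha> i)))"
      by (rule infsumI[OF has_sum_of_real_iff[THEN iffD2], symmetric])
    also have "\<dots> = (\<Sum>\<^sub>\<infinity>\<alpha>\<in>multi_indices m. T \<alpha> (complex_of_real y))"
      by (rule infsum_cong) (auto simp: T_def Fy of_real_prod)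
    finally show ?thesis by simp
  qed
  ultimately show ?thesis
    unfolding real_analytic_at_def using e(1) by blast
qed

text \<open>The difference of the holomorphic extensions has zeros accumulating at x, so it vanishes
  on a disc. Accumulation from one side is enough, and this is how agreement of two curves along a
  germ presents itself.\<close>

lemma real_analytic_at_identity:
  assumes f: "real_analytic_at f x" and g: "real_analytic_at g x"
    and lim: "x islimpt {y. f y = g y}"
  shows "\<exists>d>0. \<forall>y. \<bar>y - x\<bar> < d \<longrightarrow> f y = g y"
proof -
  obtain F r where r: "r > 0" and F: "F holomorphic_on ball (complex_of_real x) r"
    and Ff: "\<And>y. \<bar>y - x\<bar> < r \<Longrightarrow> F (complex_of_real y) = complex_of_real (f y)"
    using f unfolding real_analytic_at_def by blast
  obtain H q where q: "q > 0" and H: "H holomorphic_on ball (complex_of_real x) q"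
    and Hg: "\<And>y. \<bar>y - x\<bar> < q \<Longrightarrow> H (complex_of_real y) = complex_of_real (g y)"
    using g unfolding real_analytic_at_def by blast
  define e where "e = min r q"
  have e: "e > 0" using r q by (simp add: e_def)
  let ?B = "ball (complex_of_real x) e"
  define U where "U = complex_of_real ` {y. f y = g y \<and> \<bar>y - x\<bar> < e}"
  have inB: "complex_of_real y \<in> ?B \<longleftrightarrow> \<bar>y - x\<bar> < e" for y
    by (simp add: dist_norm abs_minus_commute flip: of_real_diff)
  have hol: "(\<lambda>z. F z - H z) holomorphic_on ?B"
    by (intro holomorphic_intros holomorphic_on_subset[OF F] holomorphic_on_subset[OF H])
       (auto simp: e_def)
  have "complex_of_real x islimpt U"
    unfolding islimpt_approachable
  proof (intro allI impI)
    fix d :: real assume "d > 0"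
    then have "min d e > 0" using e by simp
    then obtain y where "f y = g y" "y \<noteq> x" "dist y x < min d e"
      using lim unfolding islimpt_approachable by blast
    then show "\<exists>x'\<in>U. x' \<noteq> complex_of_real x \<and> dist x' (complex_of_real x) < d"
      unfolding U_def by (intro bexI[of _ "complex_of_real y"]) (auto simp: dist_real_def dist_norm simp flip: of_real_diff)
  qed
  moreover have "U \<subseteq> ?B" unfolding U_def using inB by auto
  moreover have "F w - H w = 0" if "w \<in> U" for w
    using that Ff Hg unfolding U_def e_def by auto
  ultimately have 0: "F z - H z = 0" if "z \<in> ?B" for z
    using analytic_continuation[OF hol open_ball connected_ball, of U "complex_of_real x" z] that e by simp
  show ?thesis
  proof (intro exI[of _ e] conjI allI impI e)
    fix y assume y: "\<bar>y - x\<bar> < e"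
    then have "F (complex_of_real y) = H (complex_of_real y)" using 0[of "complex_of_real y"] inB[of y] by auto
    then show "f y = g y" using Ff[of y] Hg[of y] y by (simp add: e_def)
  qed
qed

lemma real_analytic_at_compose1:
  assumes f: "real_analytic_at f (g x)" and g: "real_analytic_at g x"
  shows "real_analytic_at (\<lambda>y. f (g y)) x"
proof -
  obtain F r where r: "r > 0" and F: "F holomorphic_on ball (complex_of_real (g x)) r"
    and Ff: "\<And>y. \<bar>y - g x\<bar> < r \<Longrightarrow> F (complex_of_real y) = complex_of_real (f y)"
    using f unfolding real_analytic_at_def by blast
  obtain H q where q: "q > 0" and H: "H holomorphic_on ball (complex_of_real x) q"
    and Hg: "\<And>y. \<bar>y - x\<bar> < q \<Longrightarrow> H (complex_of_real y) = complex_of_real (g y)"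
    using g unfolding real_analytic_at_def by blast
  have "isCont H (complex_of_real x)"
    using holomorphic_on_imp_continuous_on[OF H] q by (simp add: continuous_on_eq_continuous_at)
  moreover have Hx: "H (complex_of_real x) = complex_of_real (g x)" using Hg[of x] q by simp
  ultimately obtain e where e: "e > 0" "\<And>z. dist z (complex_of_real x) < e \<Longrightarrow> dist (H z) (complex_of_real (g x)) < r"
    using r unfolding continuous_at by (metis Hx continuous_at continuous_at_eps_delta)
  define d where "d = min e q"
  have "(F \<circ> H) holomorphic_on ball (complex_of_real x) d"
    using e(2) by (intro holomorphic_on_compose_gen[OF holomorphic_on_subset[OF H] F])
      (auto simp: d_def dist_commute)
  moreover have "(F \<circ> H) (complex_of_real y) = complex_of_real (f (g y))" if "\<bar>y - x\<bar> < d" for y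
  proof -
    have "dist (complex_of_real y) (complex_of_real x) < e"
      using that by (simp add: d_def dist_norm flip: of_real_diff)
    then have "dist (complex_of_real (g y)) (complex_of_real (g x)) < r"
      using e(2) Hg[of y] that by (metis d_def min_less_iff_conj)
    then show ?thesis
      using Ff[of "g y"] Hg[of y] that by (simp add: d_def dist_norm flip: of_real_diff)
  qed
  ultimately show ?thesis
    unfolding real_analytic_at_def using e q by (intro exI[of _ "F \<circ> H"] exI[of _ d]) (auto simp: d_def)
qed

text \<open>The complex derivative of the extension at x equals the real one, hence is nonzero, so
  the extension has a local holomorphic inverse. The point that needs care is that this inverse is
  real on the real axis near \<open>f x\<close>.\<close>

lemma real_analytic_at_inverse:
  assumes f: "real_analytic_at f x" and der: "(f has_real_derivative D) (at x)" and D: "D \<noteq> 0"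
  shows "\<exists>h. real_analytic_at h (f x) \<and> (\<exists>d>0. \<forall>y. \<bar>y - x\<bar> < d \<longrightarrow> h (f y) = y)"
proof -
  obtain F r where r: "r > 0" and F: "F holomorphic_on ball (complex_of_real x) r"
    and Ff: "\<And>y. \<bar>y - x\<bar> < r \<Longrightarrow> F (complex_of_real y) = complex_of_real (f y)"
    using f unfolding real_analytic_at_def by blast
  have inB: "complex_of_real y \<in> ball (complex_of_real x) s \<longleftrightarrow> \<bar>y - x\<bar> < s" for y s
    by (simp add: dist_norm abs_minus_commute flip: of_real_diff)
  have "(F has_field_derivative deriv F (complex_of_real x)) (at (complex_of_real x))"
    using F r by (intro holomorphic_derivI[OF F]) auto
  then have "((\<lambda>y. F (complex_of_real y)) has_vector_derivative deriv F (complex_of_real x)) (at x)"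
    using field_vector_diff_chain_at[of complex_of_real 1 x F] has_vector_derivative_of_real[OF DERIV_ident[of "at x"]]
    by (simp add: o_def)
  moreover have "((\<lambda>y. F (complex_of_real y)) has_vector_derivative complex_of_real D) (at x)"
  proof (rule has_vector_derivative_transform_within[where d = r])
    show "((\<lambda>y. complex_of_real (f y)) has_vector_derivative complex_of_real D) (at x)"
      using der by (rule has_vector_derivative_of_real)
  qed (use r Ff in \<open>auto simp: dist_real_def\<close>)
  ultimately have dF: "deriv F (complex_of_real x) = complex_of_real D"
    by (rule vector_derivative_unique_at)
  then obtain s where s: "s > 0" "ball (complex_of_real x) s \<subseteq> ball (complex_of_real x) r"
      "inj_on F (ball (complex_of_real x) s)"
    using has_complex_derivative_locally_injective[OF F] r D by (metis centre_in_ball open_ball of_real_eq_0_iff)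
  let ?B = "ball (complex_of_real x) s"
  have FB: "F holomorphic_on ?B" using F s(2) holomorphic_on_subset by blast
  obtain H where H: "H holomorphic_on (F ` ?B)" "\<And>z. z \<in> ?B \<Longrightarrow> H (F z) = z"
    using holomorphic_has_inverse[OF FB open_ball s(3)] by metis
  have "open (F ` ?B)" using open_mapping_thm3[OF FB open_ball s(3)] .
  moreover have "complex_of_real (f x) \<in> F ` ?B"
    using Ff[of x] r s(1) by (metis abs_zero centre_in_ball diff_self image_eqI)
  ultimately obtain q where q: "q > 0" "ball (complex_of_real (f x)) q \<subseteq> F ` ?B"
    by (meson open_contains_ball)
  have sr: "s \<le> r" using s(1,2) by (simp add: ball_subset_ball_iff)
  have Ffs: "F (complex_of_real y) = complex_of_real (f y)" if "\<bar>y - x\<bar> < s" for y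
    using Ff that sr by auto
  let ?I = "{x-s<..<x+s}"
  have fc: "continuous_on ?I f"
  proof -
    have "continuous_on ?I (\<lambda>y. Re (F (complex_of_real y)))"
      using inB by (intro continuous_intros continuous_on_compose2[OF holomorphic_on_imp_continuous_on[OF FB]])
        (auto simp del: mem_ball)
    then show ?thesis
      by (rule continuous_on_eq) (use Ffs in auto)
  qed
  have fi: "inj_on f ?I"
  proof (rule inj_onI)
    fix a b assume ab: "a \<in> ?I" "b \<in> ?I" "f a = f b"
    then have d: "\<bar>a - x\<bar> < s" "\<bar>b - x\<bar> < s" by auto
    have "F (complex_of_real a) = F (complex_of_real b)" using Ffs[OF d(1)] Ffs[OF d(2)] ab(3) by simp
    moreover have "complex_of_real a \<in> ?B" "complex_of_real b \<in> ?B" using d by (simp_all only: inB)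
    ultimately have "complex_of_real a = complex_of_real b" using s(3) by (meson inj_onD)
    then show "a = b" by simp
  qed
  \<comment> \<open>An injective continuous function on an open interval is open, so every real
    number near \<open>f x\<close> is a value of f at a real point; the complex inverse takes that
    real point as its value.\<close>
  have "open (f ` ?I)"
    using injective_eq_1d_open_map_UNIV[OF fc is_interval_oo, THEN iffD1, OF fi, rule_format, of ?I] by simp
  moreover have "f x \<in> f ` ?I" using s(1) by auto
  ultimately obtain q' where q': "q' > 0" "ball (f x) q' \<subseteq> f ` ?I"
    by (meson open_contains_ball)
  define h where "h = (\<lambda>y. Re (H (complex_of_real y)))"
  have hf: "h (f y) = y" if "y \<in> ?I" for y
  proof -
    have d: "\<bar>y - x\<bar> < s" using that by auto
    then show ?thesis using H(2)[of "complex_of_real y"] Ffs[OF d] inB[of y s] by (simp only: h_def Re_complex_of_real)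
  qed
  have "real_analytic_at h (f x)"
    unfolding real_analytic_at_def
  proof (intro exI[of _ H] exI[of _ "min q q'"] conjI allI impI)
    show "0 < min q q'" using q q' by simp
    show "H holomorphic_on ball (complex_of_real (f x)) (min q q')"
      using holomorphic_on_subset[OF H(1)] q(2) by (auto simp: subset_iff)
    fix w assume "\<bar>w - f x\<bar> < min q q'"
    then have "w \<in> ball (f x) q'" by (auto simp: dist_real_def)
    then obtain y where y: "y \<in> ?I" "w = f y" using q'(2) by blast
    have d: "\<bar>y - x\<bar> < s" using y(1) by auto
    have "H (complex_of_real w) = complex_of_real y"
      using H(2)[of "complex_of_real y"] Ffs[OF d] y(2) inB[of y s] d by (simp only:)
    then show "H (complex_of_real w) = complex_of_real (h w)" by (simp add: h_def)
  qed
  moreover have "\<forall>y. \<bar>y - x\<bar> < s \<longrightarrow> h (f y) = y"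
  proof (intro allI impI hf)
    show "y \<in> ?I" if "\<bar>y - x\<bar> < s" for y using that by auto
  qed
  ultimately show ?thesis using s(1) by blast
qed

lemma real_analytic_at_cong:
  assumes "real_analytic_at f x" and "d > 0" "\<And>y. \<bar>y - x\<bar> < d \<Longrightarrow> g y = f y"
  shows "real_analytic_at g x"
proof -
  obtain F r where r: "r > 0" and F: "F holomorphic_on ball (complex_of_real x) r"
    and Ff: "\<And>y. \<bar>y - x\<bar> < r \<Longrightarrow> F (complex_of_real y) = complex_of_real (f y)"
    using assms(1) unfolding real_analytic_at_def by blast
  show ?thesis
    unfolding real_analytic_at_def
    using r F Ff assms(2,3)
    by (intro exI[of _ F] exI[of _ "min r d"]) (auto intro: holomorphic_on_subset)
qed

text \<open>The sign covers the increasing and the decreasing case at once. In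
  \<open>pull_germ\<close> it becomes the direction of the germ found there.\<close>

lemma injective_continuous_strict_mono:
  fixes f :: "real \<Rightarrow> real"
  assumes c: "continuous_on {a..b} f" and i: "inj_on f {a..b}" and ab: "a < b"
  shows "\<exists>s\<in>{1, -1}. strict_mono_on {a..b} (\<lambda>x. s * f x)"
proof -
  have ne: "f a \<noteq> f b" using inj_on_eq_iff[OF i, of a b] ab by auto
  define s where "s = (if f a < f b then 1 else - 1 :: real)"
  define h where "h = (\<lambda>x. s * f x)"
  have hab: "h a < h b" using ne by (auto simp: h_def s_def)
  have hc: "continuous_on {a..b} h" unfolding h_def by (intro continuous_intros c)
  have "s \<noteq> 0" by (simp add: s_def)
  then have hi: "inj_on h {a..b}" using i unfolding h_def inj_on_def by simp
  have mid: "h u < h x \<and> h x < h v \<or> h v < h x \<and> h x < h u"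
    if "a \<le> u" "u < x" "x < v" "v \<le> b" for u x v
    using continuous_inj_imp_mono[OF that(2,3) continuous_on_subset[OF hc] inj_on_subset[OF hi]] that by auto
  have le: "h a < h x" if "a < x" "x \<le> b" for x
    using mid[of a x b] that hab by (cases "x = b") auto
  have "strict_mono_on {a..b} h"
  proof (rule strict_mono_onI)
    fix x y assume xy: "x \<in> {a..b}" "y \<in> {a..b}" "x < y"
    show "h x < h y"
    proof (cases "x = a")
      case True then show ?thesis using le xy by auto
    next
      case False
      then show ?thesis using mid[of a x y] le[of y] le[of x] xy by auto
    qed
  qed
  moreover have "s \<in> {1, -1}" by (simp add: s_def)
  ultimately show ?thesis unfolding h_def by blast
qed

subsection \<open>Parametrized submanifolds\<close>

text \<open>The map \<open>\<pi>\<close> treats both types of S alike: D is the parameter interval of S, or the real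
  line covering the circle.  Its relevant properties are local injectivity and those that
  express segments, their interiors and their boundaries by parameters.\<close>

locale arc_setting =
  fixes G :: "('g, 'b) monoid_scheme" (structure)
    and M :: "'m manifold"
    and S :: "'s manifold"
    and \<phi> :: "'g \<Rightarrow> 'm \<Rightarrow> 'm"
    and \<iota> :: "'s \<Rightarrow> 'm"
    and D :: "real set"
    and \<pi> :: "real \<Rightarrow> 's"
  assumes action: "group_action G (points M) \<phi>"
    and man: "analytic_manifold M"
    and act_analytic: "g \<in> carrier G \<Longrightarrow> analytic_map M M (\<phi> g)"
    and sub: "analytic_submanifold1 S M \<iota>"
    and interval: "is_interval D"
    and pi_continuous: "continuous_map (top_of_set D) (mtop S) \<pi>"
    and pi_image: "\<pi> ` D = points S"
    and pi_local_inj: "\<exists>r>0. \<forall>t\<in>D. \<forall>u\<in>D. \<bar>t - u\<bar> < r \<longrightarrow> \<pi> t = \<pi> u \<longrightarrow> t = u"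
    and pi_open: "open U \<Longrightarrow> U \<subseteq> D \<Longrightarrow> openin (mtop S) (\<pi> ` U)"
    and connected_germ: "segment S C \<Longrightarrow> t \<in> D \<Longrightarrow> \<pi> t \<in> C \<Longrightarrow>
          \<exists>s\<in>{1, -1}. \<exists>e>0. \<forall>u\<in>{0..e}. t + s * u \<in> D \<and> \<pi> (t + s * u) \<in> C"
    and compact_segment: "segment S A \<Longrightarrow> compactin (mtop S) A \<Longrightarrow> A \<noteq> points S \<Longrightarrow>
          \<exists>p q. p \<noteq> q \<and> closed_segment p q \<subseteq> D \<and> A = \<pi> ` closed_segment p q \<and> inj_on \<pi> (closed_segment p q)"
    and seg_bd_arc: "p \<noteq> q \<Longrightarrow> closed_segment p q \<subseteq> D \<Longrightarrow> inj_on \<pi> (closed_segment p q) \<Longrightarrow>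
          seg_bd S (\<pi> ` closed_segment p q) = {\<pi> p, \<pi> q}"
    and seg_int_nbhd: "t \<in> D \<Longrightarrow> \<pi> t \<in> seg_int S A \<Longrightarrow> \<exists>e>0. \<forall>u. \<bar>u - t\<bar> < e \<longrightarrow> u \<in> D \<and> \<pi> u \<in> A"
    and interior_seg_int: "t \<in> interior D \<Longrightarrow> \<pi> t \<in> seg_int S (points S)"
    and extend_arc: "p \<noteq> q \<Longrightarrow> closed_segment p q \<subseteq> D \<Longrightarrow> inj_on \<pi> (closed_segment p q) \<Longrightarrow> q \<in> interior D \<Longrightarrow>
          \<exists>e>0. closed_segment p (q + sgn (q - p) * e) \<subseteq> D \<and> inj_on \<pi> (closed_segment p (q + sgn (q - p) * e))"
begin

definition c :: "real \<Rightarrow> 'm" where "c t = \<iota> (\<pi> t)"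

lemma mdim_S: "mdim S = 1" and manifold_S: "manifold_modelled_on (half_space 1) S"
  and iota_analytic: "analytic_map S M \<iota>" and iota_immersion: "analytic_immersion1 S M \<iota>"
  and iota_inj: "inj_on \<iota> (points S)"
  using sub unfolding analytic_submanifold1_def analytic_manifold_with_boundary_def analytic_immersion1_def
  by auto

lemma iota_continuous: "continuous_map (mtop S) (mtop M) \<iota>"
  using iota_analytic unfolding analytic_map_def by blast

lemma Hausdorff_M: "Hausdorff_space (mtop M)"
  using man unfolding analytic_manifold_def manifold_modelled_on_def by blast

lemma act_continuous: "g \<in> carrier G \<Longrightarrow> continuous_map (mtop M) (mtop M) (\<phi> g)"
  using act_analytic unfolding analytic_map_def by blast

lemma iota_points: "z \<in> points S \<Longrightarrow> \<iota> z \<in> points M"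
  using iota_continuous by (auto simp: continuous_map_def)

lemma pi_points: "t \<in> D \<Longrightarrow> \<pi> t \<in> points S"
  using pi_image by blast

lemma c_points: "t \<in> D \<Longrightarrow> c t \<in> points M"
  using pi_points iota_points by (simp add: c_def)

lemma c_continuous: "continuous_map (top_of_set D) (mtop M) c"
  using continuous_map_compose[OF pi_continuous iota_continuous] by (simp add: c_def[abs_def] o_def)

lemma c_eq_iff: "t \<in> D \<Longrightarrow> u \<in> D \<Longrightarrow> c t = c u \<longleftrightarrow> \<pi> t = \<pi> u"
  unfolding c_def by (rule inj_on_eq_iff[OF iota_inj pi_points pi_points])

lemma group_G: "group G"
  using action by (simp add: group_action_def group_hom_def)

lemma act_mult: "g \<in> carrier G \<Longrightarrow> h \<in> carrier G \<Longrightarrow> x \<in> points M \<Longrightarrow> \<phi> (g \<otimes> h) x = \<phi> g (\<phi> h x)"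
  using group_action.composition_rule[OF action] by metis

lemma act_one: "x \<in> points M \<Longrightarrow> \<phi> \<one> x = x"
  using group_action.id_eq_one[OF action] by (metis restrict_apply')

lemma act_inv:
  assumes "g \<in> carrier G" "x \<in> points M"
  shows "\<phi> (inv g) (\<phi> g x) = x" "\<phi> g (\<phi> (inv g) x) = x"
  using assms act_mult[of "inv g" g x] act_mult[of g "inv g" x] act_one[of x]
    group.l_inv[OF group_G] group.r_inv[OF group_G] group.inv_closed[OF group_G]
  by auto

lemma act_inj: "g \<in> carrier G \<Longrightarrow> x \<in> points M \<Longrightarrow> y \<in> points M \<Longrightarrow> \<phi> g x = \<phi> g y \<longleftrightarrow> x = y"
  using act_inv(1) by metis

lemma chart_S:
  assumes "z \<in> points S"
  obtains U \<kappa> where "(U, \<kappa>) \<in> charts S" "z \<in> U" "openin (mtop S) U" "inj_on \<kappa> U"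
    "continuous_map (subtopology (mtop S) U) (powertop_real UNIV) \<kappa>"
    "\<And>w. w \<in> U \<Longrightarrow> \<kappa> w = line_point (\<kappa> w 0)"
proof -
  obtain U \<kappa> where U: "(U, \<kappa>) \<in> charts S" "z \<in> U"
    using manifold_S assms unfolding manifold_modelled_on_def by blast
  then have ch: "is_chart (half_space 1) (mtop S) U \<kappa>"
    using manifold_S unfolding manifold_modelled_on_def by blast
  then have opU: "openin (mtop S) U" and opI: "openin (half_space 1) (\<kappa> ` U)"
    and hom: "homeomorphic_map (subtopology (mtop S) U) (subtopology (half_space 1) (\<kappa> ` U)) \<kappa>"
    unfolding is_chart_def by auto
  have top: "topspace (subtopology (mtop S) U) = U"
    using openin_subset[OF opU] by (simp add: Int_absorb1)
  have "inj_on \<kappa> U"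
    using homeomorphic_imp_injective_map[OF hom] top by simp
  moreover have "continuous_map (subtopology (mtop S) U) (powertop_real UNIV) \<kappa>"
    using homeomorphic_imp_continuous_map[OF hom]
    by (simp add: half_space_def Euclidean_space_def continuous_map_in_subtopology)
  moreover have "\<kappa> w = line_point (\<kappa> w 0)" if "w \<in> U" for w
  proof -
    have "\<kappa> w \<in> topspace (half_space 1)" using openin_subset[OF opI] that by blast
    then have "\<forall>i\<ge>1. \<kappa> w i = 0" by (simp add: half_space_def topspace_Euclidean_space)
    then show ?thesis by (auto simp: line_point_def fun_eq_iff)
  qed
  ultimately show ?thesis using that U opU by blast
qed

lemma chart_M:
  assumes "x \<in> points M"
  obtains V \<psi> where "(V, \<psi>) \<in> charts M" "x \<in> V" "openin (mtop M) V" "inj_on \<psi> V"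
    "\<psi> ` V \<subseteq> topspace (Euclidean_space (mdim M))"
proof -
  have m: "manifold_modelled_on (Euclidean_space (mdim M)) M"
    using man by (simp add: analytic_manifold_def)
  obtain V \<psi> where V: "(V, \<psi>) \<in> charts M" "x \<in> V"
    using m assms unfolding manifold_modelled_on_def by blast
  then have ch: "is_chart (Euclidean_space (mdim M)) (mtop M) V \<psi>"
    using m unfolding manifold_modelled_on_def by blast
  then have opV: "openin (mtop M) V" and opI: "openin (Euclidean_space (mdim M)) (\<psi> ` V)"
    and hom: "homeomorphic_map (subtopology (mtop M) V) (subtopology (Euclidean_space (mdim M)) (\<psi> ` V)) \<psi>"
    unfolding is_chart_def by auto
  have top: "topspace (subtopology (mtop M) V) = V"
    using openin_subset[OF opV] by (simp add: Int_absorb1)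
  have "inj_on \<psi> V"
    using homeomorphic_imp_injective_map[OF hom] top by simp
  then show ?thesis using that V opV openin_subset[OF opI] by blast
qed

lemma near_open:
  assumes f: "continuous_map (top_of_set D) X f" and W: "openin X W" "f t \<in> W"
    and t: "t \<in> interior D" and s: "s \<in> {1, -1 :: real}"
  shows "\<exists>d>0. \<forall>u. \<bar>u\<bar> < d \<longrightarrow> t + s * u \<in> D \<and> f (t + s * u) \<in> W"
proof -
  have "openin (top_of_set D) {x \<in> D. f x \<in> W}"
    using openin_continuous_map_preimage[OF f W(1)] by simp
  then obtain T where T: "open T" "{x \<in> D. f x \<in> W} = D \<inter> T"
    by (metis openin_open)
  have "t \<in> interior D \<inter> T" using t T(2) W(2) interior_subset by blast
  then obtain d where d: "d > 0" "ball t d \<subseteq> interior D \<inter> T"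
    using T(1) by (meson open_Int open_interior open_contains_ball)
  have "t + s * u \<in> D \<and> f (t + s * u) \<in> W" if "\<bar>u\<bar> < d" for u
  proof -
    have "t + s * u \<in> ball t d" using that s by (auto simp: dist_real_def abs_mult)
    then show ?thesis using d(2) T(2) interior_subset by blast
  qed
  then show ?thesis using d(1) by blast
qed

text \<open>Although the charts of S take values in a half-line, near an interior parameter the
  coordinate of the arc covers an open interval.\<close>

lemma chart_coordinate:
  assumes t: "t \<in> interior D" and s: "s \<in> {1, -1}"
  obtains U \<kappa> k e where "(U, \<kappa>) \<in> charts S" "inj_on \<kappa> U" "e > 0"
    "\<And>u. \<bar>u\<bar> < e \<Longrightarrow> t + s * u \<in> D \<and> \<pi> (t + s * u) \<in> U"
    "\<And>u. \<bar>u\<bar> < e \<Longrightarrow> \<kappa> (\<pi> (t + s * u)) = line_point (k u)"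
    "\<And>u. \<bar>u\<bar> < e \<Longrightarrow> inv_into U \<kappa> (line_point (k u)) = \<pi> (t + s * u)"
    "continuous_on {-e<..<e} k" "inj_on k {-e<..<e}"
    "\<And>d. 0 < d \<Longrightarrow> d \<le> e \<Longrightarrow> \<exists>r>0. ball (k 0) r \<subseteq> k ` {-d<..<d}"
proof -
  have tD: "t \<in> D" using t interior_subset by blast
  obtain U \<kappa> where U: "(U, \<kappa>) \<in> charts S" "\<pi> t \<in> U" "openin (mtop S) U" "inj_on \<kappa> U"
    "continuous_map (subtopology (mtop S) U) (powertop_real UNIV) \<kappa>"
    and line: "\<And>w. w \<in> U \<Longrightarrow> \<kappa> w = line_point (\<kappa> w 0)"
    using chart_S[OF pi_points[OF tD]] by metis
  obtain d where d: "d > 0" "\<And>u. \<bar>u\<bar> < d \<Longrightarrow> t + s * u \<in> D \<and> \<pi> (t + s * u) \<in> U"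
    using near_open[OF pi_continuous U(3) U(2) t s] by blast
  obtain r where r: "r > 0" "\<And>t u. t \<in> D \<Longrightarrow> u \<in> D \<Longrightarrow> \<bar>t - u\<bar> < r \<Longrightarrow> \<pi> t = \<pi> u \<Longrightarrow> t = u"
    using pi_local_inj by blast
  \<comment> \<open>Half of \<open>r\<close>, so that any two parameters within e of t are less than
    \<open>r\<close> apart and local injectivity of \<open>\<pi>\<close> applies to them.\<close>
  define e where "e = min d (r / 2)"
  define k where "k = (\<lambda>u. \<kappa> (\<pi> (t + s * u)) 0)"
  have e: "e > 0" "\<And>u. \<bar>u\<bar> < e \<Longrightarrow> t + s * u \<in> D \<and> \<pi> (t + s * u) \<in> U"
    using d r by (auto simp: e_def)
  have kk: "\<kappa> (\<pi> (t + s * u)) = line_point (k u)" if "\<bar>u\<bar> < e" for u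
    using line e(2)[OF that] by (auto simp: k_def)
  have inv: "inv_into U \<kappa> (line_point (k u)) = \<pi> (t + s * u)" if "\<bar>u\<bar> < e" for u
    using inv_into_f_f[OF U(4)] e(2)[OF that] kk[OF that] by metis
  have "continuous_map (top_of_set {-e<..<e}) (top_of_set D) (\<lambda>u. t + s * u)"
    using e(2) by (auto simp: intro!: continuous_intros)
  then have "continuous_map (top_of_set {-e<..<e}) (mtop S) (\<lambda>u. \<pi> (t + s * u))"
    by (rule continuous_map_compose[OF _ pi_continuous, unfolded o_def])
  then have "continuous_map (top_of_set {-e<..<e}) (subtopology (mtop S) U) (\<lambda>u. \<pi> (t + s * u))"
    using e(2) by (auto simp: continuous_map_in_subtopology)
  then have "continuous_map (top_of_set {-e<..<e}) (powertop_real UNIV) (\<lambda>u. \<kappa> (\<pi> (t + s * u)))"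
    by (rule continuous_map_compose[OF _ U(5), unfolded o_def])
  then have kc: "continuous_on {-e<..<e} k"
    by (auto simp: k_def continuous_map_componentwise_UNIV)
  have ki: "inj_on k {-e<..<e}"
  proof (rule inj_onI)
    fix a b assume ab: "a \<in> {-e<..<e}" "b \<in> {-e<..<e}" "k a = k b"
    then have a: "\<bar>a\<bar> < e" and b: "\<bar>b\<bar> < e" by auto
    have "\<pi> (t + s * a) = \<pi> (t + s * b)" using inv[OF a] inv[OF b] ab(3) by metis
    moreover have "\<bar>(t + s * a) - (t + s * b)\<bar> < r" using a b s by (auto simp: e_def)
    ultimately have "t + s * a = t + s * b" using r(2) e(2)[OF a] e(2)[OF b] by blast
    then show "a = b" using s by auto
  qed
  have op: "\<exists>r>0. ball (k 0) r \<subseteq> k ` {-d<..<d}" if "0 < d" "d \<le> e" for d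
  proof -
    have "{-d<..<d} \<subseteq> {-e<..<e}" using that by auto
    \<comment> \<open>Injective continuous functions on open intervals are open maps. This makes a
      chart with values in the half-line as good as an interior chart around the given
      parameter.\<close>
    then have "open (k ` {-d<..<d})"
      using injective_eq_1d_open_map_UNIV[OF kc is_interval_oo, THEN iffD1, OF ki, rule_format, of "{-d<..<d}"] by simp
    moreover have "k 0 \<in> k ` {-d<..<d}" using that by auto
    ultimately show ?thesis by (meson open_contains_ball)
  qed
  show ?thesis using that[OF U(1) U(4) e(1) e(2) kk inv kc ki op] by blast
qed

text \<open>Charts of S allow one-sided analyticity at the end of the half-line. The hypothesis that
  a full interval around x has its line points in the chart image reduces this to ordinary
  analyticity in one real variable.\<close>

lemma real_analytic_at_iota:
  assumes U: "(U, \<kappa>) \<in> charts S" "inj_on \<kappa> U" and V: "(V, \<psi>) \<in> charts M" and i: "i < mdim M"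
    and d: "d > 0" "\<And>y. \<bar>y - x\<bar> < d \<Longrightarrow> line_point y \<in> \<kappa> ` (U \<inter> \<iota> -` V)"
  shows "real_analytic_at (\<lambda>y. \<psi> (\<iota> (inv_into U \<kappa> (line_point y))) i) x"
proof (rule real_analytic_at_compose[where P = line_point and m = 1 and f = "\<lambda>t. \<psi> (\<iota> (inv_into U \<kappa> t)) i"])
  show "real_analytic_on 1 (\<kappa> ` (U \<inter> \<iota> -` V)) (\<lambda>t. \<psi> (\<iota> (inv_into U \<kappa> t)) i)"
    using iota_analytic U(1) V i mdim_S unfolding analytic_map_def by fastforce
  show "line_point x \<in> \<kappa> ` (U \<inter> \<iota> -` V)" using d(2)[of x] d(1) by simp
  show "real_analytic_at (\<lambda>t. line_point t j) x" if "j < 1" for j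
  proof -
    have "(\<lambda>t. line_point t j) = (\<lambda>t. t)" using that by (simp add: line_point_def)
    then show ?thesis by (simp only: real_analytic_at_ident)
  qed
  have "\<forall>(U, \<kappa>)\<in>charts S. is_chart (half_space 1) (mtop S) U \<kappa>"
    using manifold_S unfolding manifold_modelled_on_def by (elim conjE)
  then have "is_chart (half_space 1) (mtop S) U \<kappa>"
    using U(1) by auto
  then have "\<kappa> ` U \<subseteq> topspace (half_space 1)" unfolding is_chart_def using openin_subset by blast
  then show "\<kappa> ` (U \<inter> \<iota> -` V) \<subseteq> topspace (Euclidean_space 1)" by (auto simp: half_space_def)
qed (use d in auto)

text \<open>A chart \<open>V\<close> of M around the point before the move is inserted between
  \<open>\<iota>\<close> and \<open>\<phi> g\<close>: both maps are analytic in coordinates, and the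
  chart cancels against its inverse near x.\<close>

lemma real_analytic_at_moved_iota:
  assumes g: "g \<in> carrier G" and U: "(U, \<kappa>) \<in> charts S" "inj_on \<kappa> U"
    and V: "(V, \<psi>) \<in> charts M" "inj_on \<psi> V" "\<psi> ` V \<subseteq> topspace (Euclidean_space (mdim M))"
    and V': "(V', \<psi>') \<in> charts M" and i: "i < mdim M"
    and d: "d > 0" "\<And>y. \<bar>y - x\<bar> < d \<Longrightarrow> line_point y \<in> \<kappa> ` (U \<inter> \<iota> -` (V \<inter> \<phi> g -` V'))"
  shows "real_analytic_at (\<lambda>y. \<psi>' (\<phi> g (\<iota> (inv_into U \<kappa> (line_point y)))) i) x"
proof -
  define P where "P = (\<lambda>y. \<psi> (\<iota> (inv_into U \<kappa> (line_point y))))"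
  have in_V: "\<iota> (inv_into U \<kappa> (line_point y)) \<in> V \<inter> \<phi> g -` V'" if "\<bar>y - x\<bar> < d" for y
    using d(2)[OF that] inv_into_f_f[OF U(2)] by auto
  have "real_analytic_at (\<lambda>y. \<psi>' (\<phi> g (inv_into V \<psi> (P y))) i) x"
  proof (rule real_analytic_at_compose[where P = P and m = "mdim M" and f = "\<lambda>t. \<psi>' (\<phi> g (inv_into V \<psi> t)) i"])
    show "real_analytic_on (mdim M) (\<psi> ` (V \<inter> \<phi> g -` V')) (\<lambda>t. \<psi>' (\<phi> g (inv_into V \<psi> t)) i)"
      using act_analytic[OF g] V(1) V' i unfolding analytic_map_def by fastforce
    show "P x \<in> \<psi> ` (V \<inter> \<phi> g -` V')" using in_V[of x] d(1) by (simp add: P_def)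
    show "real_analytic_at (\<lambda>t. P t j) x" if "j < mdim M" for j
      unfolding P_def using d(2) by (intro real_analytic_at_iota[OF U V(1) that d(1)]) blast
    show "P y \<in> \<psi> ` (V \<inter> \<phi> g -` V')" if "\<bar>y - x\<bar> < d" for y
      using in_V[OF that] by (simp add: P_def)
  qed (use d V(3) in auto)
  moreover have "inv_into V \<psi> (P y) = \<iota> (inv_into U \<kappa> (line_point y))" if "\<bar>y - x\<bar> < d" for y
    using in_V[OF that] inv_into_f_f[OF V(2)] by (simp add: P_def)
  ultimately show ?thesis
    using d(1) by (auto intro: real_analytic_at_cong)
qed

subsection \<open>Germs and their continuation\<close>

text \<open>Directions s are 1 or -1: g carries the arc issuing from t in direction s to the arc issuing
  from t' in direction s', up to an increasing reparametrization.\<close>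

definition germ_map :: "'g \<Rightarrow> real \<Rightarrow> real \<Rightarrow> real \<Rightarrow> real \<Rightarrow> bool" where
  "germ_map g t s t' s' \<longleftrightarrow>
     (\<exists>e>0. \<exists>\<rho>. continuous_on {0..e} \<rho> \<and> strict_mono_on {0..e} \<rho> \<and> \<rho> 0 = 0 \<and>
        (\<forall>u\<in>{0..e}. t + s * u \<in> D \<and> t' + s' * \<rho> u \<in> D \<and> \<phi> g (c (t + s * u)) = c (t' + s' * \<rho> u)))"

definition germ_in :: "real \<Rightarrow> real \<Rightarrow> 's set \<Rightarrow> bool" where
  "germ_in t s A \<longleftrightarrow> (\<exists>e>0. \<forall>u\<in>{0..e}. t + s * u \<in> D \<and> \<pi> (t + s * u) \<in> A)"

lemma germ_mapI:
  assumes "e > 0" "continuous_on {0..e} \<rho>" "strict_mono_on {0..e} \<rho>" "\<rho> 0 = 0"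
    "\<And>u. u \<in> {0..e} \<Longrightarrow> t + s * u \<in> D" "\<And>u. u \<in> {0..e} \<Longrightarrow> t' + s' * \<rho> u \<in> D"
    "\<And>u. u \<in> {0..e} \<Longrightarrow> \<phi> g (c (t + s * u)) = c (t' + s' * \<rho> u)"
  shows "germ_map g t s t' s'"
  unfolding germ_map_def using assms by blast

lemma germ_mapE:
  assumes "germ_map g t s t' s'"
  obtains e \<rho> where "e > 0" "continuous_on {0..e} \<rho>" "strict_mono_on {0..e} \<rho>" "\<rho> 0 = 0"
    "\<And>u. u \<in> {0..e} \<Longrightarrow> t + s * u \<in> D" "\<And>u. u \<in> {0..e} \<Longrightarrow> t' + s' * \<rho> u \<in> D"
    "\<And>u. u \<in> {0..e} \<Longrightarrow> \<phi> g (c (t + s * u)) = c (t' + s' * \<rho> u)"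
  using assms unfolding germ_map_def by (elim exE conjE) blast

lemma reparam_small:
  assumes "e > 0" "continuous_on {0..e} \<rho>" "strict_mono_on {0..e} \<rho>" "\<rho> 0 = (0::real)" "d > 0"
  obtains e' where "e' > 0" "e' \<le> (e::real)" "\<And>u. u \<in> {0..e'} \<Longrightarrow> \<rho> u \<in> {0..d}"
proof -
  have mono: "\<rho> u \<le> \<rho> v" if "u \<in> {0..e}" "v \<in> {0..e}" "u \<le> v" for u v
    using strict_mono_onD[OF assms(3), of u v] that by (cases "u = v") auto
  have "\<forall>\<epsilon>>0. \<exists>r>0. \<forall>x\<in>{0..e}. dist x 0 < r \<longrightarrow> dist (\<rho> x) (\<rho> 0) < \<epsilon>"
    using assms(2) unfolding continuous_on_iff by (rule bspec) (use assms(1) in simp)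
  then obtain r where r: "r > 0" "\<And>x. x \<in> {0..e} \<Longrightarrow> dist x 0 < r \<Longrightarrow> dist (\<rho> x) (\<rho> 0) < d"
    using assms(5) by blast
  define e' where "e' = min e (r / 2)"
  have e': "e' > 0" "e' \<le> e" "e' < r" using r(1) assms(1) by (auto simp: e'_def)
  show ?thesis
  proof (rule that[OF e'(1,2)])
    fix u assume u: "u \<in> {0..e'}"
    then have "dist (\<rho> u) (\<rho> 0) < d" using r(2)[of u] e' by auto
    moreover have "0 \<le> \<rho> u" using mono[of 0 u] u e' assms(4) by auto
    ultimately show "\<rho> u \<in> {0..d}" using assms(4) by (auto simp: dist_real_def)
  qed
qed

lemma germ_map_points:
  assumes "germ_map g t s t' s'"
  shows "t \<in> D" "t' \<in> D" "\<phi> g (c t) = c t'"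
proof -
  obtain e \<rho> where "e > 0" "\<rho> 0 = 0"
    "\<And>u. u \<in> {0..e} \<Longrightarrow> t + s * u \<in> D" "\<And>u. u \<in> {0..e} \<Longrightarrow> t' + s' * \<rho> u \<in> D"
    "\<And>u. u \<in> {0..e} \<Longrightarrow> \<phi> g (c (t + s * u)) = c (t' + s' * \<rho> u)"
    using germ_mapE[OF assms] by metis
  from this(1,2) this(3-5)[of 0] show "t \<in> D" "t' \<in> D" "\<phi> g (c t) = c t'" by auto
qed

lemma germ_map_comp:
  assumes gh: "germ_map g t s t' s'" "germ_map h t' s' t'' s''" and G: "g \<in> carrier G" "h \<in> carrier G"
  shows "germ_map (h \<otimes> g) t s t'' s''"
proof -
  obtain e \<rho> where 1: "e > 0" "continuous_on {0..e} \<rho>" "strict_mono_on {0..e} \<rho>" "\<rho> 0 = 0"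
    "\<And>u. u \<in> {0..e} \<Longrightarrow> t + s * u \<in> D" "\<And>u. u \<in> {0..e} \<Longrightarrow> t' + s' * \<rho> u \<in> D"
    "\<And>u. u \<in> {0..e} \<Longrightarrow> \<phi> g (c (t + s * u)) = c (t' + s' * \<rho> u)"
    using germ_mapE[OF gh(1)] by metis
  obtain d \<sigma> where 2: "d > 0" "continuous_on {0..d} \<sigma>" "strict_mono_on {0..d} \<sigma>" "\<sigma> 0 = 0"
    "\<And>u. u \<in> {0..d} \<Longrightarrow> t' + s' * u \<in> D" "\<And>u. u \<in> {0..d} \<Longrightarrow> t'' + s'' * \<sigma> u \<in> D"
    "\<And>u. u \<in> {0..d} \<Longrightarrow> \<phi> h (c (t' + s' * u)) = c (t'' + s'' * \<sigma> u)"
    using germ_mapE[OF gh(2)] by metis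
  obtain e' where e': "e' > 0" "e' \<le> e" "\<And>u. u \<in> {0..e'} \<Longrightarrow> \<rho> u \<in> {0..d}"
    using reparam_small[OF 1(1-4) 2(1)] by blast
  have sub: "{0..e'} \<subseteq> {0..e}" using e' by auto
  show ?thesis
  proof (rule germ_mapI[of e' "\<lambda>u. \<sigma> (\<rho> u)"])
    show "continuous_on {0..e'} (\<lambda>u. \<sigma> (\<rho> u))"
      using e'(3) by (intro continuous_on_compose2[OF 2(2)] continuous_on_subset[OF 1(2) sub]) auto
    show "strict_mono_on {0..e'} (\<lambda>u. \<sigma> (\<rho> u))"
    proof (rule strict_mono_onI)
      fix x y assume xy: "x \<in> {0..e'}" "y \<in> {0..e'}" "x < y"
      then have "\<rho> x < \<rho> y" using strict_mono_onD[OF 1(3)] sub by blast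
      then show "\<sigma> (\<rho> x) < \<sigma> (\<rho> y)" using strict_mono_onD[OF 2(3)] e'(3) xy by blast
    qed
    show "\<phi> (h \<otimes> g) (c (t + s * u)) = c (t'' + s'' * \<sigma> (\<rho> u))" if "u \<in> {0..e'}" for u
      using act_mult[OF G(2,1) c_points[OF 1(5)[of u]]] 1(7)[of u] 2(7)[OF e'(3)[OF that]] sub that by auto
    show "t + s * u \<in> D" if "u \<in> {0..e'}" for u using 1(5) sub that by blast
    show "t'' + s'' * \<sigma> (\<rho> u) \<in> D" if "u \<in> {0..e'}" for u using 2(6)[OF e'(3)[OF that]] .
  qed (use e' 1 2 in auto)
qed

lemma germ_map_inv:
  assumes gm: "germ_map g t s t' s'" and G: "g \<in> carrier G"
  shows "germ_map (inv g) t' s' t s"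
proof -
  obtain e \<rho> where 1: "e > 0" "continuous_on {0..e} \<rho>" "strict_mono_on {0..e} \<rho>" "\<rho> 0 = 0"
    "\<And>u. u \<in> {0..e} \<Longrightarrow> t + s * u \<in> D" "\<And>u. u \<in> {0..e} \<Longrightarrow> t' + s' * \<rho> u \<in> D"
    "\<And>u. u \<in> {0..e} \<Longrightarrow> \<phi> g (c (t + s * u)) = c (t' + s' * \<rho> u)"
    using germ_mapE[OF gm] by metis
  have inj: "inj_on \<rho> {0..e}" using 1(3) by (rule strict_mono_on_imp_inj_on)
  have pos: "\<rho> e > 0" using strict_mono_onD[OF 1(3), of 0 e] 1(1,4) by auto
  have img: "{0..\<rho> e} \<subseteq> \<rho> ` {0..e}"
  proof
    fix y assume "y \<in> {0..\<rho> e}"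
    then show "y \<in> \<rho> ` {0..e}" using IVT'[of \<rho> 0 y e] 1(1,2,4) by auto
  qed
  define \<sigma> where "\<sigma> = the_inv_into {0..e} \<rho>"
  have s1: "\<sigma> y \<in> {0..e}" "\<rho> (\<sigma> y) = y" if "y \<in> {0..\<rho> e}" for y
  proof -
    have "y \<in> \<rho> ` {0..e}" using img that by blast
    then show "\<sigma> y \<in> {0..e}" "\<rho> (\<sigma> y) = y"
      unfolding \<sigma>_def using the_inv_into_into[OF inj _ order.refl] f_the_inv_into_f[OF inj] by blast+
  qed
  have s2: "\<sigma> (\<rho> u) = u" if "u \<in> {0..e}" for u
    using the_inv_into_f_f[OF inj that] by (simp add: \<sigma>_def)
  show ?thesis
  proof (rule germ_mapI[of "\<rho> e" \<sigma>])
    show "continuous_on {0..\<rho> e} \<sigma>"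
      unfolding \<sigma>_def using continuous_on_subset[OF continuous_on_inv_into[OF 1(2) compact_Icc inj] img] .
    show "strict_mono_on {0..\<rho> e} \<sigma>"
    proof (rule strict_mono_onI)
      fix x y assume xy: "x \<in> {0..\<rho> e}" "y \<in> {0..\<rho> e}" "x < y"
      show "\<sigma> x < \<sigma> y"
      proof (rule ccontr)
        assume "\<not> \<sigma> x < \<sigma> y"
        then have "\<sigma> y = \<sigma> x \<or> \<sigma> y < \<sigma> x" by auto
        then have "\<rho> (\<sigma> y) \<le> \<rho> (\<sigma> x)" using strict_mono_onD[OF 1(3), of "\<sigma> y" "\<sigma> x"] s1(1) xy by fastforce
        then show False using s1(2) xy by simp
      qed
    qed
    show "\<sigma> 0 = 0" using s2[of 0] 1(1,4) by simp
    fix u assume u: "u \<in> {0..\<rho> e}"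
    show "t' + s' * u \<in> D" using 1(6)[OF s1(1)[OF u]] s1(2)[OF u] by simp
    show tD: "t + s * \<sigma> u \<in> D" using 1(5)[OF s1(1)[OF u]] .
    have "\<phi> g (c (t + s * \<sigma> u)) = c (t' + s' * u)" using 1(7)[OF s1(1)[OF u]] s1(2)[OF u] by simp
    then show "\<phi> (inv g) (c (t' + s' * u)) = c (t + s * \<sigma> u)"
      using act_inv(1)[OF G c_points[OF tD]] by simp
  qed (rule pos)
qed

text \<open>The arc in a chart around the image point is an immersion, so one of its coordinates
  is invertible there; composing its inverse with that coordinate of the moved arc gives an
  analytic reparametrization, which by the identity theorem is valid on both sides.\<close>

theorem germ_map_extend:
  assumes gm: "germ_map g t s t' s'" and G: "g \<in> carrier G"
    and t: "t \<in> interior D" and t': "t' \<in> interior D"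
    and s: "s \<in> {1, -1}" and s': "s' \<in> {1, -1}"
  shows "germ_map g t (- s) t' (- s')"
proof -
  obtain e \<rho> where gm: "e > 0" "continuous_on {0..e} \<rho>" "strict_mono_on {0..e} \<rho>" "\<rho> 0 = 0"
    "\<And>u. u \<in> {0..e} \<Longrightarrow> t + s * u \<in> D" "\<And>u. u \<in> {0..e} \<Longrightarrow> t' + s' * \<rho> u \<in> D"
    "\<And>u. u \<in> {0..e} \<Longrightarrow> \<phi> g (c (t + s * u)) = c (t' + s' * \<rho> u)"
    using germ_mapE[OF gm] by metis
  have tD: "t \<in> D" "t' \<in> D" using t t' interior_subset by auto
  have gct: "\<phi> g (c t) = c t'" using gm(1,4) gm(7)[of 0] by simp
  obtain U \<kappa> k e1 where K: "(U, \<kappa>) \<in> charts S" "inj_on \<kappa> U" "e1 > 0"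
    "\<And>u. \<bar>u\<bar> < e1 \<Longrightarrow> t + s * u \<in> D \<and> \<pi> (t + s * u) \<in> U"
    "\<And>u. \<bar>u\<bar> < e1 \<Longrightarrow> \<kappa> (\<pi> (t + s * u)) = line_point (k u)"
    "\<And>u. \<bar>u\<bar> < e1 \<Longrightarrow> inv_into U \<kappa> (line_point (k u)) = \<pi> (t + s * u)"
    "continuous_on {-e1<..<e1} k" "inj_on k {-e1<..<e1}"
    "\<And>d. 0 < d \<Longrightarrow> d \<le> e1 \<Longrightarrow> \<exists>r>0. ball (k 0) r \<subseteq> k ` {-d<..<d}"
    using chart_coordinate[OF t s] by metis
  obtain U' \<kappa>' k' e2 where K': "(U', \<kappa>') \<in> charts S" "inj_on \<kappa>' U'" "e2 > 0"
    "\<And>u. \<bar>u\<bar> < e2 \<Longrightarrow> t' + s' * u \<in> D \<and> \<pi> (t' + s' * u) \<in> U'"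
    "\<And>u. \<bar>u\<bar> < e2 \<Longrightarrow> \<kappa>' (\<pi> (t' + s' * u)) = line_point (k' u)"
    "\<And>u. \<bar>u\<bar> < e2 \<Longrightarrow> inv_into U' \<kappa>' (line_point (k' u)) = \<pi> (t' + s' * u)"
    "continuous_on {-e2<..<e2} k'" "inj_on k' {-e2<..<e2}"
    "\<And>d. 0 < d \<Longrightarrow> d \<le> e2 \<Longrightarrow> \<exists>r>0. ball (k' 0) r \<subseteq> k' ` {-d<..<d}"
    using chart_coordinate[OF t' s'] by metis
  obtain V \<psi> where V: "(V, \<psi>) \<in> charts M" "c t' \<in> V" "openin (mtop M) V" "inj_on \<psi> V"
    "\<psi> ` V \<subseteq> topspace (Euclidean_space (mdim M))"
    using chart_M[OF c_points[OF tD(2)]] by metis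
  obtain V0 \<psi>0 where V0: "(V0, \<psi>0) \<in> charts M" "c t \<in> V0" "openin (mtop M) V0" "inj_on \<psi>0 V0"
    "\<psi>0 ` V0 \<subseteq> topspace (Euclidean_space (mdim M))"
    using chart_M[OF c_points[OF tD(1)]] by metis
  have gc: "continuous_map (top_of_set D) (mtop M) (\<lambda>u. \<phi> g (c u))"
    using continuous_map_compose[OF c_continuous act_continuous[OF G]] by (simp add: o_def)
  obtain d1 where d1: "d1 > 0" "\<And>u. \<bar>u\<bar> < d1 \<Longrightarrow> \<phi> g (c (t + s * u)) \<in> V"
    using near_open[OF gc V(3) _ t s] V(2) gct by auto
  obtain d2 where d2: "d2 > 0" "\<And>u. \<bar>u\<bar> < d2 \<Longrightarrow> c (t + s * u) \<in> V0"
    using near_open[OF c_continuous V0(3,2) t s] by auto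
  obtain d3 where d3: "d3 > 0" "\<And>u. \<bar>u\<bar> < d3 \<Longrightarrow> c (t' + s' * u) \<in> V"
    using near_open[OF c_continuous V(3,2) t' s'] by auto
  define \<gamma> where "\<gamma> = (\<lambda>i y. \<psi> (\<phi> g (\<iota> (inv_into U \<kappa> (line_point y)))) i)"
  define \<gamma>' where "\<gamma>' = (\<lambda>i y. \<psi> (\<iota> (inv_into U' \<kappa>' (line_point y))) i)"
  have gam: "\<gamma> i (k u) = \<psi> (\<phi> g (c (t + s * u))) i" if "\<bar>u\<bar> < e1" for i u
    using K(6)[OF that] by (simp add: \<gamma>_def c_def)
  have gam': "\<gamma>' i (k' u) = \<psi> (c (t' + s' * u)) i" if "\<bar>u\<bar> < e2" for i u
    using K'(6)[OF that] by (simp add: \<gamma>'_def c_def)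
  have an: "real_analytic_at (\<gamma> i) (k 0)" if i: "i < mdim M" for i
  proof -
    define d where "d = min e1 (min d1 d2)"
    have d: "0 < d" "d \<le> e1" using K(3) d1 d2 by (auto simp: d_def)
    obtain r where r: "r > 0" "ball (k 0) r \<subseteq> k ` {-d<..<d}" using K(9)[OF d] by blast
    have "line_point y \<in> \<kappa> ` (U \<inter> \<iota> -` (V0 \<inter> \<phi> g -` V))" if "\<bar>y - k 0\<bar> < r" for y
    proof -
      have "y \<in> ball (k 0) r" using that by (simp add: dist_real_def abs_minus_commute)
      then obtain u where u: "\<bar>u\<bar> < d" "y = k u" using r(2) by force
      have "\<bar>u\<bar> < e1" "\<bar>u\<bar> < d1" "\<bar>u\<bar> < d2" using u(1) by (auto simp: d_def)
      then have "line_point y = \<kappa> (\<pi> (t + s * u))" "\<pi> (t + s * u) \<in> U \<inter> \<iota> -` (V0 \<inter> \<phi> g -` V)"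
        using K(4,5) d1(2) d2(2) u(2) by (auto simp: c_def)
      then show ?thesis by blast
    qed
    then show ?thesis
      unfolding \<gamma>_def using real_analytic_at_moved_iota[OF G K(1,2) V0(1,4,5) V(1) i r(1)] by blast
  qed
  define d4 where "d4 = min e2 d3"
  have d4: "0 < d4" "d4 \<le> e2" using K'(3) d3 by (auto simp: d4_def)
  obtain r' where r': "r' > 0" "ball (k' 0) r' \<subseteq> k' ` {-d4<..<d4}" using K'(9)[OF d4] by blast
  have inV': "line_point y \<in> \<kappa>' ` (U' \<inter> \<iota> -` V)" if y: "\<bar>y - k' 0\<bar> < r'" for y
  proof -
    have "y \<in> ball (k' 0) r'" using that by (simp add: dist_real_def abs_minus_commute)
    then obtain u where u: "\<bar>u\<bar> < d4" "y = k' u" using r'(2) by force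
    have "\<bar>u\<bar> < e2" "\<bar>u\<bar> < d3" using u(1) by (auto simp: d4_def)
    then have "line_point y = \<kappa>' (\<pi> (t' + s' * u))" "\<pi> (t' + s' * u) \<in> U' \<inter> \<iota> -` V"
      using K'(4,5) d3(2) u(2) by (auto simp: c_def)
    then show ?thesis by blast
  qed
  have an': "real_analytic_at (\<gamma>' i) (k' 0)" if i: "i < mdim M" for i
    unfolding \<gamma>'_def using real_analytic_at_iota[OF K'(1,2) V(1) i r'(1) inV'] by blast
  have pit': "\<pi> t' \<in> U'" "\<kappa>' (\<pi> t') = line_point (k' 0)" using K'(4)[of 0] K'(5)[of 0] K'(3) by auto
  have "\<forall>z\<in>U'. \<iota> z \<in> V \<longrightarrow>
        (\<exists>i<mdim M. \<exists>d. d \<noteq> 0 \<and>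
          ((\<lambda>t. \<psi> (\<iota> (inv_into U' \<kappa>' (line_point t))) i) has_real_derivative d)
            (at (\<kappa>' z 0) within {t. line_point t \<in> \<kappa>' ` (U' \<inter> \<iota> -` V)}))"
    using iota_immersion K'(1) V(1) unfolding analytic_immersion1_def by fast
  then obtain i d where id: "i < mdim M" "d \<noteq> 0"
     "(\<gamma>' i has_real_derivative d) (at (k' 0) within {t. line_point t \<in> \<kappa>' ` (U' \<inter> \<iota> -` V)})"
    using pit' V(2) unfolding \<gamma>'_def c_def by (auto simp: line_point_def)
  have "ball (k' 0) r' \<subseteq> {t. line_point t \<in> \<kappa>' ` (U' \<inter> \<iota> -` V)}"
  proof
    fix y assume "y \<in> ball (k' 0) r'"
    then have "\<bar>y - k' 0\<bar> < r'" by (simp add: dist_real_def abs_minus_commute)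
    then show "y \<in> {t. line_point t \<in> \<kappa>' ` (U' \<inter> \<iota> -` V)}" using inV' by (simp only: mem_Collect_eq)
  qed
  moreover have "k' 0 \<in> ball (k' 0) r'" using r'(1) by simp
  \<comment> \<open>The immersion condition only provides a derivative within the set of admissible
    coordinates. As \<open>k' 0\<close> is interior to that set, this is a two-sided derivative, as
    the inverse function argument requires.\<close>
  ultimately have int_k: "k' 0 \<in> interior {t. line_point t \<in> \<kappa>' ` (U' \<inter> \<iota> -` V)}"
    using interiorI open_ball by blast
  have der: "(\<gamma>' i has_real_derivative d) (at (k' 0))"
    using id(3) unfolding at_within_interior[OF int_k] .
  obtain h0 d0 where h0: "real_analytic_at h0 (\<gamma>' i (k' 0))" "d0 > 0" "\<And>y. \<bar>y - k' 0\<bar> < d0 \<Longrightarrow> h0 (\<gamma>' i y) = y"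
    using real_analytic_at_inverse[OF an'[OF id(1)] der id(2)] by blast
  \<comment> \<open>In chart coordinates \<open>h\<close> is the candidate for the
    reparametrization: follow the moved arc, take its i-th coordinate, and read off the parameter of
    the target arc. It is analytic on both sides, unlike \<open>\<rho>\<close>, which is given on
    one side only.\<close>
  define h where "h = (\<lambda>y. h0 (\<gamma> i y))"
  have k0: "\<gamma> i (k 0) = \<gamma>' i (k' 0)" using gam[of 0 i] gam'[of 0 i] K(3) K'(3) gct by simp
  have hk0: "h (k 0) = k' 0" using h0(2) h0(3)[of "k' 0"] by (simp add: h_def k0)
  have anh: "real_analytic_at h (k 0)"
    unfolding h_def
    using real_analytic_at_compose1[of h0 "\<gamma> i" "k 0", unfolded k0, OF h0(1) an[OF id(1)]] .
  obtain b where b: "b > 0" "b < e2" "\<And>u. \<bar>u\<bar> \<le> b \<Longrightarrow> \<bar>k' u - k' 0\<bar> < d0"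
  proof -
    have "isCont k' 0" using K'(7,3) by (auto simp: continuous_on_eq_continuous_at)
    then obtain b where b: "b > 0" "\<And>u. \<bar>u\<bar> < b \<Longrightarrow> \<bar>k' u - k' 0\<bar> < d0"
      using h0(2) unfolding continuous_at_eps_delta by (metis diff_zero dist_real_def)
    show ?thesis using that[of "min b e2 / 2"] b K'(3) by auto
  qed
  obtain e3 where e3: "e3 > 0" "e3 \<le> e" "\<And>u. u \<in> {0..e3} \<Longrightarrow> \<rho> u \<in> {0..b}"
    using reparam_small[OF gm(1-4) b(1)] by metis
  have hk: "h (k u) = k' (\<rho> u)" and gg: "\<gamma> j (k u) = \<gamma>' j (h (k u))" if u: "0 \<le> u" "u \<le> e3" "u < e1" for u j
  proof -
    have r: "\<bar>\<rho> u\<bar> \<le> b" "\<bar>\<rho> u\<bar> < e2" using e3(3)[of u] b(2) u by auto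
    have *: "\<gamma> j (k u) = \<gamma>' j (k' (\<rho> u))" for j
      using gam[of u j] gam'[OF r(2), of j] gm(7)[of u] u e3(2) by simp
    show hk: "h (k u) = k' (\<rho> u)" unfolding h_def * using h0(3) b(3)[OF r(1)] .
    show "\<gamma> j (k u) = \<gamma>' j (h (k u))" unfolding hk by (rule *)
  qed
  \<comment> \<open>On the given side all coordinates of the moved arc agree with those of the
    target arc at \<open>h\<close>, not only the i-th one. The parameters on that side accumulate at
    \<open>k 0\<close>, so the identity theorem extends the agreement to a full
    neighbourhood.\<close>
  have near: "\<exists>d>0. \<forall>y. \<bar>y - k 0\<bar> < d \<longrightarrow> \<gamma> j y = \<gamma>' j (h y)" if j: "j < mdim M" for j
  proof (rule real_analytic_at_identity[OF an[OF j]])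
    show "real_analytic_at (\<lambda>y. \<gamma>' j (h y)) (k 0)"
      using real_analytic_at_compose1[of "\<gamma>' j" h "k 0", unfolded hk0, OF an'[OF j] anh] .
    show "k 0 islimpt {y. \<gamma> j y = \<gamma>' j (h y)}"
      unfolding islimpt_approachable
    proof (intro allI impI)
      fix q :: real assume q: "q > 0"
      have "isCont k 0" using K(7,3) by (auto simp: continuous_on_eq_continuous_at)
      then obtain a where a: "a > 0" "\<And>u. \<bar>u\<bar> < a \<Longrightarrow> \<bar>k u - k 0\<bar> < q"
        using q unfolding continuous_at_eps_delta by (metis diff_zero dist_real_def)
      define u where "u = min a (min e1 e3) / 2"
      have u: "0 < u" "u < a" "u < e1" "u \<le> e3" using a(1) K(3) e3(1) by (auto simp: u_def)
      have "k u \<noteq> k 0" using inj_onD[OF K(8), of u 0] u K(3) by auto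
      moreover have "dist (k u) (k 0) < q" using a(2)[of u] u by (simp add: dist_real_def)
      ultimately show "\<exists>x'\<in>{y. \<gamma> j y = \<gamma>' j (h y)}. x' \<noteq> k 0 \<and> dist x' (k 0) < q"
        using gg[of u j] u by (intro bexI[of _ "k u"]) auto
    qed
  qed
  then have "\<forall>j\<in>{..<mdim M}. \<forall>\<^sub>F y in nhds (k 0). \<gamma> j y = \<gamma>' j (h y)"
    by (auto simp: eventually_nhds_metric dist_real_def)
  then have "\<forall>\<^sub>F y in nhds (k 0). \<forall>j\<in>{..<mdim M}. \<gamma> j y = \<gamma>' j (h y)"
    by (rule eventually_ball_finite[OF finite_lessThan])
  then obtain q where q: "q > 0" "\<And>y j. \<bar>y - k 0\<bar> < q \<Longrightarrow> j < mdim M \<Longrightarrow> \<gamma> j y = \<gamma>' j (h y)"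
    by (auto simp: eventually_nhds_metric dist_real_def)
  define b' where "b' = min b d3 / 2"
  have b': "0 < b'" "b' < b" "b' < d3" "b' < e2" "b' \<le> e2" using b(1,2) d3(1) by (auto simp: b'_def)
  obtain w where w: "w > 0" "ball (k' 0) w \<subseteq> k' ` {-b'<..<b'}" using K'(9)[OF b'(1,5)] by blast
  have kcont0: "isCont k 0" using K(7,3) by (auto simp: continuous_on_eq_continuous_at)
  have "\<forall>\<^sub>F y in nhds (k 0). h y \<in> ball (k' 0) w"
    using real_analytic_at_isCont[OF anh] hk0 w(1) unfolding isCont_def tendsto_at_iff_tendsto_nhds
    by (metis centre_in_ball open_ball topological_tendstoD)
  moreover have "\<forall>\<^sub>F y in nhds (k 0). \<bar>y - k 0\<bar> < q"
    unfolding eventually_nhds_metric using q(1) by (auto simp: dist_real_def)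
  \<comment> \<open>Continuity of \<open>h\<close> in a whole neighbourhood is needed for the
    continuity of \<open>\<tau>\<close> below; the holomorphic extension serves every nearby point
    on a smaller disc.\<close>
  moreover have "\<forall>\<^sub>F y in nhds (k 0). isCont h y"
  proof -
    obtain F x0 where F: "x0 > 0" "F holomorphic_on ball (complex_of_real (k 0)) x0"
      "\<And>y. \<bar>y - k 0\<bar> < x0 \<Longrightarrow> F (complex_of_real y) = complex_of_real (h y)"
      using anh unfolding real_analytic_at_def by metis
    have "isCont h y" if y: "\<bar>y - k 0\<bar> < x0" for y
    proof (rule real_analytic_at_isCont)
      define x1 where "x1 = x0 - \<bar>y - k 0\<bar>"
      have sub: "ball (complex_of_real y) x1 \<subseteq> ball (complex_of_real (k 0)) x0"
        using y by (auto simp: x1_def ball_subset_ball_iff dist_norm simp flip: of_real_diff)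
      show "real_analytic_at h y"
        unfolding real_analytic_at_def using y F(3) holomorphic_on_subset[OF F(2) sub]
        by (intro exI[of _ F] exI[of _ x1]) (auto simp: x1_def)
    qed
    then show ?thesis unfolding eventually_nhds_metric using F(1) by (auto simp: dist_real_def)
  qed
  ultimately have "\<forall>\<^sub>F y in nhds (k 0). h y \<in> ball (k' 0) w \<and> \<bar>y - k 0\<bar> < q \<and> isCont h y"
    by (intro eventually_conj)
  moreover have "(k \<longlongrightarrow> k 0) (nhds 0)" using kcont0 unfolding isCont_def tendsto_at_iff_tendsto_nhds .
  ultimately have "\<forall>\<^sub>F u in nhds 0. h (k u) \<in> ball (k' 0) w \<and> \<bar>k u - k 0\<bar> < q \<and> isCont h (k u)"
    by (rule eventually_compose_filterlim)
  then obtain a where a: "a > 0" "\<And>u. \<bar>u\<bar> < a \<Longrightarrow> h (k u) \<in> ball (k' 0) w"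
    "\<And>u. \<bar>u\<bar> < a \<Longrightarrow> \<bar>k u - k 0\<bar> < q" "\<And>u. \<bar>u\<bar> < a \<Longrightarrow> isCont h (k u)"
    by (auto simp: eventually_nhds_metric)
  obtain r0 where r0: "r0 > 0" "\<And>t u. t \<in> D \<Longrightarrow> u \<in> D \<Longrightarrow> \<bar>t - u\<bar> < r0 \<Longrightarrow> \<pi> t = \<pi> u \<Longrightarrow> t = u"
    using pi_local_inj by blast
  \<comment> \<open>Less than half of \<open>r0\<close>, so that two parameters in the symmetric
    interval differ by less than the radius of local injectivity; the other bounds are those under
    which the preceding facts hold.\<close>
  define \<epsilon> where "\<epsilon> = min (min a d1) (min (min e1 e3) r0) / 3"
  have eps: "0 < \<epsilon>" "\<epsilon> < a" "\<epsilon> < d1" "\<epsilon> < e1" "\<epsilon> < e3" "2 * \<epsilon> < r0"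
    using a(1) d1(1) K(3) e3(1) r0(1) by (auto simp: \<epsilon>_def)
  have bi: "inj_on k' {-b'..b'}" and bc: "continuous_on {-b'..b'} k'"
    using b' by (auto intro!: inj_on_subset[OF K'(8)] continuous_on_subset[OF K'(7)])
  \<comment> \<open>The two-sided reparametrization: \<open>h\<close> transported from chart
    coordinates back to parameters. It extends \<open>\<rho>\<close>.\<close>
  define \<tau> where "\<tau> = (\<lambda>u. the_inv_into {-b'..b'} k' (h (k u)))"
  have img: "h (k u) \<in> k' ` {-b'..b'}" if "\<bar>u\<bar> \<le> \<epsilon>" for u
  proof -
    have "h (k u) \<in> k' ` {-b'<..<b'}" using a(2)[of u] w(2) that eps(2) by auto
    then show ?thesis by force
  qed
  have tau: "\<tau> u \<in> {-b'..b'}" "k' (\<tau> u) = h (k u)" if "\<bar>u\<bar> \<le> \<epsilon>" for u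
    unfolding \<tau>_def using img[OF that] the_inv_into_into[OF bi _ order.refl] f_the_inv_into_f[OF bi] by blast+
  have taur: "\<tau> u = \<rho> u" if "0 \<le> u" "u \<le> \<epsilon>" for u
  proof (rule inj_onD[OF K'(8)])
    show "k' (\<tau> u) = k' (\<rho> u)" using tau(2)[of u] hk[of u] that eps by auto
    show "\<tau> u \<in> {- e2<..<e2}" using tau(1)[of u] that b' by auto
    show "\<rho> u \<in> {- e2<..<e2}" using e3(3)[of u] that eps b(2) by auto
  qed
  have key: "\<phi> g (c (t + s * u)) = c (t' + s' * \<tau> u)" and keyD: "t + s * u \<in> D" "t' + s' * \<tau> u \<in> D"
    if u: "\<bar>u\<bar> \<le> \<epsilon>" for u
  proof -
    have u': "\<bar>u\<bar> < e1" "\<bar>u\<bar> < d1" "\<bar>u\<bar> < a" and v: "\<bar>\<tau> u\<bar> < e2" "\<bar>\<tau> u\<bar> < d3"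
      using u eps tau(1)[OF u] b' by auto
    show "t + s * u \<in> D" "t' + s' * \<tau> u \<in> D" using K(4)[OF u'(1)] K'(4)[OF v(1)] by auto
    have inV: "\<phi> g (c (t + s * u)) \<in> V" "c (t' + s' * \<tau> u) \<in> V" using d1(2)[OF u'(2)] d3(2)[OF v(2)] .
    have "\<psi> (\<phi> g (c (t + s * u))) j = \<psi> (c (t' + s' * \<tau> u)) j" for j
    proof (cases "j < mdim M")
      case True
      then show ?thesis
        using q(2)[OF a(3)[OF u'(3)] True] gam[OF u'(1), of j] gam'[OF v(1), of j] tau(2)[OF u] by simp
    next
      case False
      then have "j \<ge> mdim M" by simp
      moreover have "\<psi> x \<in> topspace (Euclidean_space (mdim M))" if "x \<in> V" for x
        using V(5) that by blast
      ultimately show ?thesis using inV by (simp add: topspace_Euclidean_space)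
    qed
    then show "\<phi> g (c (t + s * u)) = c (t' + s' * \<tau> u)"
      using inj_onD[OF V(4) _ inV] by blast
  qed
  have tc: "continuous_on {-\<epsilon>..\<epsilon>} \<tau>"
  proof -
    have "continuous_on {-\<epsilon>..\<epsilon>} k" using eps by (auto intro!: continuous_on_subset[OF K(7)])
    moreover have "continuous_on (k ` {-\<epsilon>..\<epsilon>}) h"
      using a(4) eps(2) by (intro continuous_at_imp_continuous_on) auto
    ultimately have "continuous_on {-\<epsilon>..\<epsilon>} (\<lambda>u. h (k u))"
      using continuous_on_compose[of "{-\<epsilon>..\<epsilon>}" k h] by (simp add: o_def)
    then show ?thesis
      unfolding \<tau>_def using img
      by (intro continuous_on_compose2[OF continuous_on_inv_into[OF bc compact_Icc bi]]) auto
  qed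
  have ti: "inj_on \<tau> {-\<epsilon>..\<epsilon>}"
  proof (rule inj_onI)
    fix x y assume xy: "x \<in> {-\<epsilon>..\<epsilon>}" "y \<in> {-\<epsilon>..\<epsilon>}" "\<tau> x = \<tau> y"
    then have x: "\<bar>x\<bar> \<le> \<epsilon>" and y: "\<bar>y\<bar> \<le> \<epsilon>" by auto
    have "\<phi> g (c (t + s * x)) = \<phi> g (c (t + s * y))" using key[OF x] key[OF y] xy(3) by simp
    then have "c (t + s * x) = c (t + s * y)"
      using act_inj[OF G c_points c_points] keyD x y by blast
    then have "\<pi> (t + s * x) = \<pi> (t + s * y)" using c_eq_iff keyD x y by blast
    moreover have "\<bar>(t + s * x) - (t + s * y)\<bar> < r0" using x y eps(6) s by auto
    ultimately have "t + s * x = t + s * y" using r0(2) keyD x y by blast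
    then show "x = y" using s by auto
  qed
  have "- \<epsilon> < \<epsilon>" using eps(1) by simp
  then obtain \<sigma> where sg: "\<sigma> \<in> {1, -1 :: real}" "strict_mono_on {-\<epsilon>..\<epsilon>} (\<lambda>x. \<sigma> * \<tau> x)"
    using injective_continuous_strict_mono[OF tc ti] by blast
  \<comment> \<open>Monotonicity of \<open>\<tau>\<close> comes from injectivity, its sign from the
    side on which it coincides with the increasing \<open>\<rho>\<close>.\<close>
  have "\<rho> 0 < \<rho> \<epsilon>" using strict_mono_onD[OF gm(3), of 0 \<epsilon>] eps e3(2) by auto
  then have "\<tau> 0 < \<tau> \<epsilon>" using taur[of 0] taur[of \<epsilon>] eps(1) by simp
  moreover have "\<sigma> * \<tau> 0 < \<sigma> * \<tau> \<epsilon>" using strict_mono_onD[OF sg(2), of 0 \<epsilon>] eps(1) by simp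
  ultimately have "\<sigma> = 1" using sg(1) by auto
  then have tm: "strict_mono_on {-\<epsilon>..\<epsilon>} \<tau>" using sg(2) by simp
  show ?thesis
  \<comment> \<open>Reversing both directions conjugates the reparametrization by negation, which
    keeps it increasing.\<close>
  proof (rule germ_mapI[of \<epsilon> "\<lambda>u. - \<tau> (- u)"])
    show "continuous_on {0..\<epsilon>} (\<lambda>u. - \<tau> (- u))"
      by (intro continuous_intros continuous_on_compose2[OF tc]) auto
    show "strict_mono_on {0..\<epsilon>} (\<lambda>u. - \<tau> (- u))"
      by (rule strict_mono_onI) (use strict_mono_onD[OF tm] in auto)
    show "- \<tau> (- 0) = 0" using taur[of 0] eps(1) gm(4) by simp
    fix u assume "u \<in> {0..\<epsilon>}"
    then have u: "\<bar>- u\<bar> \<le> \<epsilon>" by auto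
    show "t + - s * u \<in> D" using keyD(1)[OF u] by simp
    show "t' + - s' * - \<tau> (- u) \<in> D" using keyD(2)[OF u] by simp
    show "\<phi> g (c (t + - s * u)) = c (t' + - s' * - \<tau> (- u))" using key[OF u] by simp
  qed (rule eps(1))
qed

section \<open>One-sided germs inside segments, and the stabilizer of S\<close>

abbreviation H :: "'g set" where "H \<equiv> stab_S G \<phi> S \<iota>"

abbreviation coset :: "'g \<Rightarrow> 'g set" where "coset \<equiv> cls G \<phi> S \<iota>"

text \<open>The endpoints are not ordered: q may lie on either side of p, and
  \<open>sgn (q - p)\<close> is the direction from p into the arc. Hence either endpoint of a
  segment can be given the role of q.\<close>

definition arc :: "real \<Rightarrow> real \<Rightarrow> bool" where
  "arc p q \<longleftrightarrow> p \<noteq> q \<and> closed_segment p q \<subseteq> D \<and> inj_on \<pi> (closed_segment p q)"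

lemma arc_commute: "arc p q \<Longrightarrow> arc q p"
  by (auto simp: arc_def closed_segment_commute)

lemma stab_iff:
  assumes "D \<noteq> {}"
  shows "g \<in> H \<longleftrightarrow> g \<in> carrier G \<and> (\<forall>t\<in>D. \<phi> g (c t) = c t)"
  unfolding stab_S_def stabilizer_def c_def pi_image[symmetric] using assms by auto

lemma stab_act: "g \<in> H \<Longrightarrow> t \<in> D \<Longrightarrow> g \<in> carrier G \<and> \<phi> g (c t) = c t"
  using stab_iff by blast

lemma stab_subgroup:
  assumes "D \<noteq> {}"
  shows "subgroup H G"
proof (rule group.subgroupI[OF group_G])
  show "H \<subseteq> carrier G" using stab_iff[OF assms] by blast
  show "H \<noteq> {}"
    using stab_iff[OF assms] act_one c_points group.is_monoid[OF group_G] monoid.one_closed by blast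
  fix g h assume g: "g \<in> H"
  then have gG: "g \<in> carrier G" "\<And>t. t \<in> D \<Longrightarrow> \<phi> g (c t) = c t" using stab_iff[OF assms] by auto
  show "inv g \<in> H"
    unfolding stab_iff[OF assms] using gG act_inv(1)[OF gG(1) c_points] group.inv_closed[OF group_G] by metis
  assume h: "h \<in> H"
  then have hG: "h \<in> carrier G" "\<And>t. t \<in> D \<Longrightarrow> \<phi> h (c t) = c t" using stab_iff[OF assms] by auto
  have "g \<otimes> h \<in> carrier G"
    using gG(1) hG(1) group.is_monoid[OF group_G] by (simp add: monoid.m_closed)
  then show "g \<otimes> h \<in> H"
    unfolding stab_iff[OF assms] using act_mult[OF gG(1) hG(1) c_points] gG hG by simp
qed

lemma germ_in_mono: "germ_in t s A \<Longrightarrow> A \<subseteq> B \<Longrightarrow> germ_in t s B"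
  unfolding germ_in_def by blast

lemma germ_in_point: "germ_in t s A \<Longrightarrow> t \<in> D \<and> \<pi> t \<in> A"
  unfolding germ_in_def by force

text \<open>Local injectivity of \<open>\<pi>\<close> makes a germ an infinite set of points. The
  lemma serves to exclude a direction: members of a decomposition with finite intersection cannot
  both contain the same germ.\<close>

lemma germ_in_infinite:
  assumes A: "germ_in t s A" and B: "germ_in t s B" and s: "s \<in> {1, -1}"
  shows "infinite (A \<inter> B)"
proof -
  obtain a b where a: "a > 0" "\<And>u. u \<in> {0..a} \<Longrightarrow> t + s * u \<in> D \<and> \<pi> (t + s * u) \<in> A"
    and b: "b > 0" "\<And>u. u \<in> {0..b} \<Longrightarrow> \<pi> (t + s * u) \<in> B"
    using A B unfolding germ_in_def by metis
  obtain r where r: "r > 0" "\<And>t u. t \<in> D \<Longrightarrow> u \<in> D \<Longrightarrow> \<bar>t - u\<bar> < r \<Longrightarrow> \<pi> t = \<pi> u \<Longrightarrow> t = u"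
    using pi_local_inj by blast
  define e where "e = min (min a b) (r / 2)"
  have e: "e > 0" "e \<le> a" "e \<le> b" "e < r" using a b r by (auto simp: e_def)
  have "inj_on (\<lambda>u. \<pi> (t + s * u)) {0..e}"
  proof (rule inj_onI)
    fix x y assume xy: "x \<in> {0..e}" "y \<in> {0..e}" "\<pi> (t + s * x) = \<pi> (t + s * y)"
    then have "\<bar>(t + s * x) - (t + s * y)\<bar> < r" using s e by auto
    moreover have "t + s * x \<in> D" "t + s * y \<in> D" using a(2)[of x] a(2)[of y] xy e by auto
    ultimately have "t + s * x = t + s * y" using r(2) xy(3) by blast
    then show "x = y" using s by auto
  qed
  then have "infinite ((\<lambda>u. \<pi> (t + s * u)) ` {0..e})"
    using e(1) by (simp add: finite_image_iff infinite_Icc)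
  moreover have "(\<lambda>u. \<pi> (t + s * u)) ` {0..e} \<subseteq> A \<inter> B"
    using a(2) b(2) e by auto
  ultimately show ?thesis using finite_subset by blast
qed

text \<open>Analytic continuation needs interior parameters; a common endpoint of two neighbouring
  segments is one, since the parameter interval extends to both sides of it.\<close>

lemma germ_both_interior:
  assumes "germ_in t s A" "germ_in t (- s) B" "s \<in> {1, -1}"
  shows "t \<in> interior D"
proof -
  obtain a where a: "a > 0" "t + s * a \<in> D"
    using assms(1) unfolding germ_in_def by (meson atLeastAtMost_iff less_imp_le order_refl)
  obtain b where b: "b > 0" "t + (- s) * b \<in> D"
    using assms(2) unfolding germ_in_def by (meson atLeastAtMost_iff less_imp_le order_refl)
  define l where "l = (if s = 1 then t - b else t - a)"
  define u where "u = (if s = 1 then t + a else t + b)"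
  have lu: "l \<in> D" "u \<in> D" "l < t" "t < u" using a b assms(3) by (auto simp: l_def u_def)
  have "{l<..<u} \<subseteq> D"
    using interval lu unfolding is_interval_1 by (meson greaterThanLessThan_iff less_imp_le subsetI)
  then show ?thesis using interiorI[of "{l<..<u}" t D] lu by auto
qed

lemma germ_in_arc:
  assumes pq: "arc p q" and x: "x \<in> closed_segment p q"
  shows "x \<noteq> q \<Longrightarrow> germ_in x (sgn (q - p)) (\<pi> ` closed_segment p q)"
    and "x \<noteq> p \<Longrightarrow> germ_in x (- sgn (q - p)) (\<pi> ` closed_segment p q)"
proof -
  have sub: "closed_segment p q \<subseteq> D" using pq by (simp add: arc_def)
  have ne: "p \<noteq> q" using pq by (simp add: arc_def)
  have "x + sgn (q - p) * u \<in> closed_segment p q" if "u \<in> {0..\<bar>q - x\<bar>}" for u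
    using that x ne by (auto simp: closed_segment_eq_real_ivl sgn_if split: if_splits)
  then show "germ_in x (sgn (q - p)) (\<pi> ` closed_segment p q)" if "x \<noteq> q"
    unfolding germ_in_def using sub that by (intro exI[of _ "\<bar>q - x\<bar>"]) auto
  have "x + (- sgn (q - p)) * u \<in> closed_segment p q" if "u \<in> {0..\<bar>p - x\<bar>}" for u
    using that x ne by (auto simp: closed_segment_eq_real_ivl sgn_if split: if_splits)
  then show "germ_in x (- sgn (q - p)) (\<pi> ` closed_segment p q)" if "x \<noteq> p"
    unfolding germ_in_def using sub that by (intro exI[of _ "\<bar>p - x\<bar>"]) auto
qed

lemma sgn_arc: "arc p q \<Longrightarrow> sgn (q - p) \<in> {1, -1}"
  by (auto simp: arc_def sgn_if)

lemma arc_image_compact: "arc p q \<Longrightarrow> compactin (mtop S) (\<pi> ` closed_segment p q)"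
  by (rule image_compactin[OF _ pi_continuous]) (simp add: arc_def compactin_subtopology)

lemma arc_image_segment:
  assumes "arc p q"
  shows "segment S (\<pi> ` closed_segment p q)"
proof -
  have "connectedin (mtop S) (\<pi> ` closed_segment p q)"
    using assms by (intro connectedin_continuous_map_image[OF pi_continuous])
      (simp add: arc_def connectedin_subtopology)
  moreover have "\<pi> p \<noteq> \<pi> q" using assms by (auto simp: arc_def dest: inj_onD)
  ultimately show ?thesis unfolding segment_def by (meson ends_in_segment imageI)
qed

lemma segment_germ:
  assumes "segment S C" "t \<in> D" "\<pi> t \<in> C"
  obtains s where "s \<in> {1, -1}" "germ_in t s C"
  using connected_germ[OF assms] unfolding germ_in_def by blast

lemma segment_subset: "segment S C \<Longrightarrow> C \<subseteq> points S"
  unfolding segment_def using connectedin_subset_topspace by blast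

lemma segment_lift:
  assumes "segment S C"
  obtains t s where "\<pi> t \<in> C" "s \<in> {1, -1}" "germ_in t s C"
proof -
  obtain z where z: "z \<in> C" using assms unfolding segment_def by blast
  then obtain t where "t \<in> D" "\<pi> t = z" using segment_subset[OF assms] unfolding pi_image[symmetric] by blast
  then show ?thesis using segment_germ[OF assms, of t] that z by metis
qed

text \<open>An injective continuous map from a compact space to a Hausdorff space is an embedding,
  and so are its restrictions. This supplies the embedding condition in \<open>overlaps\<close>,
  which an injective immersion alone does not give.\<close>

lemma embedded_compact:
  assumes A: "compactin (mtop S) A" and K: "K \<subseteq> A"
  shows "embedded_on S M \<iota> K"
proof -
  have AS: "A \<subseteq> points S" using A compactin_subset_topspace by blast
  have top: "topspace (subtopology (mtop S) A) = A" "topspace (subtopology (mtop S) K) = K"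
    using AS K by auto
  have "embedding_map (subtopology (mtop S) A) (mtop M) \<iota>"
    using A AS iota_inj
    by (intro continuous_imp_embedding_map continuous_map_from_subtopology[OF iota_continuous] Hausdorff_M
        compact_space_subtopology) (auto intro: inj_on_subset)
  then have "homeomorphic_map (subtopology (mtop S) A) (subtopology (mtop M) (\<iota> ` A)) \<iota>"
    unfolding embedding_map_def top .
  then have "homeomorphic_map (subtopology (subtopology (mtop S) A) K) (subtopology (subtopology (mtop M) (\<iota> ` A)) (\<iota> ` K)) \<iota>"
    by (rule homeomorphic_map_subtopologies) (use K AS iota_points in auto)
  then have "homeomorphic_map (subtopology (mtop S) K) (subtopology (mtop M) (\<iota> ` K)) \<iota>"
    using K by (simp add: subtopology_subtopology Int_absorb1 image_mono)
  then show ?thesis unfolding embedded_on_def embedding_map_def top .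
qed

lemma germ_open_segment:
  assumes s: "s \<in> {1, -1}" and e: "e > 0" and A: "\<And>u. u \<in> {0..e} \<Longrightarrow> t + s * u \<in> D"
  shows "openin (mtop S) ((\<lambda>u. \<pi> (t + s * u)) ` {0<..<e})" "segment S ((\<lambda>u. \<pi> (t + s * u)) ` {0<..<e})"
proof -
  define I where "I = (if s = 1 then {t<..<t+e} else {t-e<..<t})"
  have I: "I = (\<lambda>u. t + s * u) ` {0<..<e}"
  proof (intro equalityI subsetI)
    fix x assume "x \<in> I"
    then show "x \<in> (\<lambda>u. t + s * u) ` {0<..<e}"
      using s by (intro image_eqI[of _ _ "s * (x - t)"]) (auto simp: I_def split: if_splits)
  qed (use s in \<open>auto simp: I_def\<close>)
  have img: "(\<lambda>u. \<pi> (t + s * u)) ` {0<..<e} = \<pi> ` I" unfolding I image_image ..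
  have sub: "I \<subseteq> D" unfolding I using A by auto
  show "openin (mtop S) ((\<lambda>u. \<pi> (t + s * u)) ` {0<..<e})"
    unfolding img by (rule pi_open[OF _ sub]) (simp add: I_def)
  have "connected I" by (simp add: I_def)
  then have con: "connectedin (mtop S) (\<pi> ` I)"
    using sub by (intro connectedin_continuous_map_image[OF pi_continuous]) (simp add: connectedin_subtopology)
  obtain r where r: "r > 0" "\<And>t u. t \<in> D \<Longrightarrow> u \<in> D \<Longrightarrow> \<bar>t - u\<bar> < r \<Longrightarrow> \<pi> t = \<pi> u \<Longrightarrow> t = u"
    using pi_local_inj by blast
  \<comment> \<open>With a third of the minimum, the parameters at distances \<open>d\<close> and
    \<open>2 * d\<close> both belong to the open germ and are close enough to have different
    images.\<close>
  define d where "d = min e r / 3"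
  have d: "0 < d" "2 * d < e" "2 * d < r" using e r(1) by (auto simp: d_def)
  have "t + s * d \<in> I" "t + s * (2 * d) \<in> I" unfolding I using d by auto
  moreover have "\<pi> (t + s * d) \<noteq> \<pi> (t + s * (2 * d))"
    using r(2)[of "t + s * d" "t + s * (2 * d)"] A[of d] A[of "2 * d"] d s by auto
  ultimately show "segment S ((\<lambda>u. \<pi> (t + s * u)) ` {0<..<e})"
    unfolding img segment_def using con by blast
qed

text \<open>The bridge from germs to the definition of freeness. The base points are removed,
  because they may be endpoints of \<open>A\<close> and \<open>A'\<close>; what remains of the two
  germs are open segments, and the intermediate value theorem shows that g carries one exactly onto
  the other.\<close>

lemma germ_overlaps:
  assumes gm: "germ_map g v s v' s'" and A: "germ_in v s A" "compactin (mtop S) A"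
    and A': "germ_in v' s' A'" "compactin (mtop S) A'" and s: "s \<in> {1, -1}" "s' \<in> {1, -1}"
  shows "overlaps \<phi> M S \<iota> g A A'"
proof -
  obtain e \<rho> where gm: "e > 0" "continuous_on {0..e} \<rho>" "strict_mono_on {0..e} \<rho>" "\<rho> 0 = 0"
    "\<And>u. u \<in> {0..e} \<Longrightarrow> v + s * u \<in> D" "\<And>u. u \<in> {0..e} \<Longrightarrow> v' + s' * \<rho> u \<in> D"
    "\<And>u. u \<in> {0..e} \<Longrightarrow> \<phi> g (c (v + s * u)) = c (v' + s' * \<rho> u)"
    using germ_mapE[OF gm] by metis
  obtain a where a: "a > 0" "\<And>u. u \<in> {0..a} \<Longrightarrow> \<pi> (v + s * u) \<in> A"
    using A(1) unfolding germ_in_def by metis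
  obtain a' where a': "a' > 0" "\<And>u. u \<in> {0..a'} \<Longrightarrow> \<pi> (v' + s' * u) \<in> A'"
     "\<And>u. u \<in> {0..a'} \<Longrightarrow> v' + s' * u \<in> D"
    using A'(1) unfolding germ_in_def by metis
  obtain b where b: "b > 0" "b \<le> e" "\<And>u. u \<in> {0..b} \<Longrightarrow> \<rho> u \<in> {0..a'}"
    using reparam_small[OF gm(1-4) a'(1)] by metis
  define d where "d = min a b"
  have d: "0 < d" "d \<le> a" "d \<le> b" "d \<le> e" using a b by (auto simp: d_def)
  have r0: "0 < \<rho> d" using strict_mono_onD[OF gm(3), of 0 d] d gm(4) by auto
  have ra: "\<rho> d \<le> a'" using b(3)[of d] d by auto
  have img: "\<rho> ` {0<..<d} = {0<..<\<rho> d}"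
  proof (intro equalityI subsetI)
    fix y assume "y \<in> \<rho> ` {0<..<d}"
    then obtain u where u: "0 < u" "u < d" "y = \<rho> u" by auto
    then show "y \<in> {0<..<\<rho> d}"
      using strict_mono_onD[OF gm(3), of 0 u] strict_mono_onD[OF gm(3), of u d] d gm(4) by auto
  next
    fix y assume y: "y \<in> {0<..<\<rho> d}"
    have "continuous_on {0..d} \<rho>" using continuous_on_subset[OF gm(2)] d(4) by auto
    then obtain u where "0 \<le> u" "u \<le> d" "\<rho> u = y" using IVT'[of \<rho> 0 y d] y gm(4) d(1) by auto
    moreover from this have "u \<noteq> 0" "u \<noteq> d" using y gm(4) by auto
    ultimately show "y \<in> \<rho> ` {0<..<d}" by (intro image_eqI[of _ _ u]) auto
  qed
  define K where "K = (\<lambda>u. \<pi> (v + s * u)) ` {0<..<d}"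
  define K' where "K' = (\<lambda>u. \<pi> (v' + s' * u)) ` {0<..<\<rho> d}"
  have KA: "K \<subseteq> A" unfolding K_def using a(2) d by auto
  have KA': "K' \<subseteq> A'" unfolding K'_def using a'(2) ra by auto
  have "\<phi> g ` \<iota> ` K = (\<lambda>u. \<phi> g (c (v + s * u))) ` {0<..<d}"
    by (simp add: K_def image_image c_def)
  also have "\<dots> = (\<lambda>u. c (v' + s' * \<rho> u)) ` {0<..<d}"
    by (rule image_cong[OF refl]) (use gm(7) d in auto)
  also have "\<dots> = (\<lambda>u. c (v' + s' * u)) ` \<rho> ` {0<..<d}" by (simp add: image_image)
  also have "\<dots> = \<iota> ` K'" unfolding img by (simp add: K'_def image_image c_def)
  finally have "\<phi> g ` \<iota> ` K = \<iota> ` K'" .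
  moreover have "openin (mtop S) K" "segment S K"
    unfolding K_def using germ_open_segment[OF s(1) d(1)] gm(5) d(4) by auto
  moreover have "openin (mtop S) K'" "segment S K'"
    unfolding K'_def using germ_open_segment[OF s(2) r0] a'(3) ra by auto
  ultimately show ?thesis
    unfolding overlaps_def using KA KA' embedded_compact[OF A(2) KA] embedded_compact[OF A'(2) KA'] by blast
qed

lemma free_germ:
  assumes "A \<in> free_segments G \<phi> M S \<iota>" "compactin (mtop S) A" "g \<in> carrier G"
    "germ_map g v s v' s'" "germ_in v s A" "germ_in v' s' A" "s \<in> {1, -1}" "s' \<in> {1, -1}"
  shows "g \<in> H"
  using assms germ_overlaps[OF assms(4,5,2,6,2,7,8)] unfolding free_segments_def by blast

text \<open>The reparametrization reaches every small parameter of the target germ by the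
  intermediate value theorem, and injectivity of \<open>\<iota>\<close> turns the inclusion of
  images into membership in \<open>B\<close>.\<close>

lemma germ_map_germ_in:
  assumes gm: "germ_map g t s t' s'" and A: "germ_in t s A"
    and sub: "\<phi> g ` \<iota> ` A \<subseteq> \<iota> ` B" and B: "B \<subseteq> points S"
  shows "germ_in t' s' B"
proof -
  obtain e \<rho> where gm: "e > 0" "continuous_on {0..e} \<rho>" "strict_mono_on {0..e} \<rho>" "\<rho> 0 = 0"
    "\<And>u. u \<in> {0..e} \<Longrightarrow> t + s * u \<in> D" "\<And>u. u \<in> {0..e} \<Longrightarrow> t' + s' * \<rho> u \<in> D"
    "\<And>u. u \<in> {0..e} \<Longrightarrow> \<phi> g (c (t + s * u)) = c (t' + s' * \<rho> u)"
    using germ_mapE[OF gm] by metis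
  obtain a where a: "a > 0" "\<And>u. u \<in> {0..a} \<Longrightarrow> \<pi> (t + s * u) \<in> A"
    using A unfolding germ_in_def by metis
  define d where "d = min a e"
  have d: "0 < d" "d \<le> a" "d \<le> e" using a gm by (auto simp: d_def)
  have "t' + s' * w \<in> D \<and> \<pi> (t' + s' * w) \<in> B" if w: "w \<in> {0..\<rho> d}" for w
  proof -
    have "continuous_on {0..d} \<rho>" using continuous_on_subset[OF gm(2)] d(3) by auto
    then obtain u where u: "0 \<le> u" "u \<le> d" "\<rho> u = w" using IVT'[of \<rho> 0 w d] w gm(4) d(1) by auto
    have tD: "t' + s' * w \<in> D" using gm(6)[of u] u d by auto
    have "\<iota> (\<pi> (t' + s' * w)) = \<phi> g (\<iota> (\<pi> (t + s * u)))" using gm(7)[of u] u d by (auto simp: c_def)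
    also have "\<dots> \<in> \<iota> ` B" using sub a(2)[of u] u d by auto
    finally have "\<pi> (t' + s' * w) \<in> B"
      using inj_on_image_mem_iff[OF iota_inj pi_points[OF tD] B] by blast
    then show ?thesis using tD by blast
  qed
  moreover have "0 < \<rho> d" using strict_mono_onD[OF gm(3), of 0 d] d gm(4) by auto
  ultimately show ?thesis unfolding germ_in_def by blast
qed

text \<open>Converts an equality of image sets into a statement about parameters. On the compact arc
  the curve is a homeomorphism onto its image, so \<open>inv g\<close> carries the germ of C to a
  continuous injective path of parameters in the arc. This path is monotone, and its sign is the
  direction of the source germ. The last conclusion says that the arc contains a point in that
  direction, which determines the direction when v is an endpoint.\<close>

lemma pull_germ:
  assumes pq: "arc p q" and B: "B \<subseteq> \<pi> ` closed_segment p q" and g: "g \<in> carrier G"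
    and img: "\<phi> g ` \<iota> ` B = \<iota> ` C" and C: "germ_in t s C" "C \<subseteq> points S" and s: "s \<in> {1, -1}"
  obtains v s' where "s' \<in> {1, -1}" "v \<in> closed_segment p q" "germ_map g v s' t s" "germ_in v s' B"
    "\<exists>e>0. v + s' * e \<in> closed_segment p q"
proof -
  let ?I = "closed_segment p q"
  have I: "?I \<subseteq> D" "inj_on \<pi> ?I" using pq by (auto simp: arc_def)
  have B': "B \<subseteq> points S" using B I pi_points by blast
  have ig: "inv g \<in> carrier G" using g group_G by (simp add: group.inv_closed)
  have img': "\<phi> (inv g) ` \<iota> ` C \<subseteq> \<iota> ` B"
  proof -
    have "\<phi> (inv g) ` \<iota> ` C = (\<lambda>x. \<phi> (inv g) (\<phi> g x)) ` \<iota> ` B"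
      unfolding img[symmetric] by (simp add: image_image)
    also have "\<dots> = (\<lambda>x. x) ` \<iota> ` B"
      by (rule image_cong[OF refl]) (use act_inv(1)[OF g] iota_points B' in auto)
    finally show ?thesis by simp
  qed
  obtain a where a: "a > 0" "\<And>u. u \<in> {0..a} \<Longrightarrow> t + s * u \<in> D" "\<And>u. u \<in> {0..a} \<Longrightarrow> \<pi> (t + s * u) \<in> C"
    using C unfolding germ_in_def by metis
  obtain r where r: "r > 0" "\<And>t u. t \<in> D \<Longrightarrow> u \<in> D \<Longrightarrow> \<bar>t - u\<bar> < r \<Longrightarrow> \<pi> t = \<pi> u \<Longrightarrow> t = u"
    using pi_local_inj by blast
  define e where "e = min a (r / 2)"
  have e: "0 < e" "e \<le> a" "e < r" using a r by (auto simp: e_def)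
  have eD: "t + s * u \<in> D" "\<pi> (t + s * u) \<in> C" if "u \<in> {0..e}" for u using a that e by auto
  define \<gamma> where "\<gamma> = (\<lambda>u. \<phi> (inv g) (c (t + s * u)))"
  have ci: "inj_on c ?I"
  proof (rule inj_onI)
    fix x y assume "x \<in> ?I" "y \<in> ?I" "c x = c y"
    then show "x = y" using c_eq_iff[of x y] I inj_onD[OF I(2), of x y] by auto
  qed
  have gI: "\<gamma> u \<in> c ` ?I" if "u \<in> {0..e}" for u
  proof -
    have "\<gamma> u \<in> \<iota> ` B" using img' eD(2)[OF that] unfolding \<gamma>_def c_def by blast
    then show ?thesis using B by (auto simp: c_def)
  qed
  have gcont: "continuous_map (top_of_set {0..e}) (mtop M) \<gamma>"
  proof -
    have "continuous_map (top_of_set {0..e}) (top_of_set D) (\<lambda>u. t + s * u)"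
      using eD(1) by (auto intro!: continuous_intros)
    from continuous_map_compose[OF continuous_map_compose[OF this c_continuous] act_continuous[OF ig]]
    show ?thesis by (simp add: \<gamma>_def o_def)
  qed
  define \<tau> where "\<tau> = (\<lambda>u. the_inv_into ?I c (\<gamma> u))"
  have tau: "\<tau> u \<in> ?I" "c (\<tau> u) = \<gamma> u" if "u \<in> {0..e}" for u
    unfolding \<tau>_def using gI[OF that] the_inv_into_into[OF ci _ order.refl] f_the_inv_into_f[OF ci] by blast+
  \<comment> \<open>The inverse of a continuous injection from a compact space into a Hausdorff
    space is continuous on the image.\<close>
  have "continuous_map (subtopology (mtop M) (c ` ?I)) (top_of_set ?I) (the_inv_into ?I c)"
  proof (rule continuous_inverse_map[OF _ Hausdorff_M])
    show "continuous_map (top_of_set ?I) (mtop M) c"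
      using continuous_map_from_subtopology_mono[OF c_continuous I(1)] .
    show "compact_space (top_of_set ?I)" by (simp add: compact_space_subtopology)
  qed (use the_inv_into_f_f[OF ci] in auto)
  moreover have "continuous_map (top_of_set {0..e}) (subtopology (mtop M) (c ` ?I)) \<gamma>"
    using gcont gI by (auto simp: continuous_map_in_subtopology)
  ultimately have "continuous_map (top_of_set {0..e}) (top_of_set ?I) \<tau>"
    unfolding \<tau>_def using continuous_map_compose[unfolded o_def] by blast
  then have tc: "continuous_on {0..e} \<tau>" by (simp add: continuous_map_in_subtopology)
  have ti: "inj_on \<tau> {0..e}"
  proof (rule inj_onI)
    fix x y assume xy: "x \<in> {0..e}" "y \<in> {0..e}" "\<tau> x = \<tau> y"
    then have "\<gamma> x = \<gamma> y" using tau(2) by metis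
    then have "c (t + s * x) = c (t + s * y)"
      unfolding \<gamma>_def using act_inj[OF ig c_points c_points] eD(1) xy by blast
    then have "\<pi> (t + s * x) = \<pi> (t + s * y)" using c_eq_iff eD(1) xy by blast
    moreover have "\<bar>(t + s * x) - (t + s * y)\<bar> < r" using xy e s by auto
    ultimately have "t + s * x = t + s * y" using r(2) eD(1) xy by blast
    then show "x = y" using s by auto
  qed
  obtain s' where s': "s' \<in> {1, -1 :: real}" "strict_mono_on {0..e} (\<lambda>x. s' * \<tau> x)"
    using injective_continuous_strict_mono[OF tc ti e(1)] by blast
  have ss: "s' * s' = 1" using s'(1) by auto
  have gm: "germ_map (inv g) t s (\<tau> 0) s'"
  proof (rule germ_mapI[of e "\<lambda>u. s' * (\<tau> u - \<tau> 0)"])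
    show "continuous_on {0..e} (\<lambda>u. s' * (\<tau> u - \<tau> 0))" by (intro continuous_intros tc)
    show "strict_mono_on {0..e} (\<lambda>u. s' * (\<tau> u - \<tau> 0))"
      by (rule strict_mono_onI) (use strict_mono_onD[OF s'(2)] in \<open>auto simp: right_diff_distrib\<close>)
    fix u assume u: "u \<in> {0..e}"
    have eq: "\<tau> 0 + s' * (s' * (\<tau> u - \<tau> 0)) = \<tau> u" using ss by (simp flip: mult.assoc)
    show "t + s * u \<in> D" using eD(1)[OF u] .
    show "\<tau> 0 + s' * (s' * (\<tau> u - \<tau> 0)) \<in> D" unfolding eq using tau(1)[OF u] I by blast
    show "\<phi> (inv g) (c (t + s * u)) = c (\<tau> 0 + s' * (s' * (\<tau> u - \<tau> 0)))"
      unfolding eq using tau(2)[OF u] by (simp add: \<gamma>_def)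
  qed (use e in auto)
  have "germ_map g (\<tau> 0) s' t s"
    using germ_map_inv[OF gm ig] g group_G by (simp add: group.inv_inv)
  moreover have "germ_in (\<tau> 0) s' B" by (rule germ_map_germ_in[OF gm C(1) img' B'])
  \<comment> \<open>The far end of the lifted path is the required point of the arc; its signed
    distance from the start is positive by monotonicity.\<close>
  moreover have "\<exists>e>0. \<tau> 0 + s' * e \<in> ?I"
  proof (intro exI[of _ "s' * (\<tau> e - \<tau> 0)"] conjI)
    show "0 < s' * (\<tau> e - \<tau> 0)"
      using strict_mono_onD[OF s'(2), of 0 e] e(1) by (auto simp: right_diff_distrib)
    have "\<tau> 0 + s' * (s' * (\<tau> e - \<tau> 0)) = \<tau> e" using ss by (simp flip: mult.assoc)
    then show "\<tau> 0 + s' * (s' * (\<tau> e - \<tau> 0)) \<in> ?I" using tau(1)[of e] e(1) by simp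
  qed
  ultimately show ?thesis using that[OF s'(1) tau(1)[of 0]] e(1) by auto
qed

subsection \<open>Classes modulo the stabilizer\<close>

lemma cls_eq_iff:
  assumes "D \<noteq> {}" and g: "g \<in> carrier G" and h: "h \<in> carrier G"
  shows "coset g = coset h \<longleftrightarrow> inv g \<otimes> h \<in> H"
proof -
  interpret group G by (rule group_G)
  have sg: "subgroup H G" by (rule stab_subgroup[OF assms(1)])
  show ?thesis
  proof
    assume eq: "coset g = coset h"
    have "h \<in> h <# H"
      unfolding l_coset_def using subgroup.one_closed[OF sg] h by force
    then have "h \<in> g <# H" using eq by (simp add: cls_def)
    then obtain q where q: "q \<in> H" "h = g \<otimes> q" unfolding l_coset_def by blast
    then show "inv g \<otimes> h \<in> H"
      using g subgroup.subset[OF sg] by (auto simp: m_assoc[symmetric])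
  next
    assume q: "inv g \<otimes> h \<in> H"
    have "h = g \<otimes> (inv g \<otimes> h)" using g h by (simp add: m_assoc[symmetric])
    then have "h \<in> g <# H" unfolding l_coset_def using q by blast
    then show "coset g = coset h"
      unfolding cls_def using l_repr_independence[OF _ g sg] by blast
  qed
qed

lemma cls_mem:
  assumes "D \<noteq> {}" "g \<in> carrier G"
  shows "h \<in> coset g \<longleftrightarrow> h \<in> carrier G \<and> coset h = coset g"
proof -
  interpret group G by (rule group_G)
  have sg: "subgroup H G" by (rule stab_subgroup[OF assms(1)])
  have "h \<in> h <# H" if "h \<in> carrier G"
    unfolding l_coset_def using subgroup.one_closed[OF sg] that by force
  moreover have "h \<in> carrier G \<and> g <# H = h <# H" if "h \<in> g <# H"
    using that l_repr_independence[OF that assms(2) sg] l_coset_subset_G[OF subgroup.subset[OF sg] assms(2)] by blast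
  ultimately show ?thesis unfolding cls_def by blast
qed

text \<open>The stabilizer H need not be normal in G; products of classes are well defined for
  elements that normalize it.\<close>

definition nrm :: "'g set" where
  "nrm = {x \<in> carrier G. \<forall>q\<in>H. x \<otimes> q \<otimes> inv x \<in> H \<and> inv x \<otimes> q \<otimes> x \<in> H}"

lemma nrm_subgroup:
  assumes "D \<noteq> {}"
  shows "subgroup nrm G"
proof -
  interpret group G by (rule group_G)
  have sg: "subgroup H G" by (rule stab_subgroup[OF assms(1)])
  note HG = subgroup.mem_carrier[OF sg]
  show ?thesis
  proof (rule subgroupI)
    show "nrm \<subseteq> carrier G" by (auto simp: nrm_def)
    have "\<one> \<in> nrm" using HG by (auto simp: nrm_def)
    then show "nrm \<noteq> {}" by blast
    fix a assume a: "a \<in> nrm"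
    then show "inv a \<in> nrm" by (auto simp: nrm_def)
    fix b assume b: "b \<in> nrm"
    have ab: "a \<in> carrier G" "b \<in> carrier G" using a b by (auto simp: nrm_def)
    have "a \<otimes> b \<otimes> q \<otimes> inv (a \<otimes> b) = a \<otimes> (b \<otimes> q \<otimes> inv b) \<otimes> inv a"
      "inv (a \<otimes> b) \<otimes> q \<otimes> (a \<otimes> b) = inv b \<otimes> (inv a \<otimes> q \<otimes> a) \<otimes> b"
      if "q \<in> H" for q
      using ab HG[OF that] by (simp_all add: m_assoc inv_mult_group)
    then show "a \<otimes> b \<in> nrm"
      using a b ab by (simp add: nrm_def)
  qed
qed

text \<open>Changing x within its class inserts a stabilizer element between x and y, and it has to
  be moved past y. This is why the condition falls on the right-hand factor y.\<close>

lemma cls_mult: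
  assumes "D \<noteq> {}" and G: "x \<in> carrier G" "x' \<in> carrier G" "y \<in> nrm" "y' \<in> carrier G"
    and eq: "coset x = coset x'" "coset y = coset y'"
  shows "coset (x \<otimes> y) = coset (x' \<otimes> y')"
proof -
  interpret group G by (rule group_G)
  have sg: "subgroup H G" by (rule stab_subgroup[OF assms(1)])
  have yG: "y \<in> carrier G" using G by (simp add: nrm_def)
  define a where "a = inv x \<otimes> x'"
  define b where "b = inv y \<otimes> y'"
  have ab: "a \<in> H" "b \<in> H" using eq cls_eq_iff[OF assms(1)] G yG by (auto simp: a_def b_def)
  have "inv (x \<otimes> y) \<otimes> (x' \<otimes> y') = (inv y \<otimes> a \<otimes> y) \<otimes> b"
    using G yG by (simp add: a_def b_def m_assoc inv_mult_group) (simp add: m_assoc[symmetric])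
  also have "\<dots> \<in> H" using ab G(3) subgroup.m_closed[OF sg] by (simp add: nrm_def)
  finally show ?thesis using cls_eq_iff[OF assms(1)] G yG by simp
qed

text \<open>Left cosets of inverses compare \<open>x \<otimes> inv x'\<close> instead of
  \<open>inv x' \<otimes> x\<close>; the two are conjugate by x.\<close>

lemma cls_inv:
  assumes "D \<noteq> {}" and G: "x \<in> nrm" "x' \<in> carrier G" and eq: "coset x = coset x'"
  shows "coset (inv x) = coset (inv x')"
proof -
  interpret group G by (rule group_G)
  have sg: "subgroup H G" by (rule stab_subgroup[OF assms(1)])
  have xG: "x \<in> carrier G" using G by (simp add: nrm_def)
  have "inv x \<otimes> x' \<in> H" using eq cls_eq_iff[OF assms(1)] G xG by auto
  then have "inv (inv x \<otimes> x') \<in> H" by (rule subgroup.m_inv_closed[OF sg])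
  then have "x \<otimes> inv (inv x \<otimes> x') \<otimes> inv x \<in> H" using G(1) by (simp add: nrm_def)
  moreover have "x \<otimes> inv (inv x \<otimes> x') \<otimes> inv x = inv (inv x) \<otimes> inv x'"
    using xG G(2) by (simp add: inv_mult_group m_assoc)
  ultimately show ?thesis using cls_eq_iff[OF assms(1)] G xG by simp
qed

lemma cls_nat_pow:
  assumes "D \<noteq> {}" and G: "x \<in> nrm" "x' \<in> carrier G" and eq: "coset x = coset x'"
  shows "coset (x [^] (k::nat)) = coset (x' [^] k)"
proof -
  interpret group G by (rule group_G)
  have xG: "x \<in> carrier G" using G by (simp add: nrm_def)
  show ?thesis
    by (induction k) (use cls_mult[OF assms(1) _ _ G _ eq] xG G in \<open>auto\<close>)
qed

lemma cls_int_pow: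
  assumes "D \<noteq> {}" and G: "x \<in> nrm" "x' \<in> carrier G" and eq: "coset x = coset x'"
  shows "coset (x [^] (k::int)) = coset (x' [^] k)"
proof -
  interpret group G by (rule group_G)
  have xG: "x \<in> carrier G" using G by (simp add: nrm_def)
  interpret N: subgroup nrm G by (rule nrm_subgroup[OF assms(1)])
  have pow: "x [^] (n::nat) \<in> nrm" for n by (induction n) (use G in auto)
  show ?thesis
    using cls_nat_pow[OF assms] cls_inv[OF assms(1) pow _ cls_nat_pow[OF assms]] xG G
    by (cases k rule: int_cases2) (simp_all add: int_pow_int int_pow_neg)
qed

lemma germ_map_stab:
  assumes "germ_map g t s t' s'" "q \<in> H"
  shows "germ_map q t s t s"
proof -
  obtain e where e: "e > 0" "\<And>u. u \<in> {0..e} \<Longrightarrow> t + s * u \<in> D"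
    using germ_mapE[OF assms(1)] by metis
  show ?thesis
    by (rule germ_mapI[of e "\<lambda>u. u"]) (use e stab_act[OF assms(2)] in \<open>auto simp: strict_mono_on_def\<close>)
qed

end

subsection \<open>Translations along a free segment\<close>

text \<open>A free segment with a chosen orientation. In the applications to a neighbouring segment,
  q is the end shared with the neighbour and p the far end.\<close>

locale free_arc = arc_setting +
  fixes A p q
  assumes free: "A \<in> free_segments G \<phi> M S \<iota>" and pq: "arc p q" and A: "A = \<pi> ` closed_segment p q"
begin

abbreviation \<sigma> where "\<sigma> \<equiv> sgn (q - p)"

lemma A_compact: "compactin (mtop S) A" unfolding A by (rule arc_image_compact[OF pq])

lemma A_points: "A \<subseteq> points S" using A_compact compactin_subset_topspace by blast

lemma D_ne: "D \<noteq> {}" using pq by (auto simp: arc_def)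

lemma sigma: "\<sigma> \<in> {1, -1}" "- \<sigma> \<in> {1, -1}" using sgn_arc[OF pq] by auto

lemma germ_p: "germ_in p \<sigma> A" and germ_q: "germ_in q (- \<sigma>) A"
  using germ_in_arc[OF pq] pq unfolding A arc_def by auto

lemma pqD: "p \<in> D" "q \<in> D" using pq by (auto simp: arc_def)

lemma pi_inj_arc: "x \<in> closed_segment p q \<Longrightarrow> y \<in> closed_segment p q \<Longrightarrow> \<pi> x = \<pi> y \<Longrightarrow> x = y"
  using pq inj_onD unfolding arc_def by metis

text \<open>At an endpoint only one direction leads into the arc. Combined with the last conclusion
  of \<open>pull_germ\<close>, it identifies the unknown direction of a pulled-back germ.\<close>

lemma direction:
  assumes "s \<in> {1, -1}" "e > 0"
  shows "p + s * e \<in> closed_segment p q \<Longrightarrow> s = \<sigma>" and "q + s * e \<in> closed_segment p q \<Longrightarrow> s = - \<sigma>"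
  using assms pq by (auto simp: closed_segment_eq_real_ivl sgn_if arc_def split: if_splits)

lemma germ_stab:
  assumes "g \<in> carrier G" "germ_map g v s v' s'" "germ_in v s A" "germ_in v' s' A" "s \<in> {1, -1}" "s' \<in> {1, -1}"
  shows "g \<in> H"
  using free_germ[OF free A_compact assms] .

lemma interior_arc:
  assumes "x \<in> closed_segment p q" "x \<noteq> p" "x \<noteq> q"
  shows "x \<in> interior D" "s \<in> {1, -1} \<Longrightarrow> germ_in x s A"
proof -
  have g: "germ_in x \<sigma> A" "germ_in x (- \<sigma>) A" using germ_in_arc[OF pq assms(1)] assms(2,3) unfolding A by auto
  then show "x \<in> interior D" using germ_both_interior sigma(1) by blast
  show "germ_in x s A" if "s \<in> {1, -1}" using g sigma(1) that by auto
qed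

text \<open>Going back by \<open>inv f\<close>, staying put under h and returning by f fixes the
  target germ. Once this germ lies in \<open>A\<close>, freeness puts the conjugate into
  \<open>H\<close>. Only the target germ has to lie in \<open>A\<close>; the source germ may be
  anywhere.\<close>

lemma conj_stab:
  assumes f: "f \<in> carrier G" "germ_map f v s w s'" "germ_in w s' A" "s \<in> {1, -1}" "s' \<in> {1, -1}" and h: "h \<in> H"
  shows "f \<otimes> h \<otimes> inv f \<in> H"
proof -
  interpret group G by (rule group_G)
  have hG: "h \<in> carrier G" using h subgroup.mem_carrier[OF stab_subgroup[OF D_ne]] by blast
  have "germ_map (h \<otimes> inv f) w s' v s"
    by (rule germ_map_comp[OF germ_map_inv[OF f(2,1)] germ_map_stab[OF f(2) h]]) (use f hG in auto)
  then have "germ_map (f \<otimes> (h \<otimes> inv f)) w s' w s'"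
    by (rule germ_map_comp[OF _ f(2)]) (use f hG in auto)
  then show ?thesis
    using germ_stab[OF _ _ f(3) f(3) f(5) f(5)] f(1) hG by (simp add: m_assoc)
qed

text \<open>The germ of A at q that points into A is the image under f of the germ at p outside of A,
  by analytic continuation; this controls conjugation by f, not only by its inverse.\<close>

lemma translation_nrm:
  assumes f: "f \<in> carrier G" "germ_map f p \<sigma> q \<sigma>" and int: "p \<in> interior D" "q \<in> interior D"
  shows "f \<in> nrm"
proof -
  interpret group G by (rule group_G)
  have ext: "germ_map f p (- \<sigma>) q (- \<sigma>)" by (rule germ_map_extend[OF f(2,1) int sigma(1) sigma(1)])
  have fi: "inv f \<in> carrier G" using f by simp
  show ?thesis
    unfolding nrm_def
    using conj_stab[OF f(1) ext germ_q sigma(2) sigma(2)]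
      conj_stab[OF fi germ_map_inv[OF f(2,1)] germ_p sigma(1) sigma(1)] f(1) by auto
qed

text \<open>If g carries a germ inside C to another one inside C, then
  \<open>inv f \<otimes> (g \<otimes> f)\<close> does the same inside \<open>B\<close>, hence
  belongs to \<open>H\<close>. Returning to g conjugates by f, whence the hypothesis on f. The lemma
  supplies the free segment beyond an endpoint that the boundary class asks for.\<close>

lemma translate_free:
  assumes f: "f \<in> carrier G" "\<And>h. h \<in> H \<Longrightarrow> f \<otimes> h \<otimes> inv f \<in> H"
    and B: "B \<subseteq> A" and img: "\<phi> f ` \<iota> ` B = \<iota> ` C" and xy: "arc x y" and C: "C = \<pi> ` closed_segment x y"
  shows "C \<in> free_segments G \<phi> M S \<iota>"
proof -
  interpret group G by (rule group_G)
  have Cseg: "segment S C" and Ccomp: "compactin (mtop S) C"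
    unfolding C using arc_image_segment[OF xy] arc_image_compact[OF xy] .
  have CS: "C \<subseteq> points S" by (rule segment_subset[OF Cseg])
  have "overlaps \<phi> M S \<iota> g C C \<longleftrightarrow> g \<in> H" if g: "g \<in> carrier G" for g
  proof
    assume "overlaps \<phi> M S \<iota> g C C"
    then obtain K K' where K: "segment S K" "K \<subseteq> C" "segment S K'" "K' \<subseteq> C" "\<phi> g ` \<iota> ` K = \<iota> ` K'"
      unfolding overlaps_def by blast
    obtain t s where t: "s \<in> {1, -1}" "germ_in t s K'" using segment_lift[OF K(3)] by metis
    obtain v s' where v: "s' \<in> {1, -1}" "germ_map g v s' t s" "germ_in v s' K"
      using pull_germ[OF xy K(2)[unfolded C] g K(5) t(2) segment_subset[OF K(3)] t(1)] by metis
    obtain w r where w: "r \<in> {1, -1}" "germ_map f w r t s" "germ_in w r B"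
      using pull_germ[OF pq B[unfolded A] f(1) img germ_in_mono[OF t(2) K(4)] CS t(1)] by metis
    obtain w' r' where w': "r' \<in> {1, -1}" "germ_map f w' r' v s'" "germ_in w' r' B"
      using pull_germ[OF pq B[unfolded A] f(1) img germ_in_mono[OF v(3) K(2)] CS v(1)] by metis
    have "germ_map (g \<otimes> f) w' r' t s" by (rule germ_map_comp[OF w'(2) v(2) f(1) g])
    then have "germ_map (inv f \<otimes> (g \<otimes> f)) w' r' w r"
      by (rule germ_map_comp[OF _ germ_map_inv[OF w(2) f(1)]]) (use f g in auto)
    then have "inv f \<otimes> (g \<otimes> f) \<in> H"
      using germ_stab[OF _ _ germ_in_mono[OF w'(3) B] germ_in_mono[OF w(3) B] w'(1) w(1)] f(1) g by simp
    from f(2)[OF this] show "g \<in> H" using f(1) g by (simp add: m_assoc) (simp add: m_assoc[symmetric])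
  next
    assume h: "g \<in> H"
    obtain t s where t: "s \<in> {1, -1}" "germ_in t s C" using segment_lift[OF Cseg] by metis
    obtain e where e: "e > 0" "\<And>u. u \<in> {0..e} \<Longrightarrow> t + s * u \<in> D" using t(2) unfolding germ_in_def by metis
    have "germ_map g t s t s"
      by (rule germ_mapI[of e "\<lambda>u. u"]) (use e stab_act[OF h] in \<open>auto simp: strict_mono_on_def\<close>)
    then show "overlaps \<phi> M S \<iota> g C C" using germ_overlaps t Ccomp by blast
  qed
  then show ?thesis unfolding free_segments_def using Cseg by blast
qed

end

context arc_setting
begin

lemma arc_sub:
  assumes "arc p q" "x \<in> closed_segment p q" "y \<in> closed_segment p q" "x \<noteq> y"
  shows "arc x y"
proof -
  have "closed_segment x y \<subseteq> closed_segment p q"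
    using assms(2,3) by (simp add: closed_segment_subset)
  then show ?thesis using assms unfolding arc_def by (meson inj_on_subset subset_trans)
qed

text \<open>The boundary class is formulated with compact segments, so the germ is truncated to
  compact arcs on both sides of t, matched exactly, endpoints included. The bound \<open>E\<close>
  keeps them inside a given neighbourhood of t.\<close>

lemma germ_map_arcs:
  assumes gm: "germ_map g t (- s) t s" and s: "s \<in> {1, -1}" and E: "E > 0"
  obtains a b where "0 < a" "a \<le> E" "0 < b" "b \<le> E"
    "\<phi> g ` \<iota> ` \<pi> ` closed_segment (t - s * a) t = \<iota> ` \<pi> ` closed_segment t (t + s * b)"
    "\<phi> g (c (t - s * a)) = c (t + s * b)"
proof -
  obtain e \<rho> where gm: "e > 0" "continuous_on {0..e} \<rho>" "strict_mono_on {0..e} \<rho>" "\<rho> 0 = 0"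
    "\<And>u. u \<in> {0..e} \<Longrightarrow> \<phi> g (c (t + (- s) * u)) = c (t + s * \<rho> u)"
    using germ_mapE[OF gm] by metis
  obtain d where d: "d > 0" "d \<le> e" "\<And>u. u \<in> {0..d} \<Longrightarrow> \<rho> u \<in> {0..E}"
    using reparam_small[OF gm(1-4) E] by metis
  define a where "a = min d E"
  have a: "0 < a" "a \<le> d" "a \<le> e" "a \<le> E" using d E by (auto simp: a_def)
  have b: "0 < \<rho> a" "\<rho> a \<le> E" using strict_mono_onD[OF gm(3), of 0 a] a gm(4) d(3)[of a] by auto
  have seg: "closed_segment (t - s * a') t = (\<lambda>u. t + (- s) * u) ` {0..a'}"
    "closed_segment t (t + s * a') = (\<lambda>u. t + s * u) ` {0..a'}" if "0 < a'" for a'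
  proof -
    have sb: "{x - y..x} = (\<lambda>u. x - u) ` {0..y}" "{x..x + y} = (\<lambda>u. x + u) ` {0..y}" for x y :: real
      by (auto intro!: image_eqI[of _ _ "x - _"] image_eqI[of _ _ "_ - x"])
    show "closed_segment (t - s * a') t = (\<lambda>u. t + (- s) * u) ` {0..a'}"
      "closed_segment t (t + s * a') = (\<lambda>u. t + s * u) ` {0..a'}"
      using s that sb[of t a'] by (auto simp: closed_segment_eq_real_ivl)
  qed
  have img: "\<rho> ` {0..a} = {0..\<rho> a}"
  proof (intro equalityI subsetI)
    fix y assume "y \<in> \<rho> ` {0..a}"
    then obtain u where u: "0 \<le> u" "u \<le> a" "y = \<rho> u" by auto
    have "\<rho> 0 \<le> \<rho> u" "\<rho> u \<le> \<rho> a"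
      using strict_mono_onD[OF gm(3), of 0 u] strict_mono_onD[OF gm(3), of u a] u a
      by (cases "u = 0"; cases "u = a"; force)+
    then show "y \<in> {0..\<rho> a}" using u gm(4) by auto
  next
    fix y assume y: "y \<in> {0..\<rho> a}"
    have "continuous_on {0..a} \<rho>" using continuous_on_subset[OF gm(2)] a(3) by auto
    then obtain u where "0 \<le> u" "u \<le> a" "\<rho> u = y" using IVT'[of \<rho> 0 y a] y gm(4) a(1) by auto
    then show "y \<in> \<rho> ` {0..a}" by (intro image_eqI[of _ _ u]) auto
  qed
  have "\<phi> g ` \<iota> ` \<pi> ` closed_segment (t - s * a) t = (\<lambda>u. \<phi> g (c (t + (- s) * u))) ` {0..a}"
    unfolding seg(1)[OF a(1)] by (simp add: image_image c_def)
  also have "\<dots> = (\<lambda>u. c (t + s * \<rho> u)) ` {0..a}"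
    by (rule image_cong[OF refl]) (use gm(5) a in auto)
  also have "\<dots> = (\<lambda>u. c (t + s * u)) ` \<rho> ` {0..a}" by (simp add: image_image)
  also have "\<dots> = \<iota> ` \<pi> ` closed_segment t (t + s * \<rho> a)"
    unfolding img seg(2)[OF b(1)] by (simp add: image_image c_def)
  finally have "\<phi> g ` \<iota> ` \<pi> ` closed_segment (t - s * a) t = \<iota> ` \<pi> ` closed_segment t (t + s * \<rho> a)" .
  moreover have "\<phi> g (c (t - s * a)) = c (t + s * \<rho> a)" using gm(5)[of a] a by simp
  ultimately show ?thesis using that[OF a(1,4) b] by blast
qed

end

context free_arc
begin

text \<open>There are two directions at q, and the one pointing into the arc is occupied by
  \<open>A\<close>.\<close>

lemma adjacent_germ:
  assumes C: "segment S C" "\<pi> q \<in> C" and fin: "finite (A \<inter> C)"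
  shows "germ_in q \<sigma> C"
proof -
  obtain s where s: "s \<in> {1, -1}" "germ_in q s C" using segment_germ[OF C(1) pqD(2) C(2)] by metis
  have "s \<noteq> - \<sigma>" using germ_in_infinite[OF germ_q _ sigma(2)] s(2) fin by metis
  then have "s = \<sigma>" using s(1) sigma by auto
  then show ?thesis using s(2) by simp
qed

text \<open>An element reflecting A at its endpoint q represents the boundary class there, and it fixes
  that endpoint, contrary to positivity.\<close>

lemma boundary_class_reflection:
  assumes q: "q \<in> interior D" and g: "g \<in> carrier G" and gm: "germ_map g q (- \<sigma>) q \<sigma>"
  shows "boundary_class G \<phi> M S \<iota> A (\<pi> q) = coset g"
proof -
  interpret group G by (rule group_G)
  \<comment> \<open>The arc is prolonged beyond q while \<open>\<pi>\<close> stays injective. On the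
    circle this prevents the reflected piece from meeting \<open>A\<close> again at its other
    end.\<close>
  obtain E where E: "E > 0" "arc p (q + \<sigma> * E)"
  proof -
    obtain E where "E > 0" "closed_segment p (q + \<sigma> * E) \<subseteq> D" "inj_on \<pi> (closed_segment p (q + \<sigma> * E))"
      using extend_arc[of p q] pq q unfolding arc_def by metis
    moreover have "p \<noteq> q + \<sigma> * E" using pq \<open>E > 0\<close> by (auto simp: arc_def sgn_if split: if_splits)
    ultimately show ?thesis using that unfolding arc_def by blast
  qed
  \<comment> \<open>Bounding by the length of the arc keeps the piece before q inside
    \<open>A\<close>; bounding by \<open>E\<close> keeps its reflection inside the
    prolongation.\<close>
  define E' where "E' = min E \<bar>q - p\<bar>"
  have pq_ne: "p \<noteq> q" using pq by (simp add: arc_def)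
  have E': "E' > 0" "E' \<le> E" "E' \<le> \<bar>q - p\<bar>" using E(1) pq_ne by (auto simp: E'_def)
  obtain a b where ab: "0 < a" "a \<le> E'" "0 < b" "b \<le> E'"
    "\<phi> g ` \<iota> ` \<pi> ` closed_segment (q - \<sigma> * a) q = \<iota> ` \<pi> ` closed_segment q (q + \<sigma> * b)"
    "\<phi> g (c (q - \<sigma> * a)) = c (q + \<sigma> * b)"
    using germ_map_arcs[OF gm sigma(1) E'(1)] by metis
  define x where "x = q - \<sigma> * a"
  define y where "y = q + \<sigma> * b"
  have big: "inj_on \<pi> (closed_segment p (q + \<sigma> * E))" using E(2) by (simp add: arc_def)
  have sub: "closed_segment p q \<subseteq> closed_segment p (q + \<sigma> * E)" "y \<in> closed_segment p (q + \<sigma> * E)"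
    "closed_segment q y \<subseteq> closed_segment p (q + \<sigma> * E)" "x \<in> closed_segment p q" "x \<noteq> q" "y \<noteq> q"
    "closed_segment p q \<inter> closed_segment q y = {q}" "y \<notin> closed_segment p q"
    "q \<in> closed_segment p (q + \<sigma> * E)"
    using ab E' pq_ne by (auto simp: x_def y_def closed_segment_eq_real_ivl sgn_if split: if_splits)
  have inj: "u = v" if "\<pi> u = \<pi> v" "u \<in> closed_segment p (q + \<sigma> * E)" "v \<in> closed_segment p (q + \<sigma> * E)" for u v
    using inj_onD[OF big that] .
  have xq: "arc x q" by (rule arc_sub[OF pq sub(4) _ sub(5)]) simp
  have qy: "arc q y" by (rule arc_sub[OF E(2) sub(9,2)]) (use sub in auto)
  define B where "B = \<pi> ` closed_segment x q"
  define Z where "Z = \<pi> ` closed_segment q y"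
  have BA: "B \<subseteq> A" unfolding B_def A using sub(4) by (intro image_mono) (simp add: closed_segment_subset)
  have img: "\<phi> g ` \<iota> ` B = \<iota> ` Z" using ab(5) by (simp add: B_def Z_def x_def y_def)
  have bdA: "seg_bd S A = {\<pi> p, \<pi> q}" unfolding A using seg_bd_arc pq unfolding arc_def by blast
  have bdB: "seg_bd S B = {\<pi> x, \<pi> q}" unfolding B_def using seg_bd_arc xq unfolding arc_def by blast
  have bdZ: "seg_bd S Z = {\<pi> q, \<pi> y}" unfolding Z_def using seg_bd_arc qy unfolding arc_def by blast
  have AZ: "A \<inter> Z = {\<pi> q}"
  proof
    show "A \<inter> Z \<subseteq> {\<pi> q}"
    proof
      fix z assume "z \<in> A \<inter> Z"
      then obtain u v where uv: "u \<in> closed_segment p q" "v \<in> closed_segment q y" "z = \<pi> u" "z = \<pi> v"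
        unfolding A Z_def by blast
      then have "u = v" using inj[of u v] sub by auto
      then have "u \<in> closed_segment p q \<inter> closed_segment q y" using uv by simp
      then have "u = q" unfolding sub(7) by simp
      then show "z \<in> {\<pi> q}" using uv by simp
    qed
  qed (auto simp: A Z_def)
  have bdAZ: "seg_bd S A \<inter> seg_bd S Z = {\<pi> q}"
  proof -
    have "seg_bd S A \<subseteq> A" "seg_bd S Z \<subseteq> Z" by (auto simp: seg_bd_def)
    then show ?thesis using AZ bdA bdZ by blast
  qed
  \<comment> \<open>Continuation at q gives the opposite half of the reflection: the germ outside
    \<open>A\<close> goes to the germ inside. With a target in \<open>A\<close>,
    \<open>conj_stab\<close> applies to g.\<close>
  have gm': "germ_map g q \<sigma> q (- \<sigma>)"
    using germ_map_extend[OF gm g q q sigma(2,1)] by simp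
  have conj: "g \<otimes> h \<otimes> inv g \<in> H" if "h \<in> H" for h
    by (rule conj_stab[OF g gm' germ_q sigma that])
  have Zfree: "Z \<in> free_segments G \<phi> M S \<iota>"
    by (rule translate_free[OF g conj BA img qy Z_def])
  have gH: "g \<notin> H"
  proof
    assume "g \<in> H"
    then have "c x = c y" using stab_act[of g x] ab(6) xq by (auto simp: x_def y_def arc_def)
    then have "\<pi> x = \<pi> y" using c_eq_iff[of x y] xq qy by (auto simp: arc_def)
    then have "x = y" using inj sub by blast
    then show False using sub by simp
  qed
  have one: "coset g \<noteq> coset \<one>"
    using cls_eq_iff[OF D_ne, of "\<one>" g] g gH by auto
  have gq: "\<phi> g (\<iota> (\<pi> q)) = \<iota> (\<pi> q)" using germ_map_points(3)[OF gm] by (simp add: c_def)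
  show ?thesis
    unfolding boundary_class_def
  proof (rule the_equality)
    show "\<exists>g'\<in>carrier G. coset g = coset g' \<and> coset g \<noteq> coset \<one> \<and>
        (\<exists>\<Sigma>b b \<Sigma>z.
           segment S \<Sigma>b \<and> compactin (mtop S) \<Sigma>b \<and> \<Sigma>b \<subseteq> A \<and>
           b \<in> seg_bd S A \<inter> seg_bd S \<Sigma>b \<and>
           \<Sigma>z \<in> free_segments G \<phi> M S \<iota> \<and> compactin (mtop S) \<Sigma>z \<and>
           A \<inter> \<Sigma>z = {\<pi> q} \<and> seg_bd S A \<inter> seg_bd S \<Sigma>z = {\<pi> q} \<and>
           \<phi> g' ` \<iota> ` \<Sigma>b = \<iota> ` \<Sigma>z \<and> \<phi> g' (\<iota> b) = \<iota> (\<pi> q))"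
    proof (rule bexI[OF _ g], intro conjI refl one)
      have "segment S B" "compactin (mtop S) B" "compactin (mtop S) Z"
        unfolding B_def Z_def by (fact arc_image_segment[OF xq] arc_image_compact[OF xq] arc_image_compact[OF qy])+
      moreover have "\<pi> q \<in> seg_bd S A \<inter> seg_bd S B" unfolding bdA bdB by simp
      ultimately have "segment S B \<and> compactin (mtop S) B \<and> B \<subseteq> A \<and>
           \<pi> q \<in> seg_bd S A \<inter> seg_bd S B \<and>
           Z \<in> free_segments G \<phi> M S \<iota> \<and> compactin (mtop S) Z \<and>
           A \<inter> Z = {\<pi> q} \<and> seg_bd S A \<inter> seg_bd S Z = {\<pi> q} \<and>
           \<phi> g ` \<iota> ` B = \<iota> ` Z \<and> \<phi> g (\<iota> (\<pi> q)) = \<iota> (\<pi> q)"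
        using BA AZ bdAZ img gq Zfree by (intro conjI)
      then show "\<exists>\<Sigma>b b \<Sigma>z.
           segment S \<Sigma>b \<and> compactin (mtop S) \<Sigma>b \<and> \<Sigma>b \<subseteq> A \<and>
           b \<in> seg_bd S A \<inter> seg_bd S \<Sigma>b \<and>
           \<Sigma>z \<in> free_segments G \<phi> M S \<iota> \<and> compactin (mtop S) \<Sigma>z \<and>
           A \<inter> \<Sigma>z = {\<pi> q} \<and> seg_bd S A \<inter> seg_bd S \<Sigma>z = {\<pi> q} \<and>
           \<phi> g ` \<iota> ` \<Sigma>b = \<iota> ` \<Sigma>z \<and> \<phi> g (\<iota> b) = \<iota> (\<pi> q)"
        by (intro exI)
    qed
  next
    fix k
    assume "\<exists>g'\<in>carrier G. k = coset g' \<and> k \<noteq> coset \<one> \<and>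
        (\<exists>\<Sigma>b b \<Sigma>z.
           segment S \<Sigma>b \<and> compactin (mtop S) \<Sigma>b \<and> \<Sigma>b \<subseteq> A \<and>
           b \<in> seg_bd S A \<inter> seg_bd S \<Sigma>b \<and>
           \<Sigma>z \<in> free_segments G \<phi> M S \<iota> \<and> compactin (mtop S) \<Sigma>z \<and>
           A \<inter> \<Sigma>z = {\<pi> q} \<and> seg_bd S A \<inter> seg_bd S \<Sigma>z = {\<pi> q} \<and>
           \<phi> g' ` \<iota> ` \<Sigma>b = \<iota> ` \<Sigma>z \<and> \<phi> g' (\<iota> b) = \<iota> (\<pi> q))"
    then obtain g' B' Z' where g': "g' \<in> carrier G" "k = coset g'" "B' \<subseteq> A"
      "Z' \<in> free_segments G \<phi> M S \<iota>" "A \<inter> Z' = {\<pi> q}" "\<phi> g' ` \<iota> ` B' = \<iota> ` Z'"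
      by blast
    have Z': "segment S Z'" using g'(4) by (simp add: free_segments_def)
    have "germ_in q \<sigma> Z'" by (rule adjacent_germ[OF Z']) (use g'(5) in auto)
    \<comment> \<open>For uniqueness, any competitor \<open>g'\<close> also produces the germ that
      leaves \<open>A\<close> at q, starting from a germ in \<open>A\<close>. The reflection g
      brings that germ back into \<open>A\<close>, so \<open>inv g \<otimes> g'\<close> is in the
      stabilizer.\<close>
    then obtain w r where w: "r \<in> {1, -1}" "germ_map g' w r q \<sigma>" "germ_in w r B'"
      using pull_germ[OF pq g'(3)[unfolded A] g'(1,6) _ segment_subset[OF Z'] sigma(1)] by metis
    have "germ_map (inv g \<otimes> g') w r q (- \<sigma>)"
      by (rule germ_map_comp[OF w(2) germ_map_inv[OF gm g] g'(1)]) (use g in simp)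
    then have "inv g \<otimes> g' \<in> H"
      using germ_stab[OF _ _ germ_in_mono[OF w(3) g'(3)] germ_q w(1) sigma(2)] g g'(1) by simp
    then show "k = coset g" using cls_eq_iff[OF D_ne g g'(1)] g'(2) by simp
  qed
qed

text \<open>The germ of C at q is pulled back to the arc, and the position of its source is the only
  question. The source set \<open>B\<close> may be a proper part of \<open>A\<close>, so that end
  segments of an interval decomposition are included.\<close>

lemma positive_translation:
  assumes pos: "positive_segment G \<phi> M S \<iota> A" and q: "q \<in> interior D" and g: "g \<in> carrier G"
    and B: "B \<subseteq> A" and img: "\<phi> g ` \<iota> ` B = \<iota> ` C" and C: "germ_in q \<sigma> C" "C \<subseteq> points S"
  shows "germ_map g p \<sigma> q \<sigma>"
proof -
  obtain v s e where v: "s \<in> {1, -1}" "v \<in> closed_segment p q" "germ_map g v s q \<sigma>" "germ_in v s B"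
    "e > 0" "v + s * e \<in> closed_segment p q"
    using pull_germ[OF pq B[unfolded A] g img C sigma(1)] by metis
  consider "v \<noteq> p" "v \<noteq> q" | "v = q" | "v = p" by blast
  then show ?thesis
  proof cases
    case 1
    have "germ_map g v (- s) q (- \<sigma>)"
      by (rule germ_map_extend[OF v(3) g interior_arc(1)[OF v(2) 1] q v(1) sigma(1)])
    then have "g \<in> H"
      using germ_stab[OF g _ interior_arc(2)[OF v(2) 1] germ_q _ sigma(2)] v(1) by auto
    \<comment> \<open>An element of the stabilizer fixes \<open>c v\<close>, whereas g carries it to
      \<open>c q\<close>; injectivity on the arc makes v an endpoint after all.\<close>
    then have "c v = c q" using stab_act[of g v] germ_map_points[OF v(3)] by auto
    then have "\<pi> v = \<pi> q" using c_eq_iff germ_map_points(1)[OF v(3)] pqD by blast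
    then have "v = q" using pi_inj_arc[OF v(2), of q] by simp
    then show ?thesis using 1 by simp
  next
    case 2
    have "s = - \<sigma>" using direction(2)[OF v(1,5)] v(6) 2 by simp
    then have gm: "germ_map g q (- \<sigma>) q \<sigma>" using v(3) 2 by simp
    have "\<pi> q \<in> seg_bd S A" using seg_bd_arc pq unfolding A arc_def by auto
    moreover have "\<pi> q \<in> seg_int S (points S)" using interior_seg_int[OF q] .
    ultimately have "\<forall>h\<in>coset g. h \<notin> stabilizer G \<phi> (\<iota> (\<pi> q))"
      using pos boundary_class_reflection[OF q g gm] unfolding positive_segment_def by auto
    moreover have "g \<in> coset g" using cls_mem[OF D_ne g] g by simp
    moreover have "g \<in> stabilizer G \<phi> (\<iota> (\<pi> q))"
      using germ_map_points(3)[OF gm] g by (simp add: stabilizer_def c_def)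
    ultimately show ?thesis by blast
  next
    case 3
    then show ?thesis using direction(1)[OF v(1,5)] v(3,6) by simp
  qed
qed

text \<open>Induction along the segments, with f in place of their first class. Only the segments
  before the last must be images of all of \<open>A\<close>, since the chain has to cross them; the
  last may be the image of a part. The points y are the successive common endpoints, and
  \<open>y k \<noteq> y (k - 1)\<close> ensures that segment k is left at its other end, which has
  to be demanded on a circle made of two segments.\<close>

theorem translation_chain:
  fixes N :: nat
  assumes int: "p \<in> interior D" "q \<in> interior D"
    and f: "f \<in> carrier G" "germ_map f p \<sigma> q \<sigma>"
    and g: "\<And>k. 1 \<le> k \<Longrightarrow> k \<le> N \<Longrightarrow> g k \<in> carrier G"
    and seg: "\<And>k. 1 \<le> k \<Longrightarrow> k \<le> N \<Longrightarrow> segment S (Sg k)"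
    and img: "\<And>k. 1 \<le> k \<Longrightarrow> k \<le> N \<Longrightarrow> \<exists>B\<subseteq>A. \<phi> (g k) ` \<iota> ` B = \<iota> ` Sg k"
    and full: "\<And>k. 1 \<le> k \<Longrightarrow> k < N \<Longrightarrow> \<phi> (g k) ` \<iota> ` A = \<iota> ` Sg k"
    and first: "germ_in q \<sigma> (Sg 1)" "y 0 = \<pi> q"
    and adj: "\<And>k. 1 \<le> k \<Longrightarrow> k < N \<Longrightarrow> finite (Sg k \<inter> Sg (Suc k)) \<and> y k \<in> Sg k \<inter> Sg (Suc k) \<and> y k \<noteq> y (k - 1)"
    and k: "1 \<le> k" "k \<le> N"
  shows "coset (g k) = coset (f [^] k)"
proof -
  interpret group G by (rule group_G)
  \<comment> \<open>The invariant: the k-th power of f carries the germ of \<open>A\<close> at p to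
    the germ at which segment k begins, based at \<open>y (k - 1)\<close> and pointing into the
    segment. By freeness of \<open>A\<close> this alone determines the class of
    \<open>g k\<close>.\<close>
  define P where "P = (\<lambda>k x s. s \<in> {1, -1} \<and> \<pi> x = y (k - 1) \<and> germ_map (f [^] k) p \<sigma> x s \<and> germ_in x s (Sg k))"
  have P_cls: "coset (g k) = coset (f [^] k)" if k: "1 \<le> k" "k \<le> N" and P: "P k x s" for k x s
  proof -
    have P: "s \<in> {1, -1}" "germ_map (f [^] k) p \<sigma> x s" "germ_in x s (Sg k)" using P by (auto simp: P_def)
    obtain B where B: "B \<subseteq> A" "\<phi> (g k) ` \<iota> ` B = \<iota> ` Sg k" using img[OF k] by blast
    obtain v r where v: "r \<in> {1, -1}" "germ_map (g k) v r x s" "germ_in v r B"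
      using pull_germ[OF pq B(1)[unfolded A] g[OF k] B(2) P(3) segment_subset[OF seg[OF k]] P(1)] by metis
    have "germ_map (inv (g k) \<otimes> f [^] k) p \<sigma> v r"
      by (rule germ_map_comp[OF P(2) germ_map_inv[OF v(2) g[OF k]]]) (use f g[OF k] in auto)
    then have "inv (g k) \<otimes> f [^] k \<in> H"
      using germ_stab[OF _ _ germ_p germ_in_mono[OF v(3) B(1)] sigma(1) v(1)] f(1) g[OF k] by simp
    then show ?thesis using cls_eq_iff[OF D_ne g[OF k]] f(1) by simp
  qed
  have P_ex: "\<exists>x s. P k x s" if "1 \<le> k" "k \<le> N" for k
    using that
  proof (induction k rule: nat_induct_at_least)
    case base
    have "P 1 q \<sigma>" using first sigma(1) f by (simp add: P_def)
    then show ?case by blast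
  next
    case (Suc k)
    then have k: "1 \<le> k" "k \<le> N" "k < N" "1 \<le> Suc k" by auto
    let ?F = "f [^] k"
    have FG: "?F \<in> carrier G" using f(1) by simp
    obtain x s where P: "P k x s" using Suc by auto
    \<comment> \<open>The power of f and \<open>g k\<close> differ by the stabilizer element
      \<open>h\<close>, hence act equally on \<open>A\<close>. So the power, too, maps
      \<open>A\<close> onto segment k, which the invariant does not say.\<close>
    define h where "h = inv (g k) \<otimes> ?F"
    have h: "h \<in> H" using P_cls[OF k(1,2) P] cls_eq_iff[OF D_ne g[OF k(1,2)] FG] by (simp add: h_def)
    have "\<phi> ?F (\<iota> z) = \<phi> (g k) (\<iota> z)" if zA: "z \<in> A" for z
    proof -
      obtain t where "t \<in> closed_segment p q" "z = \<pi> t" using zA unfolding A by blast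
      then have t: "t \<in> D" "z = \<pi> t" using pq by (auto simp: arc_def)
      have "?F = g k \<otimes> h" using g[OF k(1,2)] FG by (simp add: h_def m_assoc[symmetric])
      then show ?thesis
        using act_mult[OF g[OF k(1,2)] _ c_points[OF t(1)], of h] stab_act[OF h t(1)] by (simp add: t(2) c_def)
    qed
    then have "\<phi> ?F ` \<iota> ` A = \<phi> (g k) ` \<iota> ` A" unfolding image_image by (rule image_cong[OF refl])
    then have imgF: "\<phi> ?F ` \<iota> ` A = \<iota> ` Sg k" using full[OF k(1,3)] by simp
    have yk: "finite (Sg k \<inter> Sg (Suc k))" "y k \<in> Sg k" "y k \<in> Sg (Suc k)" "y k \<noteq> y (k - 1)"
      using adj[OF k(1,3)] by auto
    have SgS: "Sg k \<subseteq> points S" using segment_subset seg k by blast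
    then obtain t where t: "t \<in> D" "\<pi> t = y k" using yk(2) unfolding pi_image[symmetric] by force
    obtain r where r: "r \<in> {1, -1}" "germ_in t r (Sg k)"
      using segment_germ[OF seg[OF k(1,2)] t(1)] yk(2) t(2) by metis
    obtain r' where r': "r' \<in> {1, -1}" "germ_in t r' (Sg (Suc k))"
      using segment_germ[OF seg[OF k(4)] t(1)] yk(3) t(2) Suc by metis
    have "r' \<noteq> r" using germ_in_infinite[OF r(2) _ r(1)] r'(2) yk(1) by metis
    then have r'r: "r' = - r" using r(1) r'(1) by auto
    have t_int: "t \<in> interior D" using germ_both_interior[OF r(2) _ r(1)] r'(2) r'r by simp
    obtain v s' e where v: "s' \<in> {1, -1}" "v \<in> closed_segment p q" "germ_map ?F v s' t r"
      "e > 0" "v + s' * e \<in> closed_segment p q"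
      using pull_germ[OF pq eq_refl[OF A] FG imgF r(2) SgS r(1)] by metis
    \<comment> \<open>The source of the exit point \<open>y k\<close> is the far end of
      \<open>A\<close>. It is not p, which already goes to the entry point. An inner source would
      continue segment k beyond \<open>y k\<close>, into the germ of the next segment.\<close>
    have "v = q"
    proof (rule ccontr)
      assume vq: "v \<noteq> q"
      show False
      proof (cases "v = p")
        case True
        then have "c t = c x" using germ_map_points(3)[OF v(3)] germ_map_points(3)[of ?F p \<sigma> x s] P by (simp add: P_def)
        then have "\<pi> t = \<pi> x" using c_eq_iff[of t x] t(1) germ_in_point[of x s "Sg k"] P by (auto simp: P_def)
        then show False using yk(4) t(2) P by (simp add: P_def)
      next
        case False
        have "germ_map ?F v (- s') t (- r)"
          by (rule germ_map_extend[OF v(3) FG interior_arc(1)[OF v(2) False vq] t_int v(1) r(1)])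
        moreover have "germ_in v (- s') A" using interior_arc(2)[OF v(2) False vq] v(1) by auto
        ultimately have "germ_in t (- r) (Sg k)" using germ_map_germ_in imgF SgS by blast
        then show False using germ_in_infinite[of t "- r" "Sg k" "Sg (Suc k)"] r'(2) r'r r(1) yk(1) by auto
      qed
    qed
    then have "germ_map ?F q (- \<sigma>) t r" using direction(2)[OF v(1,4)] v(3,5) by simp
    \<comment> \<open>Continuation past q and \<open>y k\<close> describes the power on the germ
      that leaves \<open>A\<close> at q. As f carries the germ at p to just this one, the composite
      re-establishes the invariant for the next index.\<close>
    then have "germ_map ?F q \<sigma> t (- r)"
      using germ_map_extend[OF _ FG int(2) t_int sigma(2) r(1)] by fastforce
    then have "germ_map (?F \<otimes> f) p \<sigma> t (- r)" by (rule germ_map_comp[OF f(2) _ f(1) FG])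
    then have "P (Suc k) t (- r)" using r'(2) r'r r(1) t(2) f(1) by (auto simp: P_def)
    then show ?case by blast
  qed
  then show ?thesis using P_ex[OF k] P_cls[OF k] by blast
qed

text \<open>The two germs are pulled back into \<open>A\<close> by g and h. Then
  \<open>inv h \<otimes> (k \<otimes> g)\<close> carries a germ of \<open>A\<close> to a germ of
  \<open>A\<close>, and freeness applies wherever these germs lie and whatever their directions
  are.\<close>

lemma crossing:
  assumes g: "g \<in> carrier G" "h \<in> carrier G" "k \<in> carrier G"
    and P: "B \<subseteq> A" "\<phi> g ` \<iota> ` B = \<iota> ` P" "germ_in w s P" "P \<subseteq> points S"
    and Q: "C \<subseteq> A" "\<phi> h ` \<iota> ` C = \<iota> ` Q" "germ_in z s' Q" "Q \<subseteq> points S"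
    and s: "s \<in> {1, -1}" "s' \<in> {1, -1}" and gm: "germ_map k w s z s'"
  shows "coset (k \<otimes> g) = coset h"
proof -
  interpret group G by (rule group_G)
  obtain v r where v: "r \<in> {1, -1}" "germ_map g v r w s" "germ_in v r B"
    using pull_germ[OF pq P(1)[unfolded A] g(1) P(2-4) s(1)] by metis
  obtain v' r' where v': "r' \<in> {1, -1}" "germ_map h v' r' z s'" "germ_in v' r' C"
    using pull_germ[OF pq Q(1)[unfolded A] g(2) Q(2-4) s(2)] by metis
  have "germ_map (k \<otimes> g) v r z s'" by (rule germ_map_comp[OF v(2) gm g(1,3)])
  then have "germ_map (inv h \<otimes> (k \<otimes> g)) v r v' r'"
    by (rule germ_map_comp[OF _ germ_map_inv[OF v'(2) g(2)]]) (use g in auto)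
  then have "inv h \<otimes> (k \<otimes> g) \<in> H"
    using germ_stab[OF _ _ germ_in_mono[OF v(3) P(1)] germ_in_mono[OF v'(3) Q(1)] v(1) v'(1)] g by simp
  then show ?thesis using cls_eq_iff[OF D_ne g(2), of "k \<otimes> g"] g by simp
qed

lemma swap: "free_arc G M S \<phi> \<iota> D \<pi> A q p"
  by unfold_locales (use free pq A arc_commute in \<open>auto simp: closed_segment_commute\<close>)

lemma self_map_stab:
  assumes g: "g \<in> carrier G" and img: "\<phi> g ` \<iota> ` A = \<iota> ` A"
  shows "g \<in> H"
proof -
  obtain v s where "s \<in> {1, -1}" "germ_map g v s q (- \<sigma>)" "germ_in v s A"
    using pull_germ[OF pq eq_refl[OF A] g img germ_q A_points sigma(2)] by metis
  then show ?thesis using germ_stab[OF g _ _ germ_q _ sigma(2)] by blast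
qed

lemma seg_bd_A: "seg_bd S A = {\<pi> p, \<pi> q}"
  unfolding A using seg_bd_arc pq unfolding arc_def by blast

end

context arc_setting
begin

text \<open>Each segment occupies at least one of the two directions at a common point, so two of
  the three share a germ.\<close>

lemma three_segments:
  assumes "segment S A" "segment S B" "segment S C" "finite (A \<inter> B)" "finite (A \<inter> C)" "finite (B \<inter> C)"
    "z \<in> A" "z \<in> B" "z \<in> C"
  shows False
proof -
  have "z \<in> \<pi> ` D" using segment_subset[OF assms(1)] assms(7) pi_image by auto
  then obtain t where t: "t \<in> D" "\<pi> t = z" by blast
  obtain a b d where s: "a \<in> {1, -1}" "germ_in t a A" "b \<in> {1, -1}" "germ_in t b B" "d \<in> {1, -1}" "germ_in t d C"
    using segment_germ[OF assms(1) t(1)] segment_germ[OF assms(2) t(1)] segment_germ[OF assms(3) t(1)] assms(7-9) t(2)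
    by metis
  then consider "a = b" | "a = d" | "b = d" by auto
  then show False
    using germ_in_infinite[of t a A B] germ_in_infinite[of t a A C] germ_in_infinite[of t b B C] s assms(4-6)
    by cases auto
qed

lemma seg_int_germ:
  assumes "t \<in> D" "\<pi> t \<in> seg_int S A" "s \<in> {1, -1}"
  shows "germ_in t s A"
proof -
  obtain e where e: "e > 0" "\<And>u. \<bar>u - t\<bar> < e \<Longrightarrow> u \<in> D \<and> \<pi> u \<in> A"
    using seg_int_nbhd[OF assms(1,2)] by blast
  show ?thesis unfolding germ_in_def
    using e assms(3) by (intro exI[of _ "e / 2"] conjI ballI e(2)) auto
qed

lemma seg_int_interior:
  assumes "t \<in> D" "\<pi> t \<in> seg_int S A"
  shows "t \<in> interior D"
proof -
  obtain e where e: "e > 0" "\<And>u. \<bar>u - t\<bar> < e \<Longrightarrow> u \<in> D \<and> \<pi> u \<in> A"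
    using seg_int_nbhd[OF assms(1,2)] by blast
  have "ball t e \<subseteq> D" using e(2) by (auto simp: dist_real_def abs_minus_commute)
  then show ?thesis using interiorI[OF open_ball, of t t e] e(1) by auto
qed

text \<open>The given boundary point is put at q, interchanging the two ends if necessary.
  Containment of \<open>A\<close> in the interior of S makes both end parameters interior, as
  continuation requires.\<close>

lemma maximal_arc:
  assumes max: "A \<in> maximal_segments G \<phi> M S \<iota>" and comp: "compactin (mtop S) A"
    and int: "A \<subseteq> seg_int S (points S)" and S: "points S \<notin> free_segments G \<phi> M S \<iota>"
    and z: "z \<in> seg_bd S A"
  obtains p q where "free_arc G M S \<phi> \<iota> D \<pi> A p q" "\<pi> q = z" "p \<in> interior D" "q \<in> interior D"
proof -
  have free: "A \<in> free_segments G \<phi> M S \<iota>" using max by (simp add: maximal_segments_def)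
  then have "segment S A" by (simp add: free_segments_def)
  moreover have "A \<noteq> points S" using free S by auto
  ultimately obtain p q where pq: "arc p q" "A = \<pi> ` closed_segment p q"
    using compact_segment comp unfolding arc_def by metis
  have fa: "free_arc G M S \<phi> \<iota> D \<pi> A p q"
    by unfold_locales (rule free pq)+
  have D: "p \<in> D" "q \<in> D" using pq(1) by (auto simp: arc_def)
  have "\<pi> p \<in> A" "\<pi> q \<in> A" unfolding pq(2) by auto
  then have i: "p \<in> interior D" "q \<in> interior D" using seg_int_interior D int by blast+
  have "z = \<pi> q \<or> z = \<pi> p" using free_arc.seg_bd_A[OF fa] z by auto
  then show ?thesis using that[OF fa _ i] that[OF free_arc.swap[OF fa] _ i(2,1)] by blast
qed

lemma first_translation:
  assumes max: "A \<in> maximal_segments G \<phi> M S \<iota>" and comp: "compactin (mtop S) A"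
    and int: "A \<subseteq> seg_int S (points S)" and S: "points S \<notin> free_segments G \<phi> M S \<iota>"
    and pos: "positive_submanifold G \<phi> M S \<iota>"
    and C: "segment S C" "finite (A \<inter> C)" "z \<in> seg_bd S A" "z \<in> C"
    and g: "g \<in> carrier G" "B \<subseteq> A" "\<phi> g ` \<iota> ` B = \<iota> ` C"
  obtains p q where "free_arc G M S \<phi> \<iota> D \<pi> A p q" "\<pi> q = z" "p \<in> interior D" "q \<in> interior D"
    "germ_map g p (sgn (q - p)) q (sgn (q - p))" "germ_in q (sgn (q - p)) C" "g \<in> nrm"
proof -
  obtain p q where ends: "free_arc G M S \<phi> \<iota> D \<pi> A p q" "\<pi> q = z" "p \<in> interior D" "q \<in> interior D"
    using maximal_arc[OF max comp int S C(3)] by metis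
  interpret free_arc G M S \<phi> \<iota> D \<pi> A p q by (rule ends(1))
  have germ: "germ_in q \<sigma> C" by (rule adjacent_germ[OF C(1) _ C(2)]) (use ends(2) C(4) in simp)
  have "positive_segment G \<phi> M S \<iota> A"
    using pos max comp unfolding positive_submanifold_def by blast
  then have gm: "germ_map g p \<sigma> q \<sigma>"
    by (rule positive_translation[OF _ ends(4) g germ segment_subset[OF C(1)]])
  show ?thesis using that[OF ends gm germ translation_nrm[OF g(1) gm ends(3,4)]] .
qed

end

subsection \<open>Decompositions\<close>

lemma circle_decompositionD:
  assumes "circle_decomposition G \<phi> M S \<iota> A n Sg g"
  shows "n \<ge> 1" "Sg 0 = A"
    and "k \<le> n \<Longrightarrow> Sg k \<in> maximal_segments G \<phi> M S \<iota>" "k \<le> n \<Longrightarrow> g k \<in> carrier G"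
    and "k \<le> n \<Longrightarrow> \<phi> (g k) ` \<iota> ` A = \<iota> ` Sg k"
    and "n = 1 \<Longrightarrow> card (Sg 0 \<inter> Sg 1) = 2" "n = 1 \<Longrightarrow> Sg 0 \<inter> Sg 1 = seg_bd S (Sg 0) \<inter> seg_bd S (Sg 1)"
    and "n \<ge> 2 \<Longrightarrow> p \<le> n \<Longrightarrow> q \<le> n \<Longrightarrow> \<bar>int p - int q\<bar> \<in> {1, int n} \<Longrightarrow>
           Sg p \<inter> Sg q = seg_bd S (Sg p) \<inter> seg_bd S (Sg q) \<and> is_singleton (Sg p \<inter> Sg q)"
    and "n \<ge> 2 \<Longrightarrow> p \<le> n \<Longrightarrow> q \<le> n \<Longrightarrow> 2 \<le> \<bar>int p - int q\<bar> \<Longrightarrow> \<bar>int p - int q\<bar> \<le> int n - 1 \<Longrightarrow>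
           Sg p \<inter> Sg q = {}"
proof -
  note d = assms[unfolded circle_decomposition_def]
  show "n \<ge> 1" using d by (rule conjunct1)
  show A: "Sg 0 = A" using d[THEN conjunct2] by (rule conjunct1)
  note d4 = d[THEN conjunct2, THEN conjunct2, THEN conjunct2, THEN conjunct1, rule_format]
  note d5 = d[THEN conjunct2, THEN conjunct2, THEN conjunct2, THEN conjunct2, THEN conjunct1]
  show "k \<le> n \<Longrightarrow> Sg k \<in> maximal_segments G \<phi> M S \<iota>" "k \<le> n \<Longrightarrow> g k \<in> carrier G"
    using d4 by simp_all
  show "k \<le> n \<Longrightarrow> \<phi> (g k) ` \<iota> ` A = \<iota> ` Sg k" unfolding A[symmetric] using d4 by simp
  show "card (Sg 0 \<inter> Sg 1) = 2" "Sg 0 \<inter> Sg 1 = seg_bd S (Sg 0) \<inter> seg_bd S (Sg 1)" if n: "n = 1"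
    by (insert mp[OF d5 n], elim conjE, assumption)+
  note d6 = d[THEN conjunct2, THEN conjunct2, THEN conjunct2, THEN conjunct2, THEN conjunct2, rule_format]
  show "Sg p \<inter> Sg q = seg_bd S (Sg p) \<inter> seg_bd S (Sg q) \<and> is_singleton (Sg p \<inter> Sg q)"
    if "n \<ge> 2" "p \<le> n" "q \<le> n" "\<bar>int p - int q\<bar> \<in> {1, int n}"
    using d6[OF that(1-3)] that(4) by (rule conjunct1[THEN mp])
  show "Sg p \<inter> Sg q = {}"
    if "n \<ge> 2" "p \<le> n" "q \<le> n" "2 \<le> \<bar>int p - int q\<bar>" "\<bar>int p - int q\<bar> \<le> int n - 1"
    using d6[OF that(1-3)] conjI[OF that(4,5)] by (rule conjunct2[THEN mp])
qed

lemma circle_decomposition_finite: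
  assumes "circle_decomposition G \<phi> M S \<iota> A n Sg g" "p \<le> n" "q \<le> n" "p \<noteq> q"
  shows "finite (Sg p \<inter> Sg q)"
proof (cases "n = 1")
  case True
  have "card (Sg 0 \<inter> Sg 1) = 2" by (rule circle_decompositionD(6)[OF assms(1) True])
  then have "finite (Sg 0 \<inter> Sg 1)" by (intro card_ge_0_finite) simp
  moreover have "p = 0 \<and> q = 1 \<or> p = 1 \<and> q = 0" using assms True by auto
  ultimately show ?thesis by (auto simp: Int_commute)
next
  case False
  have "n \<ge> 2" using circle_decompositionD(1)[OF assms(1)] False by simp
  note D = circle_decompositionD(8,9)[OF assms(1) this assms(2,3)]
  consider "\<bar>int p - int q\<bar> \<in> {1, int n}" | "2 \<le> \<bar>int p - int q\<bar>" "\<bar>int p - int q\<bar> \<le> int n - 1"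
    using assms(2-4) by force
  then show ?thesis
  proof cases
    case 1
    then have "is_singleton (Sg p \<inter> Sg q)" using D(1) by blast
    then show ?thesis by (metis is_singletonE finite.emptyI finite.insertI)
  next
    case 2
    then show ?thesis using D(2) by simp
  qed
qed

lemma circle_decomposition_adjacent:
  assumes "circle_decomposition G \<phi> M S \<iota> A n Sg g" "k \<le> n"
  shows "Sg k \<inter> Sg (Suc k mod Suc n) \<noteq> {}"
    and "Sg 0 \<inter> Sg 1 = seg_bd S (Sg 0) \<inter> seg_bd S (Sg 1)"
proof -
  have dec: "n \<ge> 1" by (rule circle_decompositionD(1)[OF assms(1)])
  have "Sg k \<inter> Sg (Suc k mod Suc n) \<noteq> {} \<and> Sg 0 \<inter> Sg 1 = seg_bd S (Sg 0) \<inter> seg_bd S (Sg 1)"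
  proof (cases "n = 1")
    case True
    have 1: "card (Sg 0 \<inter> Sg 1) = 2" "Sg 0 \<inter> Sg 1 = seg_bd S (Sg 0) \<inter> seg_bd S (Sg 1)"
      by (rule circle_decompositionD(6,7)[OF assms(1) True])+
    have "Sg 0 \<inter> Sg 1 \<noteq> {}" using 1(1) by (metis card.empty zero_neq_numeral)
    moreover have "k = 0 \<or> k = 1" using assms(2) True by auto
    ultimately have "Sg k \<inter> Sg (Suc k mod Suc n) \<noteq> {}" using True by (auto simp: Int_commute)
    then show ?thesis using 1(2) by simp
  next
    case False
    then have n2: "n \<ge> 2" using dec by simp
    have *: "\<bar>int p - int q\<bar> \<in> {1, int n} \<Longrightarrow> Sg p \<inter> Sg q = seg_bd S (Sg p) \<inter> seg_bd S (Sg q) \<and> is_singleton (Sg p \<inter> Sg q)"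
      if "p \<le> n" "q \<le> n" for p q
      using circle_decompositionD(8)[OF assms(1) n2 that] .
    have "Suc k mod Suc n \<le> n" by (metis Suc_le_mono mod_Suc_le_divisor)
    moreover have "\<bar>int k - int (Suc k mod Suc n)\<bar> \<in> {1, int n}"
      using assms(2) by (cases "k = n") auto
    ultimately have "is_singleton (Sg k \<inter> Sg (Suc k mod Suc n))" using *[OF assms(2)] by blast
    moreover have "Sg 0 \<inter> Sg 1 = seg_bd S (Sg 0) \<inter> seg_bd S (Sg 1)" using *[of 0 1] n2 by simp
    ultimately show ?thesis by (auto elim!: is_singletonE)
  qed
  then show "Sg k \<inter> Sg (Suc k mod Suc n) \<noteq> {}" "Sg 0 \<inter> Sg 1 = seg_bd S (Sg 0) \<inter> seg_bd S (Sg 1)" by auto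
qed

context arc_setting
begin

lemma circle_first:
  assumes max: "A \<in> maximal_segments G \<phi> M S \<iota>" and comp: "compactin (mtop S) A"
    and int: "A \<subseteq> seg_int S (points S)" and S: "points S \<notin> free_segments G \<phi> M S \<iota>"
    and pos: "positive_submanifold G \<phi> M S \<iota>"
    and dec: "circle_decomposition G \<phi> M S \<iota> A n Sg g" and z: "z \<in> Sg 0 \<inter> Sg 1"
  obtains p q where "free_arc G M S \<phi> \<iota> D \<pi> A p q" "\<pi> q = z" "p \<in> interior D" "q \<in> interior D"
    "germ_map (g 1) p (sgn (q - p)) q (sgn (q - p))" "germ_in q (sgn (q - p)) (Sg 1)" "g 1 \<in> nrm"
proof -
  note 1 = circle_decompositionD(1,2)[OF dec]
  note 2 = circle_decompositionD(3-5)[OF dec 1(1)]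
  have seg: "segment S (Sg 1)" using 2(1) by (simp add: maximal_segments_def free_segments_def)
  have fin: "finite (A \<inter> Sg 1)" using circle_decomposition_finite[OF dec, of 0 1] 1 by simp
  have zb: "z \<in> seg_bd S A" using circle_decomposition_adjacent(2)[OF dec, of 0] z 1 by auto
  have z1: "z \<in> Sg 1" using z by blast
  show ?thesis
    using first_translation[OF max comp int S pos seg fin zb z1 2(2) order.refl 2(3)] that by metis
qed

text \<open>The chain is followed for n + 1 steps, back to the initial segment, whose class is
  trivial. This yields the relation that the power with exponent n + 1 is trivial, needed when
  indices are shifted around the circle.\<close>

lemma circle_pow:
  assumes max: "A \<in> maximal_segments G \<phi> M S \<iota>" and comp: "compactin (mtop S) A"
    and int: "A \<subseteq> seg_int S (points S)" and S: "points S \<notin> free_segments G \<phi> M S \<iota>"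
    and pos: "positive_submanifold G \<phi> M S \<iota>"
    and dec: "circle_decomposition G \<phi> M S \<iota> A n Sg g"
  shows "g 1 \<in> nrm" and "k \<le> n \<Longrightarrow> coset (g k) = coset (g 1 [^] k)"
    and "coset \<one> = coset (g 1 [^] Suc n)"
proof -
  interpret group G by (rule group_G)
  note n1 = circle_decompositionD(1)[OF dec] and Sg0 = circle_decompositionD(2)[OF dec]
    and d = circle_decompositionD(3-5)[OF dec]
  have seg: "segment S (Sg k)" if "k \<le> n" for k
    using d(1)[OF that] by (simp add: maximal_segments_def free_segments_def)
  have fin: "finite (Sg a \<inter> Sg b)" if "a \<le> n" "b \<le> n" "a \<noteq> b" for a b
    using circle_decomposition_finite[OF dec that] .
  have adj: "\<exists>y. y \<in> Sg k \<inter> Sg (Suc k mod Suc n)" if "k \<le> n" for k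
    using circle_decomposition_adjacent(1)[OF dec that] by blast
  have "\<exists>y. (\<forall>k\<le>n. y k \<in> Sg k \<inter> Sg (Suc k mod Suc n)) \<and> (\<forall>k. 1 \<le> k \<and> k \<le> n \<longrightarrow> y k \<noteq> y (k - 1))"
  proof (cases "n = 1")
    case True
    then have "card (Sg 0 \<inter> Sg 1) = 2" by (rule circle_decompositionD(6)[OF dec])
    then obtain a b where ab: "Sg 0 \<inter> Sg 1 = {a, b}" "a \<noteq> b" unfolding card_2_iff by blast
    show ?thesis
    \<comment> \<open>Two segments have two common points; one of them is used to enter the second
      segment, the other to leave it.\<close>
    proof (intro exI[of _ "\<lambda>k. if k = 0 then a else b"] conjI allI impI)
      fix k assume "k \<le> n"
      then have "k = 0 \<or> k = 1" using True by auto
      then show "(if k = 0 then a else b) \<in> Sg k \<inter> Sg (Suc k mod Suc n)" using True ab(1) by auto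
    qed (use ab(2) True in auto)
  next
    case False
    obtain y where y: "\<And>k. k \<le> n \<Longrightarrow> y k \<in> Sg k \<inter> Sg (Suc k mod Suc n)" using adj by metis
    have "y k \<noteq> y (k - 1)" if k: "1 \<le> k" "k \<le> n" for k
    proof
      assume eq: "y k = y (k - 1)"
      let ?m = "Suc k mod Suc n"
      have m: "?m \<le> n" by (metis Suc_le_mono mod_Suc_le_divisor)
      \<comment> \<open>With at least three segments, the indices k - 1, k and the cyclic successor
        of k are distinct, so a repeated common point would lie on three different segments.\<close>
      have "?m \<noteq> k" "?m \<noteq> k - 1" using k False by (cases "k = n"; auto)+
      then have "finite (Sg (k - 1) \<inter> Sg k)" "finite (Sg (k - 1) \<inter> Sg ?m)" "finite (Sg k \<inter> Sg ?m)"
        using k m by (auto intro!: fin)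
      moreover have "y k \<in> Sg k" "y k \<in> Sg ?m" "y k \<in> Sg (k - 1)"
        using y[OF k(2)] y[of "k - 1"] k eq by auto
      ultimately show False using three_segments[of "Sg (k - 1)" "Sg k" "Sg ?m"] seg k m by auto
    qed
    then show ?thesis using y by blast
  qed
  then obtain y where y: "\<And>k. k \<le> n \<Longrightarrow> y k \<in> Sg k \<inter> Sg (Suc k mod Suc n)"
    "\<And>k. 1 \<le> k \<Longrightarrow> k \<le> n \<Longrightarrow> y k \<noteq> y (k - 1)" by blast
  have "y 0 \<in> Sg 0 \<inter> Sg 1" using y(1)[of 0] n1 by simp
  then obtain p q where ends: "free_arc G M S \<phi> \<iota> D \<pi> A p q" "\<pi> q = y 0" "p \<in> interior D" "q \<in> interior D"
    "germ_map (g 1) p (sgn (q - p)) q (sgn (q - p))" "germ_in q (sgn (q - p)) (Sg 1)" "g 1 \<in> nrm"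
    using circle_first[OF max comp int S pos dec] by metis
  interpret free_arc G M S \<phi> \<iota> D \<pi> A p q by (rule ends(1))
  show "g 1 \<in> nrm" by (rule ends(7))
  \<comment> \<open>The sequence is prolonged by one term: index n + 1 stands for the initial
    segment again, with the neutral element as its representative.\<close>
  define Sg' where "Sg' = (\<lambda>k. Sg (k mod Suc n))"
  define g' where "g' = (\<lambda>k. if k = Suc n then \<one> else g k)"
  have one_img: "\<phi> \<one> ` \<iota> ` A = \<iota> ` A"
  proof -
    have "\<phi> \<one> ` \<iota> ` A = (\<lambda>x. x) ` \<iota> ` A"
      by (rule image_cong[OF refl]) (use act_one iota_points A_points in auto)
    then show ?thesis by simp
  qed
  have chain: "coset (g' k) = coset (g 1 [^] k)" if "1 \<le> k" "k \<le> Suc n" for k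
  proof (rule translation_chain[where N = "Suc n" and Sg = Sg' and y = y, OF ends(3,4) d(2)[OF n1] ends(5)])
    fix k assume k: "1 \<le> k" "k \<le> Suc n"
    show "g' k \<in> carrier G" using d(2) k by (auto simp: g'_def)
    have "k mod Suc n \<le> n" by (metis Suc_le_mono mod_Suc_le_divisor)
    then show "segment S (Sg' k)" using seg by (simp add: Sg'_def)
    have "\<phi> (g' k) ` \<iota> ` A = \<iota> ` Sg' k"
      using d(3)[of k] one_img k Sg0 by (cases "k = Suc n") (auto simp: Sg'_def g'_def)
    then show "\<exists>B\<subseteq>A. \<phi> (g' k) ` \<iota> ` B = \<iota> ` Sg' k" by blast
  next
    fix k assume k: "1 \<le> k" "k < Suc n"
    then show "\<phi> (g' k) ` \<iota> ` A = \<iota> ` Sg' k" using d(3)[of k] by (auto simp: Sg'_def g'_def)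
    let ?m = "Suc k mod Suc n"
    have m: "?m \<le> n" by (metis Suc_le_mono mod_Suc_le_divisor)
    have "?m \<noteq> k" using k n1 by (cases "k = n") auto
    then show "finite (Sg' k \<inter> Sg' (Suc k)) \<and> y k \<in> Sg' k \<inter> Sg' (Suc k) \<and> y k \<noteq> y (k - 1)"
      using fin[of k ?m] y(1)[of k] y(2)[of k] k m by (auto simp: Sg'_def)
  next
    show "germ_in q \<sigma> (Sg' 1)" using ends(6) n1 by (simp add: Sg'_def)
    show "y 0 = \<pi> q" using ends(2) by simp
  qed (use that in auto)
  have "g 0 \<in> H" using self_map_stab[OF d(2)[of 0]] d(3)[of 0] Sg0 by simp
  then have "coset (g 0) = coset \<one>" using cls_eq_iff[OF D_ne, of "\<one>" "g 0"] d(2)[of 0] by simp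
  then show "coset (g k) = coset (g 1 [^] k)" if "k \<le> n"
    using chain[of k] that by (cases "k = 0") (auto simp: g'_def)
  show "coset \<one> = coset (g 1 [^] Suc n)" using chain[of "Suc n"] by (simp add: g'_def)
qed

lemma circle_oriented:
  assumes max: "A \<in> maximal_segments G \<phi> M S \<iota>" and comp: "compactin (mtop S) A"
    and int: "A \<subseteq> seg_int S (points S)" and S: "points S \<notin> free_segments G \<phi> M S \<iota>"
    and pos: "positive_submanifold G \<phi> M S \<iota>"
    and dec: "circle_decomposition G \<phi> M S \<iota> A n Sg g"
    and max': "A' \<in> maximal_segments G \<phi> M S \<iota>" and comp': "compactin (mtop S) A'"
    and int': "A' \<subseteq> seg_int S (points S)"
    and or: "oriented_circle_decomposition G \<phi> M S \<iota> n Sg g A' n' Sg' g'"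
  shows "coset (g' 1) = coset (g 1) \<and>
     (\<forall>k\<le>n'. coset (g' k) = coset (g 1 [^] k))"
proof -
  interpret group G by (rule group_G)
  note pow = circle_pow[OF max comp int S pos dec]
  note n1 = circle_decompositionD(1)[OF dec] and Sg0 = circle_decompositionD(2)[OF dec]
    and d = circle_decompositionD(3-5)[OF dec]
  have SgS: "Sg k \<subseteq> points S" if "k \<le> n" for k
    using d(1)[OF that] segment_subset by (auto simp: maximal_segments_def free_segments_def)
  let ?f = "g 1"
  have fG: "?f \<in> carrier G" using d(2) n1 by simp
  have D_ne: "D \<noteq> {}"
  proof -
    have "segment S (Sg 0)" using d(1)[of 0] by (simp add: maximal_segments_def free_segments_def)
    then obtain z where "z \<in> Sg 0" unfolding segment_def by blast
    then have "z \<in> \<pi> ` D" using SgS[of 0] pi_image by auto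
    then show ?thesis by blast
  qed
  interpret N: subgroup nrm G by (rule nrm_subgroup[OF D_ne])
  have fpow: "?f [^] (j::nat) \<in> nrm" for j by (induction j) (use pow(1) in auto)
  have cyc: "coset (?f [^] (j + Suc n)) = coset (?f [^] j)" for j
  proof -
    have "coset (?f [^] j \<otimes> ?f [^] Suc n) = coset (?f [^] j \<otimes> \<one>)"
      by (rule cls_mult[OF D_ne nat_pow_closed[OF fG] nat_pow_closed[OF fG] fpow one_closed refl pow(3)[symmetric]])
    then show ?thesis unfolding nat_pow_mult[OF fG] using fG by (simp del: nat_pow_Suc)
  qed
  have fdiff: "?f [^] (a + b) \<otimes> inv (?f [^] b) = ?f [^] a" for a b :: nat
    using fG by (simp add: nat_pow_mult[symmetric] m_assoc)
  have gp_inv: "coset (inv (?f [^] p)) = coset (inv (g p))" if "p \<le> n" for p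
    by (rule cls_inv[OF D_ne fpow d(2)[OF that] pow(2)[OF that, symmetric]])
  show ?thesis
  proof (cases "\<exists>p\<le>n. A' = Sg p")
    case True
    then obtain p where p: "n' = n" "p \<le> n"
      "\<And>k. k \<le> n \<Longrightarrow> g' k \<in> carrier G \<and> coset (g' k) = coset (g (zeta n p k) \<otimes> inv g p)"
      using or unfolding oriented_circle_decomposition_def if_P[OF True] by blast
    have all: "coset (g' k) = coset (?f [^] k)" if k: "k \<le> n" for k
    proof -
      have z: "zeta n p k \<le> n" using k p(2) by (auto simp: zeta_def)
      have "coset (?f [^] (k + p)) = coset (?f [^] zeta n p k)"
      proof (cases "k \<le> n - p")
        case True
        then show ?thesis by (simp add: zeta_def add.commute)
      next
        case False
        \<comment> \<open>After wrapping around, the true exponent exceeds the index by one full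
          turn, which \<open>cyc\<close> removes.\<close>
        then have "k + p = zeta n p k + Suc n" using p(2) by (auto simp: zeta_def)
        then show ?thesis using cyc[of "zeta n p k"] by (simp only:)
      qed
      then have "coset (?f [^] (k + p)) = coset (g (zeta n p k))" using pow(2)[OF z] by simp
      from cls_mult[OF D_ne _ d(2)[OF z] _ _ this gp_inv[OF p(2)]]
      have "coset (?f [^] (k + p) \<otimes> inv (?f [^] p)) = coset (g (zeta n p k) \<otimes> inv g p)"
        using fG fpow d(2)[OF p(2)] by simp
      then show ?thesis using p(3)[OF k] fdiff[of k p] by simp
    qed
    have "?f [^] (1::nat) = ?f" using fG by simp
    then show ?thesis using all[OF n1] all p(1) by simp
  next
    case False
    then obtain p zp where dec': "circle_decomposition G \<phi> M S \<iota> A' n' Sg' g'" and p: "p \<le> n"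
      "crosses S A' (Sg p) (Sg ((p + 1) mod (n + 1)))"
      "zp \<in> seg_bd S A'" "zp \<in> seg_int S (Sg ((p + 1) mod (n + 1)))" "zp \<in> seg_bd S (Sg' 1)"
      using or unfolding oriented_circle_decomposition_def if_not_P[OF False] by blast
    define m where "m = (p + 1) mod (n + 1)"
    have m: "m \<le> n" unfolding m_def by (metis Suc_eq_plus1 Suc_le_mono mod_Suc_le_divisor)
    have mp: "m \<noteq> p" using p(1) n1 unfolding m_def by (cases "p = n") auto
    obtain w where w: "w \<in> seg_int S (Sg p)" "w \<in> seg_bd S A'"
      using p(2) unfolding crosses_def by (auto elim!: is_singletonE)
    have "zp \<in> Sg' 0 \<inter> Sg' 1"
      using p(3,5) circle_decompositionD(2)[OF dec'] unfolding seg_bd_def by auto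
    then obtain a b where ab: "free_arc G M S \<phi> \<iota> D \<pi> A' a b" "\<pi> b = zp" "a \<in> interior D" "b \<in> interior D"
      "germ_map (g' 1) a (sgn (b - a)) b (sgn (b - a))"
      using circle_first[OF max' comp' int' S pos dec'] by metis
    interpret F': free_arc G M S \<phi> \<iota> D \<pi> A' a b by (rule ab(1))
    note sg = F'.sigma(1)
    have abD: "a \<in> D" "b \<in> D" using F'.pqD .
    have gb: "germ_in b (sgn (b - a)) (Sg m)"
      using seg_int_germ[OF abD(2) _ sg] p(4) ab(2) by (simp add: m_def)
    \<comment> \<open>The two boundary points of \<open>A'\<close> lie in the interiors of different
      members of the decomposition; were they equal, these members would share a germ. Hence w is
      the other end a, and \<open>g' 1\<close> leads from one member into its successor.\<close>
    have "w \<noteq> zp"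
    proof
      assume "w = zp"
      then have "germ_in b (sgn (b - a)) (Sg p)" using seg_int_germ[OF abD(2) _ sg] w(1) ab(2) by simp
      then show False using germ_in_infinite[OF _ gb sg] circle_decomposition_finite[OF dec p(1) m] mp by blast
    qed
    then have wa: "w = \<pi> a" using w(2) F'.seg_bd_A ab(2) by auto
    then have ga: "germ_in a (sgn (b - a)) (Sg p)" using seg_int_germ[OF abD(1) _ sg] w(1) by simp
    have g'G: "g' 1 \<in> carrier G" using circle_decompositionD(1,4)[OF dec'] by blast
    obtain z where z: "z \<in> seg_bd S A"
      using circle_decomposition_adjacent[OF dec, of 0] Sg0 n1 by auto
    obtain p0 q0 where "free_arc G M S \<phi> \<iota> D \<pi> A p0 q0"
      using maximal_arc[OF max comp int S z] by metis
    then interpret F: free_arc G M S \<phi> \<iota> D \<pi> A p0 q0 .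
    have "coset (g' 1 \<otimes> g p) = coset (g m)"
      by (rule F.crossing[OF d(2)[OF p(1)] d(2)[OF m] g'G order.refl d(3)[OF p(1)] ga SgS[OF p(1)]
          order.refl d(3)[OF m] gb SgS[OF m] sg sg ab(5)])
    moreover have "coset (g m) = coset (?f [^] Suc p)"
    proof (cases "p = n")
      case True
      then have "m = 0" by (simp add: m_def)
      then show ?thesis using pow(2)[of 0] pow(3) True by simp
    next
      case False
      then have "m = Suc p" using p(1) by (simp add: m_def)
      then show ?thesis using pow(2)[OF m] by simp
    qed
    \<comment> \<open>It remains to cancel \<open>g p\<close> on the right, that is, to multiply by
      inverses of two representatives of one class; \<open>gp_inv\<close> makes this legitimate
      because the powers of \<open>?f\<close> normalize the stabilizer.\<close>
    ultimately have "coset (?f [^] Suc p) = coset (g' 1 \<otimes> g p)" by simp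
    from cls_mult[OF D_ne _ _ _ _ this gp_inv[OF p(1)]]
    have "coset (?f [^] Suc p \<otimes> inv (?f [^] p)) = coset (g' 1 \<otimes> g p \<otimes> inv g p)"
      using fG fpow d(2)[OF p(1)] g'G by (simp del: nat_pow_Suc)
    then have eq: "coset (g 1) = coset (g' 1)"
      using fdiff[of 1 p] fG g'G d(2)[OF p(1)] by (simp add: m_assoc)
    then show ?thesis
      using circle_pow(2)[OF max' comp' int' S pos dec'] cls_nat_pow[OF D_ne pow(1) g'G eq] by simp
  qed
qed

end

section \<open>Decompositions of interval type\<close>

lemma interval_decompositionD:
  assumes "interval_decomposition G \<phi> M S \<iota> A nm np Sg g"
  shows "nm < Fin 0" "Fin 0 < np" "Sg 0 = A"
    and "k \<in> index_set nm np \<Longrightarrow> g k \<in> carrier G" "k \<in> index_set nm np \<Longrightarrow> segment S (Sg k)"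
    and "p \<in> index_set nm np \<Longrightarrow> q \<in> index_set nm np \<Longrightarrow> \<bar>p - q\<bar> = 1 \<Longrightarrow>
           Sg p \<inter> Sg q = seg_bd S (Sg p) \<inter> seg_bd S (Sg q) \<and> is_singleton (Sg p \<inter> Sg q)"
    and "p \<in> index_set nm np \<Longrightarrow> q \<in> index_set nm np \<Longrightarrow> 2 \<le> \<bar>p - q\<bar> \<Longrightarrow> Sg p \<inter> Sg q = {}"
    and "nm < Fin k \<Longrightarrow> Fin k < np \<Longrightarrow> \<phi> (g k) ` \<iota> ` A = \<iota> ` Sg k"
    and "Fin k = np \<Longrightarrow> boundary_segment S (points S) (Sg k)"
    and "k \<in> index_set nm np \<Longrightarrow> \<exists>B\<subseteq>A. \<phi> (g k) ` \<iota> ` B = \<iota> ` Sg k"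
proof -
  note d = assms[unfolded interval_decomposition_def]
  show "nm < Fin 0" using d by (rule conjunct1)
  show "Fin 0 < np" using d[THEN conjunct2] by (rule conjunct1)
  show A: "Sg 0 = A" using d[THEN conjunct2, THEN conjunct2] by (rule conjunct1)
  note d4 = d[THEN conjunct2, THEN conjunct2, THEN conjunct2, THEN conjunct1, rule_format]
  note d5 = d[THEN conjunct2, THEN conjunct2, THEN conjunct2, THEN conjunct2, THEN conjunct1, rule_format]
  note d6 = d[THEN conjunct2, THEN conjunct2, THEN conjunct2, THEN conjunct2, THEN conjunct2, THEN conjunct1, rule_format]
  note d7 = d[THEN conjunct2, THEN conjunct2, THEN conjunct2, THEN conjunct2, THEN conjunct2, THEN conjunct2, rule_format]
  show "k \<in> index_set nm np \<Longrightarrow> g k \<in> carrier G" "k \<in> index_set nm np \<Longrightarrow> segment S (Sg k)"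
    using d4 by simp_all
  show "Sg p \<inter> Sg q = seg_bd S (Sg p) \<inter> seg_bd S (Sg q) \<and> is_singleton (Sg p \<inter> Sg q)"
    if "p \<in> index_set nm np" "q \<in> index_set nm np" "\<bar>p - q\<bar> = 1"
    using d5[OF that(1,2)] that(3) by (rule conjunct1[THEN mp])
  show "Sg p \<inter> Sg q = {}"
    if "p \<in> index_set nm np" "q \<in> index_set nm np" "2 \<le> \<bar>p - q\<bar>"
    using d5[OF that(1,2)] that(3) by (rule conjunct2[THEN mp])
  show full: "\<phi> (g k) ` \<iota> ` A = \<iota> ` Sg k" if "nm < Fin k" "Fin k < np"
    unfolding A[symmetric] by (rule d6[OF conjI[OF that]])
  show "boundary_segment S (points S) (Sg k)" if "Fin k = np"
    using d7[OF disjI2[OF that]] by (rule conjunct1)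
  show "\<exists>B\<subseteq>A. \<phi> (g k) ` \<iota> ` B = \<iota> ` Sg k" if k: "k \<in> index_set nm np"
  proof (cases "Fin k = nm \<or> Fin k = np")
    case True
    obtain B where "boundary_segment S (Sg 0) B" "\<phi> (g k) ` \<iota> ` B = \<iota> ` Sg k"
      using d7[OF True, THEN conjunct2] by blast
    then show ?thesis unfolding A boundary_segment_def by blast
  next
    case False
    then have "nm < Fin k" "Fin k < np" using k by (auto simp: index_set_def)
    then show ?thesis using full by blast
  qed
qed

lemma interval_decomposition_finite:
  assumes "interval_decomposition G \<phi> M S \<iota> A nm np Sg g" "p \<in> index_set nm np" "q \<in> index_set nm np" "p \<noteq> q"
  shows "finite (Sg p \<inter> Sg q)"
proof (cases "\<bar>p - q\<bar> = 1")
  case True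
  then have "is_singleton (Sg p \<inter> Sg q)" using interval_decompositionD(6)[OF assms(1-3)] by blast
  then show ?thesis by (metis is_singletonE finite.emptyI finite.insertI)
next
  case False
  then have "2 \<le> \<bar>p - q\<bar>" using assms(4) by simp
  then show ?thesis using interval_decompositionD(7)[OF assms(1-3)] by simp
qed

context free_arc
begin

text \<open>The sign \<open>d\<close> lets one argument serve both sides: with \<open>d = -1\<close>
  the segments of negative index are enumerated outwards, and the lemma is applied to the reversed
  arc with the inverse translation.\<close>

lemma signed_chain:
  fixes d :: int
  assumes dec: "interval_decomposition G \<phi> M S \<iota> A nm np Sg g" and d: "\<bar>d\<bar> = 1"
    and int: "p \<in> interior D" "q \<in> interior D"
    and f: "f \<in> carrier G" "germ_map f p \<sigma> q \<sigma>"
    and first: "\<pi> q \<in> Sg d"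
    and k: "1 \<le> k" "d * int k \<in> index_set nm np"
  shows "coset (g (d * int k)) = coset (f [^] k)"
proof -
  note D = interval_decompositionD[OF dec]
  have d1: "d = 1 \<or> d = -1" using d by auto
  have idx: "d * int j \<in> index_set nm np" if "j \<le> k" for j
    using k(2) that D(1,2) d1 by (cases nm; cases np) (auto simp: index_set_def)
  have mid: "nm < Fin (d * int j)" "Fin (d * int j) < np" if "1 \<le> j" "j < k" for j
    using k(2) that D(1,2) d1 by (cases nm; cases np; auto simp: index_set_def)+
  have diff: "\<bar>d * int a - d * int b\<bar> = \<bar>int a - int b\<bar>" for a b
    using d by (simp add: abs_mult flip: right_diff_distrib)
  have fin: "finite (Sg (d * int j) \<inter> Sg (d * int (Suc j)))" if "j < k" for j
    using interval_decomposition_finite[OF dec idx idx, of j "Suc j"] that d by auto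
  have "\<exists>y. y \<in> Sg (d * int j) \<inter> Sg (d * int (Suc j))" if "j < k" for j
  proof -
    have "is_singleton (Sg (d * int j) \<inter> Sg (d * int (Suc j)))"
      by (rule D(6)[OF idx idx, THEN conjunct2]) (use that diff[of j "Suc j"] in auto)
    then show ?thesis by (auto elim!: is_singletonE)
  qed
  then obtain y0 where y0: "\<And>j. j < k \<Longrightarrow> y0 j \<in> Sg (d * int j) \<inter> Sg (d * int (Suc j))" by metis
  \<comment> \<open>The first common point is a singleton intersection containing
    \<open>\<pi> q\<close>; setting it explicitly gives the start required by the chain.\<close>
  define y where "y = y0(0 := \<pi> q)"
  have qA: "\<pi> q \<in> A" unfolding A by simp
  have y: "y j \<in> Sg (d * int j) \<inter> Sg (d * int (Suc j))" if "j < k" for j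
    using y0[OF that] qA first D(3) by (auto simp: y_def)
  have idx1: "d \<in> index_set nm np" using idx[of 1] k(1) by simp
  have seg1: "segment S (Sg d)" by (rule D(5)[OF idx1])
  have fin1: "finite (A \<inter> Sg d)" using fin[of 0] k(1) D(3) by simp
  have "coset ((\<lambda>j. g (d * int j)) k) = coset (f [^] k)"
  proof (rule translation_chain[where N = k and Sg = "\<lambda>j. Sg (d * int j)" and y = y, OF int f])
    show "germ_in q \<sigma> (Sg (d * int 1))" using adjacent_germ[OF seg1 first fin1] by simp
    show "y 0 = \<pi> q" by (simp add: y_def)
    fix j assume j: "1 \<le> j" "j < k"
    show "\<phi> (g (d * int j)) ` \<iota> ` A = \<iota> ` Sg (d * int j)" by (rule D(8)[OF mid[OF j]])
    have "Sg (d * int (j - 1)) \<inter> Sg (d * int (Suc j)) = {}"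
      using D(7)[OF idx idx, of "j - 1" "Suc j"] j diff[of "j - 1" "Suc j"] by auto
    moreover have "y (j - 1) \<in> Sg (d * int (j - 1))" using y[of "j - 1"] j by simp
    moreover have "y j \<in> Sg (d * int (Suc j))" using y[of j] j by simp
    ultimately have "y j \<noteq> y (j - 1)" by (metis IntI emptyE)
    then show "finite (Sg (d * int j) \<inter> Sg (d * int (Suc j))) \<and> y j \<in> Sg (d * int j) \<inter> Sg (d * int (Suc j)) \<and> y j \<noteq> y (j - 1)"
      using fin[OF j(2)] y[OF j(2)] by (intro conjI)
  qed (use k D(4)[OF idx] D(5)[OF idx] D(10)[OF idx] in auto)
  then show ?thesis .
qed

end

context arc_setting
begin

lemma interval_first:
  assumes max: "A \<in> maximal_segments G \<phi> M S \<iota>" and comp: "compactin (mtop S) A"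
    and int: "A \<subseteq> seg_int S (points S)" and S: "points S \<notin> free_segments G \<phi> M S \<iota>"
    and pos: "positive_submanifold G \<phi> M S \<iota>"
    and dec: "interval_decomposition G \<phi> M S \<iota> A nm np Sg g" and z: "z \<in> Sg 0 \<inter> Sg 1"
  obtains p q where "free_arc G M S \<phi> \<iota> D \<pi> A p q" "\<pi> q = z" "p \<in> interior D" "q \<in> interior D"
    "germ_map (g 1) p (sgn (q - p)) q (sgn (q - p))" "g 1 \<in> nrm"
proof -
  note D = interval_decompositionD[OF dec]
  have i: "0 \<in> index_set nm np" "1 \<in> index_set nm np"
    using D(1,2) by (cases nm; cases np; auto simp: index_set_def)+
  obtain B where B: "B \<subseteq> A" "\<phi> (g 1) ` \<iota> ` B = \<iota> ` Sg 1" using D(10)[OF i(2)] by blast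
  have "Sg 0 \<inter> Sg 1 = seg_bd S (Sg 0) \<inter> seg_bd S (Sg 1)" using D(6)[OF i] by simp
  then have zb: "z \<in> seg_bd S A" using z D(3) by auto
  have z1: "z \<in> Sg 1" using z by blast
  have fin: "finite (A \<inter> Sg 1)" using interval_decomposition_finite[OF dec i] D(3) by simp
  show ?thesis
    using first_translation[OF max comp int S pos D(5)[OF i(2)] fin zb z1 D(4)[OF i(2)] B] that by metis
qed

lemma interval_pow:
  assumes max: "A \<in> maximal_segments G \<phi> M S \<iota>" and comp: "compactin (mtop S) A"
    and int: "A \<subseteq> seg_int S (points S)" and S: "points S \<notin> free_segments G \<phi> M S \<iota>"
    and pos: "positive_submanifold G \<phi> M S \<iota>"
    and dec: "interval_decomposition G \<phi> M S \<iota> A nm np Sg g"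
  shows "g 1 \<in> nrm" and "k \<in> index_set nm np \<Longrightarrow> coset (g k) = coset (g 1 [^] k)"
proof -
  interpret group G by (rule group_G)
  note D = interval_decompositionD[OF dec]
  have i: "0 \<in> index_set nm np" "1 \<in> index_set nm np" "-1 \<in> index_set nm np"
    using D(1,2) by (cases nm; cases np; auto simp: index_set_def)+
  obtain z where z: "z \<in> Sg 0 \<inter> Sg 1" using D(6)[OF i(1,2)] by (auto elim!: is_singletonE)
  obtain p q where ends: "free_arc G M S \<phi> \<iota> D \<pi> A p q" "\<pi> q = z" "p \<in> interior D" "q \<in> interior D"
    "germ_map (g 1) p (sgn (q - p)) q (sgn (q - p))" "g 1 \<in> nrm"
    using interval_first[OF max comp int S pos dec z] by metis
  show "g 1 \<in> nrm" by (rule ends(6))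
  interpret free_arc G M S \<phi> \<iota> D \<pi> A p q by (rule ends(1))
  interpret R: free_arc G M S \<phi> \<iota> D \<pi> A q p by (rule swap)
  have fG: "g 1 \<in> carrier G" by (rule D(4)[OF i(2)])
  have up: "coset (g (1 * int j)) = coset (g 1 [^] j)" if "1 \<le> j" "1 * int j \<in> index_set nm np" for j
    by (rule signed_chain[OF dec _ ends(3,4) fG ends(5) _ that]) (use ends(2) z in auto)
  \<comment> \<open>The translation also matches the germs on the other side of p and q. Its inverse
    is therefore a translation for the reversed arc, whose direction is
    \<open>- \<sigma>\<close>.\<close>
  have "germ_map (g 1) p (- \<sigma>) q (- \<sigma>)"
    by (rule germ_map_extend[OF ends(5) fG ends(3,4) sigma(1) sigma(1)])
  then have bwd: "germ_map (inv (g 1)) q (sgn (p - q)) p (sgn (p - q))"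
    using germ_map_inv[OF _ fG] sgn_minus[of "q - p"] by simp
  \<comment> \<open>The segments with indices 1 and -1 are disjoint, so the one with index -1 meets
    \<open>A\<close> at the end that is not \<open>\<pi> q\<close>.\<close>
  have p_first: "\<pi> p \<in> Sg (-1)"
  proof -
    have "is_singleton (Sg 0 \<inter> Sg (-1))" "Sg 0 \<inter> Sg (-1) = seg_bd S (Sg 0) \<inter> seg_bd S (Sg (-1))"
      using D(6)[OF i(1,3)] by auto
    then obtain z' where z': "z' \<in> seg_bd S A" "z' \<in> Sg (-1)" using D(3) by (auto elim!: is_singletonE)
    moreover have "z' \<noteq> \<pi> q" using z' ends(2) z D(7)[OF i(2,3)] by auto
    ultimately show ?thesis using seg_bd_A by auto
  qed
  have down: "coset (g ((-1) * int j)) = coset (inv (g 1) [^] j)"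
    if "1 \<le> j" "(-1) * int j \<in> index_set nm np" for j
    by (rule R.signed_chain[OF dec _ ends(4,3) _ bwd p_first that]) (use fG in auto)
  have "g 0 \<in> H" using self_map_stab[OF D(4)[OF i(1)]] D(8)[of 0] D(1-3) by simp
  then have zero: "coset (g 0) = coset \<one>"
    using cls_eq_iff[OF D_ne, of "\<one>" "g 0"] D(4)[OF i(1)] by simp
  show "coset (g k) = coset (g 1 [^] k)" if k: "k \<in> index_set nm np"
  proof (cases k "0 :: int" rule: linorder_cases)
    case equal
    then show ?thesis using zero by simp
  next
    case greater
    then show ?thesis using up[of "nat k"] k int_pow_int[of G "g 1" "nat k"] by simp
  next
    case less
    then have "k = - int (nat (- k))" by simp
    then have "g 1 [^] k = inv (g 1 [^] nat (- k))"
      using int_pow_neg_int[OF fG, of "nat (- k)"] by simp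
    then show ?thesis using down[of "nat (- k)"] k less nat_pow_inv[OF fG, of "nat (- k)"] by simp
  qed
qed

lemma interval_oriented:
  assumes max: "A \<in> maximal_segments G \<phi> M S \<iota>" and comp: "compactin (mtop S) A"
    and int: "A \<subseteq> seg_int S (points S)" and S: "points S \<notin> free_segments G \<phi> M S \<iota>"
    and pos: "positive_submanifold G \<phi> M S \<iota>"
    and dec: "interval_decomposition G \<phi> M S \<iota> A nm np Sg g"
    and max': "A' \<in> maximal_segments G \<phi> M S \<iota>" and comp': "compactin (mtop S) A'"
    and int': "A' \<subseteq> seg_int S (points S)"
    and bd: "\<not> boundary_segment S (points S) A'"
    and or: "oriented_interval_decomposition G \<phi> M S \<iota> nm np Sg g A' nm' np' Sg' g'"
  shows "coset (g' 1) = coset (g 1) \<and>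
     (\<forall>k\<in>index_set nm' np'. coset (g' k) = coset (g 1 [^] k))"
proof -
  interpret group G by (rule group_G)
  note D = interval_decompositionD[OF dec]
  note pow = interval_pow[OF max comp int S pos dec]
  have i: "0 \<in> index_set nm np" "1 \<in> index_set nm np"
    using D(1,2) by (cases nm; cases np; auto simp: index_set_def)+
  let ?f = "g 1"
  have fG: "?f \<in> carrier G" by (rule D(4)[OF i(2)])
  have SgS: "Sg k \<subseteq> points S" if "k \<in> index_set nm np" for k using segment_subset[OF D(5)[OF that]] .
  obtain z where z: "z \<in> Sg 0 \<inter> Sg 1" using D(6)[OF i] by (auto elim!: is_singletonE)
  obtain p0 q0 where "free_arc G M S \<phi> \<iota> D \<pi> A p0 q0"
    using interval_first[OF max comp int S pos dec z] by metis
  then interpret F: free_arc G M S \<phi> \<iota> D \<pi> A p0 q0 .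
  note D_ne = F.D_ne
  interpret N: subgroup nrm G by (rule nrm_subgroup[OF D_ne])
  have fpow: "?f [^] (j::int) \<in> nrm" for j
  proof -
    have "?f [^] (n::nat) \<in> nrm" for n by (induction n) (use pow(1) in auto)
    then show ?thesis using fG by (cases j rule: int_cases2) (simp_all add: int_pow_int int_pow_neg)
  qed
  have fdiff: "?f [^] (a + b) \<otimes> inv (?f [^] b) = ?f [^] a" for a b :: int
    using fG by (simp add: int_pow_mult m_assoc)
  have gp_inv: "coset (inv (?f [^] p)) = coset (inv (g p))" if "p \<in> index_set nm np" for p
    by (rule cls_inv[OF D_ne fpow D(4)[OF that] pow(2)[OF that, symmetric]])
  have one: "?f [^] (1::int) = ?f" using fG by (simp add: int_pow_1)
  show ?thesis
  proof (cases "\<exists>p\<in>index_set nm np. A' = Sg p")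
    case True
    then obtain p where p: "p \<in> index_set nm np" "A' = Sg p" "nm' = nm - Fin p" "np' = np - Fin p"
      "\<And>k. k \<in> index_set nm' np' \<Longrightarrow> g' k \<in> carrier G \<and>
         coset (g' k) = coset (g (k + p) \<otimes> inv g p)"
      using or unfolding oriented_interval_decomposition_def if_P[OF True] by blast
    have idx: "k + p \<in> index_set nm np" if "k \<in> index_set nm' np'" for k
      using that p(3,4) by (cases nm; cases np) (auto simp: index_set_def)
    have all: "coset (g' k) = coset (?f [^] k)" if k: "k \<in> index_set nm' np'" for k
    proof -
      have kp: "k + p \<in> index_set nm np" by (rule idx[OF k])
      have "coset (?f [^] (k + p) \<otimes> inv (?f [^] p)) = coset (g (k + p) \<otimes> inv g p)"
        by (rule cls_mult[OF D_ne int_pow_closed[OF fG] D(4)[OF kp] N.m_inv_closed[OF fpow]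
              inv_closed[OF D(4)[OF p(1)]] pow(2)[OF kp, symmetric] gp_inv[OF p(1)]])
      then show ?thesis using p(5)[OF k] fdiff[of k p] by simp
    qed
    \<comment> \<open>If \<open>A'\<close> were the last segment, its shifted decomposition would
      have no index 1. That segment is a boundary segment of S, and \<open>A'\<close> is
      not.\<close>
    have "Fin p \<noteq> np" using D(9)[of p] bd p(2) by auto
    then have "1 \<in> index_set nm' np'"
      using p(1,3,4) by (cases nm; cases np) (auto simp: index_set_def)
    then show ?thesis using all all[of 1] one by simp
  next
    case False
    then obtain p zp where dec': "interval_decomposition G \<phi> M S \<iota> A' nm' np' Sg' g'"
      and p: "nm \<le> Fin p" "Fin p < np" "crosses S A' (Sg p) (Sg (p + 1))"
      "zp \<in> seg_bd S A'" "zp \<in> seg_int S (Sg (p + 1))" "zp \<in> seg_bd S (Sg' 1)"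
      using or unfolding oriented_interval_decomposition_def if_not_P[OF False] by blast
    have pI: "p \<in> index_set nm np" "p + 1 \<in> index_set nm np"
      using p(1,2) by (cases nm; cases np; auto simp: index_set_def)+
    note D' = interval_decompositionD[OF dec']
    obtain w where w: "w \<in> seg_int S (Sg p)" "w \<in> seg_bd S A'"
      using p(3) unfolding crosses_def by (auto elim!: is_singletonE)
    have "zp \<in> Sg' 0 \<inter> Sg' 1"
      using p(4,6) D'(3) unfolding seg_bd_def by auto
    then obtain a b where ab: "free_arc G M S \<phi> \<iota> D \<pi> A' a b" "\<pi> b = zp" "a \<in> interior D" "b \<in> interior D"
      "germ_map (g' 1) a (sgn (b - a)) b (sgn (b - a))"
      using interval_first[OF max' comp' int' S pos dec'] by metis
    interpret F': free_arc G M S \<phi> \<iota> D \<pi> A' a b by (rule ab(1))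
    note sg = F'.sigma(1)
    have abD: "a \<in> D" "b \<in> D" using F'.pqD .
    have gb: "germ_in b (sgn (b - a)) (Sg (p + 1))"
      using seg_int_germ[OF abD(2) _ sg] p(5) ab(2) by simp
    \<comment> \<open>As on the circle: equal boundary points would give the two neighbouring
      segments a common germ. So the translation of \<open>A'\<close> goes from segment p to segment
      p + 1.\<close>
    have "w \<noteq> zp"
    proof
      assume "w = zp"
      then have "germ_in b (sgn (b - a)) (Sg p)" using seg_int_germ[OF abD(2) _ sg] w(1) ab(2) by simp
      then show False using germ_in_infinite[OF _ gb sg] interval_decomposition_finite[OF dec pI] by simp
    qed
    then have wa: "w = \<pi> a" using w(2) F'.seg_bd_A ab(2) by auto
    then have ga: "germ_in a (sgn (b - a)) (Sg p)" using seg_int_germ[OF abD(1) _ sg] w(1) by simp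
    have "1 \<in> index_set nm' np'"
      using D'(1,2) by (cases nm'; cases np'; auto simp: index_set_def)
    then have g'G: "g' 1 \<in> carrier G" by (rule D'(4))
    obtain B where B: "B \<subseteq> A" "\<phi> (g p) ` \<iota> ` B = \<iota> ` Sg p" using D(10)[OF pI(1)] by blast
    obtain C where C: "C \<subseteq> A" "\<phi> (g (p + 1)) ` \<iota> ` C = \<iota> ` Sg (p + 1)" using D(10)[OF pI(2)] by blast
    have "coset (g' 1 \<otimes> g p) = coset (g (p + 1))"
      by (rule F.crossing[OF D(4)[OF pI(1)] D(4)[OF pI(2)] g'G B ga SgS[OF pI(1)]
          C gb SgS[OF pI(2)] sg sg ab(5)])
    then have "coset (?f [^] (1 + p)) = coset (g' 1 \<otimes> g p)"
      using pow(2)[OF pI(2)] by (simp add: add.commute)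
    from cls_mult[OF D_ne int_pow_closed[OF fG] m_closed[OF g'G D(4)[OF pI(1)]] N.m_inv_closed[OF fpow]
        inv_closed[OF D(4)[OF pI(1)]] this gp_inv[OF pI(1)]]
    have eq: "coset (g 1) = coset (g' 1)"
      unfolding fdiff one using g'G D(4)[OF pI(1)] by (simp add: m_assoc)
    then show ?thesis
      using interval_pow(2)[OF max' comp' int' S pos dec'] cls_int_pow[OF D_ne pow(1) g'G eq] by simp
  qed
qed

end

subsection \<open>Parametrizations\<close>

lemma sgn_extend_segment:
  fixes p q e :: real
  assumes "p \<noteq> q" "e > 0"
  shows "closed_segment p (q + sgn (q - p) * e) = (if p < q then {p..q + e} else {q - e..p})"
  using assms by (auto simp: closed_segment_eq_real_ivl sgn_if)

lemma image_Icc_two_points: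
  fixes p q :: real
  assumes "x \<in> f ` {p..q}" "y \<in> f ` {p..q}" "x \<noteq> y"
  shows "p < q"
proof -
  obtain u v where "u \<in> {p..q}" "v \<in> {p..q}" "u \<noteq> v" using assms by blast
  then show ?thesis by (auto simp: neq_iff)
qed

section \<open>Submanifolds parametrized by an interval\<close>

lemma interval_param_preimage:
  assumes par: "interval_param S D \<pi>" and C: "C \<subseteq> points S"
  shows "\<pi> ` {t \<in> D. \<pi> t \<in> C} = C" "connectedin (mtop S) C \<longleftrightarrow> connected {t \<in> D. \<pi> t \<in> C}"
    "compactin (mtop S) C \<longleftrightarrow> compact {t \<in> D. \<pi> t \<in> C}"
proof -
  have hom: "homeomorphic_map (top_of_set D) (mtop S) \<pi>" using par by (simp add: interval_param_def)
  have img: "\<pi> ` D = points S" using homeomorphic_imp_surjective_map[OF hom] by simp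
  have "C \<subseteq> \<pi> ` D" using img C by simp
  then show eq: "\<pi> ` {t \<in> D. \<pi> t \<in> C} = C" by auto
  have sub: "{t \<in> D. \<pi> t \<in> C} \<subseteq> topspace (top_of_set D)" by auto
  show "connectedin (mtop S) C \<longleftrightarrow> connected {t \<in> D. \<pi> t \<in> C}"
    using homeomorphic_map_connectedness[OF hom sub] unfolding eq by (simp add: connectedin_subtopology)
  show "compactin (mtop S) C \<longleftrightarrow> compact {t \<in> D. \<pi> t \<in> C}"
    using homeomorphic_map_compactness[OF hom sub] unfolding eq by (simp add: compactin_subtopology)
qed

text \<open>The definition of \<open>seg_int\<close> selects a parametrization by choice. The
  assumption \<open>int\<close> ties \<open>\<pi>\<close> to that selection, so interiors are
  computed in the parameters in use.\<close>

lemma interval_arc_setting: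
  assumes action: "group_action G (points M) \<phi>" and man: "analytic_manifold M"
    and act: "\<And>g. g \<in> carrier G \<Longrightarrow> analytic_map M M (\<phi> g)" and sub: "analytic_submanifold1 S M \<iota>"
    and par: "interval_param S D \<pi>"
    and int: "\<And>A. seg_int S A = \<pi> ` interior {t \<in> D. \<pi> t \<in> A}"
  shows "arc_setting G M S \<phi> \<iota> D \<pi>"
proof -
  have hom: "homeomorphic_map (top_of_set D) (mtop S) \<pi>" and iv: "is_interval D"
    using par by (auto simp: interval_param_def)
  have img: "\<pi> ` D = points S" using homeomorphic_imp_surjective_map[OF hom] by simp
  have inj: "inj_on \<pi> D" using homeomorphic_imp_injective_map[OF hom] by simp
  have pre: "{t \<in> D. \<pi> t \<in> \<pi> ` I} = I" if "I \<subseteq> D" for I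
    using that inj by (auto dest: inj_onD)
  have seg_sub: "closed_segment x y \<subseteq> D" if "x \<in> D" "y \<in> D" for x y
    using iv that by (simp add: closed_segment_subset is_interval_convex_1)
  show ?thesis
  proof (rule arc_setting.intro)
    show "continuous_map (top_of_set D) (mtop S) \<pi>" by (rule homeomorphic_imp_continuous_map[OF hom])
    show "\<exists>r>0. \<forall>t\<in>D. \<forall>u\<in>D. \<bar>t - u\<bar> < r \<longrightarrow> \<pi> t = \<pi> u \<longrightarrow> t = u"
      using inj_onD[OF inj] by (intro exI[of _ 1]) auto
    show "openin (mtop S) (\<pi> ` U)" if "open U" "U \<subseteq> D" for U
    proof -
      have "openin (top_of_set D) U" using that by (simp add: open_subset)
      then show ?thesis using homeomorphic_imp_open_map[OF hom] unfolding open_map_def by blast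
    qed
    show "\<exists>s\<in>{1, -1}. \<exists>e>0. \<forall>u\<in>{0..e}. t + s * u \<in> D \<and> \<pi> (t + s * u) \<in> C"
      if C: "segment S C" "t \<in> D" "\<pi> t \<in> C" for C t
    proof -
      let ?T = "{t \<in> D. \<pi> t \<in> C}"
      have CS: "C \<subseteq> points S" using C(1) connectedin_subset_topspace unfolding segment_def by blast
      have con: "connected ?T" using interval_param_preimage(2)[OF par CS] C(1) by (simp add: segment_def)
      obtain z where "z \<in> C" "z \<noteq> \<pi> t" using C(1) unfolding segment_def by metis
      moreover from this obtain v where "v \<in> D" "z = \<pi> v" using CS img by blast
      ultimately have v: "v \<in> ?T" "v \<noteq> t" by auto
      have "closed_segment t v \<subseteq> ?T"
        using con v C by (simp add: closed_segment_subset connected_convex_1)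
      moreover have "t + sgn (v - t) * u \<in> closed_segment t v" if "u \<in> {0..\<bar>v - t\<bar>}" for u
        using that by (auto simp: closed_segment_eq_real_ivl sgn_if split: if_splits)
      moreover have "sgn (v - t) \<in> {1, -1}" using v(2) by (simp add: sgn_if)
      ultimately have sgn: "sgn (v - t) \<in> {1, -1}" and "\<forall>u\<in>{0..\<bar>v - t\<bar>}. t + sgn (v - t) * u \<in> ?T"
        by blast+
      then have "\<bar>v - t\<bar> > 0 \<and> (\<forall>u\<in>{0..\<bar>v - t\<bar>}. t + sgn (v - t) * u \<in> D \<and> \<pi> (t + sgn (v - t) * u) \<in> C)"
        using v(2) by simp
      then show ?thesis using sgn by blast
    qed
    show "\<exists>p q. p \<noteq> q \<and> closed_segment p q \<subseteq> D \<and> A = \<pi> ` closed_segment p q \<and> inj_on \<pi> (closed_segment p q)"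
      if A: "segment S A" "compactin (mtop S) A" for A
    proof -
      let ?T = "{t \<in> D. \<pi> t \<in> A}"
      have AS: "A \<subseteq> points S" using A(2) compactin_subset_topspace by blast
      have "connected ?T" "compact ?T"
        using interval_param_preimage(2,3)[OF par AS] A by (auto simp: segment_def)
      then obtain p q where T: "?T = {p..q}" using connected_compact_interval_1 by meson
      have A_img: "A = \<pi> ` {p..q}" using interval_param_preimage(1)[OF par AS] unfolding T by simp
      obtain x y where "x \<in> A" "y \<in> A" "x \<noteq> y" using A(1) unfolding segment_def by blast
      then have pq: "p < q" unfolding A_img by (rule image_Icc_two_points)
      have cs: "closed_segment p q = {p..q}" using pq by (simp add: closed_segment_eq_real_ivl)
      have "{p..q} \<subseteq> D" using T by blast
      then show ?thesis using pq A_img cs inj_on_subset[OF inj] by (intro exI[of _ p] exI[of _ q]) auto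
    qed
    show "seg_bd S (\<pi> ` closed_segment p q) = {\<pi> p, \<pi> q}"
      if pq: "p \<noteq> q" "closed_segment p q \<subseteq> D" for p q
    proof -
      have "interior (closed_segment p q) = closed_segment p q - {p, q}"
        using pq(1) by (auto simp: closed_segment_eq_real_ivl)
      then have "seg_bd S (\<pi> ` closed_segment p q) = \<pi> ` closed_segment p q - \<pi> ` (closed_segment p q - {p, q})"
        unfolding seg_bd_def int pre[OF pq(2)] by simp
      also have "\<dots> = \<pi> ` (closed_segment p q - (closed_segment p q - {p, q}))"
        by (rule inj_on_image_set_diff[OF inj, symmetric]) (use pq(2) in auto)
      also have "closed_segment p q - (closed_segment p q - {p, q}) = {p, q}" by auto
      finally show ?thesis by simp
    qed
    show "\<exists>e>0. \<forall>u. \<bar>u - t\<bar> < e \<longrightarrow> u \<in> D \<and> \<pi> u \<in> A" if t: "t \<in> D" "\<pi> t \<in> seg_int S A" for t A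
    proof -
      let ?T = "{t \<in> D. \<pi> t \<in> A}"
      obtain v where v: "v \<in> interior ?T" "\<pi> t = \<pi> v" using t(2) unfolding int by blast
      then have "v \<in> D" using interior_subset by blast
      then have "t \<in> interior ?T" using inj_onD[OF inj v(2) t(1)] v(1) by simp
      then obtain e where e: "e > 0" "ball t e \<subseteq> ?T" using mem_interior by blast
      have "u \<in> ?T" if "\<bar>u - t\<bar> < e" for u
      proof -
        have "u \<in> ball t e" using that by (simp add: dist_real_def abs_minus_commute)
        then show ?thesis using e(2) by blast
      qed
      then show ?thesis using e(1) by blast
    qed
    show "\<pi> t \<in> seg_int S (points S)" if "t \<in> interior D" for t
    proof -
      have "{t \<in> D. \<pi> t \<in> points S} = D" using img by blast
      then show ?thesis unfolding int using that by simp
    qed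
    show "\<exists>e>0. closed_segment p (q + sgn (q - p) * e) \<subseteq> D \<and> inj_on \<pi> (closed_segment p (q + sgn (q - p) * e))"
      if pq: "p \<noteq> q" "closed_segment p q \<subseteq> D" "q \<in> interior D" for p q
    proof -
      obtain e where e: "e > 0" "ball q e \<subseteq> D" using pq(3) mem_interior by blast
      have "q + sgn (q - p) * (e / 2) \<in> ball q e" using e(1) by (auto simp: dist_real_def sgn_if abs_mult)
      then have "closed_segment p (q + sgn (q - p) * (e / 2)) \<subseteq> D" using seg_sub e(2) pq(2) by blast
      then show ?thesis using e(1) inj_on_subset[OF inj] by (intro exI[of _ "e / 2"]) auto
    qed
  qed (use action man act sub iv img in simp_all)
qed

text \<open>Interior endpoints leave parameters on both sides of the arc, so its complement is
  disconnected. The lemma excludes that a compact maximal segment inside the interior of S is the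
  last segment of a decomposition.\<close>

lemma interval_not_boundary_segment:
  assumes par: "interval_param S D \<pi>" and ab: "a \<in> interior D" "b \<in> interior D"
  shows "\<not> boundary_segment S (points S) (\<pi> ` closed_segment a b)"
proof
  assume "boundary_segment S (points S) (\<pi> ` closed_segment a b)"
  then have con: "connectedin (mtop S) (points S - \<pi> ` closed_segment a b)" by (simp add: boundary_segment_def)
  have hom: "homeomorphic_map (top_of_set D) (mtop S) \<pi>" and iv: "is_interval D"
    using par by (auto simp: interval_param_def)
  have img: "\<pi> ` D = points S" using homeomorphic_imp_surjective_map[OF hom] by simp
  have inj: "inj_on \<pi> D" using homeomorphic_imp_injective_map[OF hom] by simp
  have "a \<in> D" "b \<in> D" using ab interior_subset by auto
  then have sub: "closed_segment a b \<subseteq> D" using iv by (simp add: closed_segment_subset is_interval_convex_1)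
  have "{t \<in> D. \<pi> t \<in> points S - \<pi> ` closed_segment a b} = D - closed_segment a b"
  proof (intro equalityI subsetI)
    fix t assume t: "t \<in> D - closed_segment a b"
    have "\<pi> t \<notin> \<pi> ` closed_segment a b" using inj_on_image_mem_iff[OF inj _ sub] t by blast
    then show "t \<in> {t \<in> D. \<pi> t \<in> points S - \<pi> ` closed_segment a b}" using t img by blast
  qed auto
  then have "connected (D - closed_segment a b)"
    using interval_param_preimage(2)[OF par, of "points S - \<pi> ` closed_segment a b"] con by simp
  then have conv: "is_interval (D - closed_segment a b)" by (simp add: is_interval_connected_1)
  obtain e where e: "e > 0" "ball a e \<subseteq> D" using ab(1) mem_interior by blast
  obtain d where d: "d > 0" "ball b d \<subseteq> D" using ab(2) mem_interior by blast
  define l where "l = (if a \<le> b then a - e / 2 else b - d / 2)"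
  define u where "u = (if a \<le> b then b + d / 2 else a + e / 2)"
  have "a - e / 2 \<in> ball a e" "a + e / 2 \<in> ball a e" "b - d / 2 \<in> ball b d" "b + d / 2 \<in> ball b d"
    using e(1) d(1) by (auto simp: dist_real_def)
  then have "l \<in> D - closed_segment a b" "u \<in> D - closed_segment a b" "l \<le> a" "a \<le> u"
    using e d by (auto simp: l_def u_def closed_segment_eq_real_ivl)
  then have "a \<in> D - closed_segment a b" using mem_is_interval_1_I[OF conv] by blast
  then show False by simp
qed

section \<open>The circle covered by the line\<close>

lemma cis_eq_near:
  assumes "cis x = cis y" "\<bar>x - y\<bar> < 2 * pi"
  shows "x = y"
proof -
  obtain n :: int where n: "x - y = of_int n * (2 * pi)"
    using assms(1) unfolding cis_conv_exp exp_eq by (auto simp: complex_eq_iff algebra_simps)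
  have "\<bar>of_int n\<bar> * (2 * pi) < 1 * (2 * pi)" using assms(2) unfolding n by (simp add: abs_mult)
  then have "n = 0" by simp
  then show ?thesis using n by simp
qed

text \<open>The branch of the argument with values from a up to, but excluding,
  \<open>a + 2 * pi\<close>. Its only jump on the unit circle is at \<open>cis a\<close>, and a is
  chosen so that the jump avoids the set under consideration.\<close>

definition arg_from :: "real \<Rightarrow> complex \<Rightarrow> real" where
  "arg_from a z = a + Arg2pi (z / cis a)"

lemma cis_arg_from:
  assumes "norm z = 1"
  shows "cis (arg_from a z) = z" "a \<le> arg_from a z" "arg_from a z < a + 2 * pi"
proof -
  have "z / cis a = complex_of_real (norm (z / cis a)) * exp (\<i> * complex_of_real (Arg2pi (z / cis a)))"
    by (rule Arg2pi_eq)
  then have "z / cis a = cis (Arg2pi (z / cis a))" using assms by (simp add: norm_divide cis_conv_exp)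
  then have "z = cis a * cis (Arg2pi (z / cis a))" by (simp add: field_simps)
  then show "cis (arg_from a z) = z" by (simp add: arg_from_def cis_mult)
  show "a \<le> arg_from a z" "arg_from a z < a + 2 * pi"
    using Arg2pi_ge_0[of "z / cis a"] Arg2pi_lt_2pi[of "z / cis a"] by (simp_all add: arg_from_def)
qed

lemma arg_from_cis:
  assumes "a \<le> x" "x < a + 2 * pi"
  shows "arg_from a (cis x) = x"
  by (rule cis_eq_near) (use cis_arg_from[of "cis x" a] assms in auto)

lemma arg_from_continuous: "continuous_on (sphere 0 1 - {cis a}) (arg_from a)"
  unfolding continuous_on_eq_continuous_within
proof
  fix z assume z: "z \<in> sphere 0 1 - {cis a}"
  have "z / cis a \<notin> \<real>\<^sub>\<ge>\<^sub>0"
  proof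
    assume "z / cis a \<in> \<real>\<^sub>\<ge>\<^sub>0"
    then obtain r where r: "z / cis a = complex_of_real r" "r \<ge> 0" by (auto simp: nonneg_Reals_def)
    have "norm (z / cis a) = 1" using z by (simp add: norm_divide)
    then have "r = 1" using r by simp
    then show False using r z by (simp add: field_simps)
  qed
  then have "isCont (\<lambda>w. Arg2pi (w / cis a)) z"
    by (intro isCont_o2[OF _ continuous_at_Arg2pi] continuous_intros) auto
  then have "isCont (arg_from a) z" unfolding arg_from_def[abs_def] by (intro continuous_intros)
  then show "continuous (at z within sphere 0 1 - {cis a}) (arg_from a)"
    by (rule continuous_at_imp_continuous_at_within)
qed

lemma cis_open:
  assumes "open U"
  shows "openin (top_of_set (sphere 0 1)) (cis ` U)"
proof (subst openin_subopen, intro ballI)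
  fix z assume "z \<in> cis ` U"
  then obtain t where t: "t \<in> U" "z = cis t" by blast
  \<comment> \<open>The jump is placed opposite to the given point, so that the branch inverts
    \<open>cis\<close> continuously around it.\<close>
  define a where "a = t - pi"
  let ?W = "sphere 0 1 - {cis a}"
  define T where "T = ?W \<inter> arg_from a -` U"
  have "openin (top_of_set ?W) T"
    unfolding T_def by (rule continuous_openin_preimage_gen[OF arg_from_continuous assms])
  moreover have "openin (top_of_set (sphere 0 1)) ?W"
    by (simp add: openin_delete)
  ultimately have "openin (top_of_set (sphere 0 1)) T" by (rule openin_trans)
  moreover have "z \<in> T"
  proof -
    have "arg_from a (cis t) = t" by (rule arg_from_cis) (auto simp: a_def)
    moreover have "cis t \<noteq> cis a" using cis_eq_near[of t a] by (auto simp: a_def)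
    ultimately show ?thesis using t by (simp add: T_def)
  qed
  moreover have "T \<subseteq> cis ` U"
  proof
    fix w assume w: "w \<in> T"
    then have "cis (arg_from a w) = w" "arg_from a w \<in> U" using cis_arg_from(1)[of w a] by (auto simp: T_def)
    then show "w \<in> cis ` U" by (metis image_eqI)
  qed
  ultimately show "\<exists>T. openin (top_of_set (sphere 0 1)) T \<and> z \<in> T \<and> T \<subseteq> cis ` U" by blast
qed

lemma cis_continuous_on: "continuous_on A cis"
  by (intro continuous_intros)

lemma circle_near:
  assumes "openin (top_of_set (sphere 0 1)) W" "cis t \<in> W"
  obtains e where "e > 0" "\<And>u. \<bar>u - t\<bar> < e \<Longrightarrow> cis u \<in> W"
proof -
  obtain V where V: "open V" "W = sphere 0 1 \<inter> V" using assms(1) by (metis openin_open)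
  have "open (cis -` V)" using V(1) cis_continuous_on[of UNIV] by (simp add: open_vimage)
  moreover have "t \<in> cis -` V" using assms(2) V(2) by simp
  ultimately obtain e where e: "e > 0" "ball t e \<subseteq> cis -` V" by (meson open_contains_ball)
  have "cis u \<in> W" if "\<bar>u - t\<bar> < e" for u
  proof -
    have "u \<in> ball t e" using that by (simp add: dist_real_def abs_minus_commute)
    then show ?thesis using e(2) V(2) by auto
  qed
  then show ?thesis using that e(1) by blast
qed

lemma circle_arc_interior:
  assumes "lo < hi" "hi - lo < 2 * pi"
  shows "top_of_set (sphere 0 1) interior_of (cis ` {lo..hi}) = cis ` {lo<..<hi}"
proof
  show "cis ` {lo<..<hi} \<subseteq> top_of_set (sphere 0 1) interior_of (cis ` {lo..hi})"
    by (rule interior_of_maximal) (auto intro: cis_open)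
  show "top_of_set (sphere 0 1) interior_of (cis ` {lo..hi}) \<subseteq> cis ` {lo<..<hi}"
  proof
    fix z assume "z \<in> top_of_set (sphere 0 1) interior_of (cis ` {lo..hi})"
    then obtain W where W: "openin (top_of_set (sphere 0 1)) W" "z \<in> W" "W \<subseteq> cis ` {lo..hi}"
      unfolding interior_of_def by blast
    then obtain y where y: "z = cis y" "lo \<le> y" "y \<le> hi" by auto
    obtain e where e: "e > 0" "\<And>u. \<bar>u - y\<bar> < e \<Longrightarrow> cis u \<in> W"
      using circle_near[OF W(1)] W(2) y(1) by metis
    \<comment> \<open>Smaller than the gap \<open>2 * pi - (hi - lo)\<close> left on the circle: a
      parameter exceeding the arc by at most \<open>d\<close> then differs by less than a full turn
      from every parameter of the arc, so its image is in the arc only if it is a parameter of the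
      arc. Hence y cannot be an end.\<close>
    define d where "d = min e (2 * pi - (hi - lo)) / 2"
    have d: "0 < d" "d < e" "d < 2 * pi - (hi - lo)" using e(1) assms by (auto simp: d_def)
    have "u \<in> {lo..hi}" if u: "\<bar>u - y\<bar> < e" "lo - d \<le> u" "u \<le> hi + d" for u
    proof -
      obtain v where v: "v \<in> {lo..hi}" "cis u = cis v" using e(2)[OF u(1)] W(3) by blast
      have "\<bar>u - v\<bar> < 2 * pi" using v(1) u d by auto
      then show ?thesis using cis_eq_near[OF v(2)] v(1) by simp
    qed
    from this[of "y - d"] this[of "y + d"] have "lo < y" "y < hi" using y d by auto
    then show "z \<in> cis ` {lo<..<hi}" using y(1) by auto
  qed
qed

text \<open>If neither direction worked, points outside T would exist on both sides of
  \<open>cis t\<close>, before w is reached. They cut the circle into two open arcs, one containing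
  \<open>cis t\<close> and the other w, contrary to connectedness.\<close>

lemma circle_connected_germ:
  assumes T: "connected T" "T \<subseteq> sphere 0 1" "cis t \<in> T" "w \<in> T" "w \<noteq> cis t"
  shows "\<exists>s\<in>{1, -1}. \<exists>e>0. \<forall>u\<in>{0..e}. cis (t + s * u) \<in> T"
proof (rule ccontr)
  assume no: "\<not> (\<exists>s\<in>{1, -1}. \<exists>e>0. \<forall>u\<in>{0..e}. cis (t + s * u) \<in> T)"
  define d where "d = arg_from t w - t"
  have nw: "norm w = 1" using T(2,4) by auto
  have w: "w = cis (t + d)" using cis_arg_from(1)[OF nw, of t] by (simp add: d_def)
  have "arg_from t w \<noteq> t" using cis_arg_from(1)[OF nw, of t] T(5) by metis
  then have d: "0 < d" "d < 2 * pi"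
    using cis_arg_from(2,3)[OF nw, of t] by (simp_all add: d_def)
  have nots: "\<exists>u\<in>{0..e}. cis (t + s * u) \<notin> T" if "s \<in> {1, -1}" "e > 0" for s e using no that by blast
  \<comment> \<open>The angle from t to w is \<open>d\<close> in the positive and
    \<open>2 * pi - d\<close> in the negative direction; these bounds keep w in the arc opposite to
    \<open>cis t\<close>.\<close>
  obtain u1 where u1: "u1 \<in> {0..d}" "cis (t + u1) \<notin> T" using nots[of 1 d] d by auto
  have "2 * pi - d > 0" using d by simp
  then obtain u2 where u2: "u2 \<in> {0..2 * pi - d}" "cis (t - u2) \<notin> T" using nots[of "-1" "2 * pi - d"] by auto
  have per: "cis (x + 2 * pi) = cis x" for x by (simp add: cis.code)
  have w': "w = cis (t - (2 * pi - d))" using per[of "t - (2 * pi - d)"] by (simp add: w algebra_simps)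
  have u1': "0 < u1" "u1 < d" using u1 T(3,4) w by (auto simp: less_le)
  have u2': "0 < u2" "u2 < 2 * pi - d" using u2 T(3,4) w' by (auto simp: less_le)
  define x1 where "x1 = t + u1"
  define x2 where "x2 = t - u2"
  obtain V1 where V1: "open V1" "cis ` {x2<..<x1} = sphere 0 1 \<inter> V1"
    using cis_open[of "{x2<..<x1}"] by (metis openin_open open_greaterThanLessThan)
  obtain V2 where V2: "open V2" "cis ` {x1<..<x2 + 2 * pi} = sphere 0 1 \<inter> V2"
    using cis_open[of "{x1<..<x2 + 2 * pi}"] by (metis openin_open open_greaterThanLessThan)
  have "V1 \<inter> V2 \<inter> T = {}"
  proof (rule ccontr)
    assume "V1 \<inter> V2 \<inter> T \<noteq> {}"
    then obtain z where z: "z \<in> cis ` {x2<..<x1}" "z \<in> cis ` {x1<..<x2 + 2 * pi}"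
      unfolding V1(2) V2(2) using T(2) by blast
    then obtain y y' where yy: "y \<in> {x2<..<x1}" "y' \<in> {x1<..<x2 + 2 * pi}" "cis y = cis y'" by auto
    have "y = y'" by (rule cis_eq_near[OF yy(3)]) (use yy(1,2) in auto)
    then show False using yy by auto
  qed
  moreover have "T \<subseteq> V1 \<union> V2"
  proof
    fix z assume z: "z \<in> T"
    then have nz: "norm z = 1" using T(2) by auto
    let ?y = "arg_from x2 z"
    have y: "cis ?y = z" "x2 \<le> ?y" "?y < x2 + 2 * pi" by (rule cis_arg_from[OF nz])+
    have "?y \<noteq> x2" "?y \<noteq> x1" using y(1) z u1(2) u2(2) by (auto simp: x1_def x2_def)
    then have "?y \<in> {x2<..<x1} \<or> ?y \<in> {x1<..<x2 + 2 * pi}" using y by auto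
    then have "z \<in> cis ` {x2<..<x1} \<or> z \<in> cis ` {x1<..<x2 + 2 * pi}" using y(1) by (metis image_eqI)
    then show "z \<in> V1 \<union> V2" unfolding V1(2) V2(2) by blast
  qed
  ultimately have "V1 \<inter> T = {} \<or> V2 \<inter> T = {}" using connectedD[OF T(1) V1(1) V2(1)] by blast
  moreover have "cis t \<in> V1"
  proof -
    have "cis t \<in> cis ` {x2<..<x1}" using u1' u2' by (intro imageI) (auto simp: x1_def x2_def)
    then show ?thesis unfolding V1(2) by blast
  qed
  moreover have "w \<in> V2"
  proof -
    have "w \<in> cis ` {x1<..<x2 + 2 * pi}" unfolding w using u1' u2' by (intro imageI) (auto simp: x1_def x2_def)
    then show ?thesis unfolding V2(2) by blast
  qed
  ultimately show False using T(3,4) by blast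
qed

lemma circle_arc_setting:
  assumes action: "group_action G (points M) \<phi>" and man: "analytic_manifold M"
    and act: "\<And>g. g \<in> carrier G \<Longrightarrow> analytic_map M M (\<phi> g)" and sub: "analytic_submanifold1 S M \<iota>"
    and par: "circle_param S \<upsilon>"
    and int: "\<And>A. seg_int S A = \<upsilon> ` (top_of_set (sphere 0 1) interior_of {t \<in> sphere 0 1. \<upsilon> t \<in> A})"
  shows "arc_setting G M S \<phi> \<iota> UNIV (\<lambda>t. \<upsilon> (cis t))"
proof -
  let ?C = "sphere (0::complex) 1"
  have hom: "homeomorphic_map (top_of_set ?C) (mtop S) \<upsilon>" using par by (simp add: circle_param_def)
  have img: "\<upsilon> ` ?C = points S" using homeomorphic_imp_surjective_map[OF hom] by simp
  have inj: "inj_on \<upsilon> ?C" using homeomorphic_imp_injective_map[OF hom] by simp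
  have cisC: "cis x \<in> ?C" for x by simp
  have range: "range cis = ?C" using cis_arg_from(1)[of _ 0] by (auto intro: rangeI[of cis] simp: image_iff) metis
  have eq_iff: "\<upsilon> (cis x) = \<upsilon> (cis y) \<longleftrightarrow> cis x = cis y" for x y
    using inj_on_eq_iff[OF inj cisC cisC] .
  have near: "x = y" if "\<upsilon> (cis x) = \<upsilon> (cis y)" "\<bar>x - y\<bar> < 2 * pi" for x y
    using cis_eq_near[OF _ that(2)] that(1) eq_iff by blast
  have pre: "{z \<in> ?C. \<upsilon> z \<in> \<upsilon> ` I} = I" if "I \<subseteq> ?C" for I
    using that inj by (auto dest: inj_onD simp: inj_on_image_mem_iff)
  have pre_img: "\<upsilon> ` {z \<in> ?C. \<upsilon> z \<in> A} = A" if "A \<subseteq> points S" for A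
  proof -
    have "A \<subseteq> \<upsilon> ` ?C" using img that by simp
    then show ?thesis by auto
  qed
  have pre_con: "connected {z \<in> ?C. \<upsilon> z \<in> A}" if "connectedin (mtop S) A" for A
  proof -
    have sub: "{z \<in> ?C. \<upsilon> z \<in> A} \<subseteq> topspace (top_of_set ?C)" by auto
    show ?thesis
      using homeomorphic_map_connectedness[OF hom sub] that pre_img[OF connectedin_subset_topspace[OF that]]
      by (simp add: connectedin_subtopology)
  qed
  have pre_comp: "compact {z \<in> ?C. \<upsilon> z \<in> A}" if "compactin (mtop S) A" for A
  proof -
    have sub: "{z \<in> ?C. \<upsilon> z \<in> A} \<subseteq> topspace (top_of_set ?C)" by auto
    show ?thesis
      using homeomorphic_map_compactness[OF hom sub] that pre_img[OF compactin_subset_topspace[OF that]]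
      by (simp add: compactin_subtopology)
  qed
  \<comment> \<open>An arc of a full turn or more would contain two parameters with the same
    image.\<close>
  have short: "\<bar>p - q\<bar> < 2 * pi" if "inj_on (\<lambda>t. \<upsilon> (cis t)) (closed_segment p q)" for p q
  proof (rule ccontr)
    assume "\<not> \<bar>p - q\<bar> < 2 * pi"
    then have "min p q \<in> closed_segment p q" "min p q + 2 * pi \<in> closed_segment p q"
      by (auto simp: closed_segment_eq_real_ivl)
    moreover have "\<upsilon> (cis (min p q)) = \<upsilon> (cis (min p q + 2 * pi))" by (simp add: cis.code)
    ultimately have "min p q = min p q + 2 * pi" using inj_onD[OF that] by blast
    then show False by simp
  qed
  show ?thesis
  proof (rule arc_setting.intro)
    show "continuous_map (top_of_set UNIV) (mtop S) (\<lambda>t. \<upsilon> (cis t))"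
    proof -
      have "continuous_map (top_of_set UNIV) (top_of_set ?C) cis"
        using cis_continuous_on[of UNIV] by (auto simp: continuous_map_in_subtopology)
      from continuous_map_compose[OF this homeomorphic_imp_continuous_map[OF hom]]
      show ?thesis by (simp add: o_def)
    qed
    show "range (\<lambda>t. \<upsilon> (cis t)) = points S" unfolding img[symmetric] range[symmetric] by (simp add: image_image)
    show "\<exists>r>0. \<forall>t\<in>UNIV. \<forall>u\<in>UNIV. \<bar>t - u\<bar> < r \<longrightarrow> \<upsilon> (cis t) = \<upsilon> (cis u) \<longrightarrow> t = u"
      using near by (intro exI[of _ "2 * pi"]) auto
    show "openin (mtop S) ((\<lambda>t. \<upsilon> (cis t)) ` U)" if "open U" for U
    proof -
      have "openin (mtop S) (\<upsilon> ` cis ` U)"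
        using homeomorphic_imp_open_map[OF hom] cis_open[OF that] unfolding open_map_def by blast
      then show ?thesis by (simp add: image_image)
    qed
    show "\<exists>s\<in>{1, -1}. \<exists>e>0. \<forall>u\<in>{0..e}. t + s * u \<in> UNIV \<and> \<upsilon> (cis (t + s * u)) \<in> C"
      if C: "segment S C" "\<upsilon> (cis t) \<in> C" for C t
    proof -
      let ?T = "{z \<in> ?C. \<upsilon> z \<in> C}"
      have con: "connectedin (mtop S) C" using C(1) by (simp add: segment_def)
      obtain z where "z \<in> C" "z \<noteq> \<upsilon> (cis t)" using C(1) unfolding segment_def by metis
      moreover from this obtain w where "w \<in> ?C" "z = \<upsilon> w" using connectedin_subset_topspace[OF con] img by blast
      ultimately have w: "w \<in> ?T" "w \<noteq> cis t" by auto
      have "?T \<subseteq> ?C" by blast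
      then have "\<exists>s\<in>{1, -1}. \<exists>e>0. \<forall>u\<in>{0..e}. cis (t + s * u) \<in> ?T"
        using circle_connected_germ[OF pre_con[OF con] _ _ w] C(2) by simp
      then show ?thesis by blast
    qed
    show "\<exists>p q. p \<noteq> q \<and> closed_segment p q \<subseteq> UNIV \<and> A = (\<lambda>t. \<upsilon> (cis t)) ` closed_segment p q \<and>
        inj_on (\<lambda>t. \<upsilon> (cis t)) (closed_segment p q)"
      if A: "segment S A" "compactin (mtop S) A" "A \<noteq> points S" for A
    proof -
      let ?T = "{z \<in> ?C. \<upsilon> z \<in> A}"
      have con: "connectedin (mtop S) A" using A(1) by (simp add: segment_def)
      have AS: "A \<subseteq> points S" by (rule connectedin_subset_topspace[OF con])
      then obtain z where z: "z \<in> points S" "z \<notin> A" using A(3) by blast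
      \<comment> \<open>A point missed by \<open>A\<close> serves as the jump of the argument, so
        that the preimage of \<open>A\<close> on the circle is mapped continuously, and hence onto a
        compact interval.\<close>
      then obtain a where a: "z = \<upsilon> (cis a)" unfolding img[symmetric] range[symmetric] by blast
      have sub: "?T \<subseteq> ?C - {cis a}" using z(2) a by auto
      have cont: "continuous_on ?T (arg_from a)" by (rule continuous_on_subset[OF arg_from_continuous sub])
      obtain p q where pq: "arg_from a ` ?T = {p..q}"
        using connected_continuous_image[OF cont pre_con[OF con]] compact_continuous_image[OF cont pre_comp[OF A(2)]]
          connected_compact_interval_1 by meson
      have "cis ` {p..q} = (\<lambda>w. cis (arg_from a w)) ` ?T" unfolding pq[symmetric] by (simp add: image_image)
      also have "\<dots> = (\<lambda>w. w) ` ?T" by (rule image_cong[OF refl]) (use cis_arg_from(1) in auto)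
      finally have T: "?T = cis ` {p..q}" by simp
      have A_img: "A = (\<lambda>t. \<upsilon> (cis t)) ` {p..q}"
        using pre_img[OF AS] unfolding T by (simp add: image_image)
      obtain x y where "x \<in> A" "y \<in> A" "x \<noteq> y" using A(1) unfolding segment_def by blast
      then have pq': "p < q" unfolding A_img by (rule image_Icc_two_points)
      have range_pq: "a \<le> t \<and> t < a + 2 * pi" if "t \<in> {p..q}" for t
        using that cis_arg_from(2,3)[of _ a] unfolding pq[symmetric] by auto
      have "inj_on (\<lambda>t. \<upsilon> (cis t)) {p..q}"
      proof (rule inj_onI)
        fix x y assume "x \<in> {p..q}" "y \<in> {p..q}" "\<upsilon> (cis x) = \<upsilon> (cis y)"
        then show "x = y" using near[of x y] range_pq[of x] range_pq[of y] by auto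
      qed
      then show ?thesis using pq' A_img by (intro exI[of _ p] exI[of _ q]) (simp add: closed_segment_eq_real_ivl)
    qed
    show "seg_bd S ((\<lambda>t. \<upsilon> (cis t)) ` closed_segment p q) = {\<upsilon> (cis p), \<upsilon> (cis q)}"
      if pq: "p \<noteq> q" "inj_on (\<lambda>t. \<upsilon> (cis t)) (closed_segment p q)" for p q
    proof -
      define lo where "lo = min p q"
      define hi where "hi = max p q"
      have lh: "lo < hi" "hi - lo < 2 * pi" using pq(1) short[OF pq(2)] by (auto simp: lo_def hi_def)
      have cs: "closed_segment p q = {lo..hi}" by (auto simp: closed_segment_eq_real_ivl lo_def hi_def)
      have "{z \<in> ?C. \<upsilon> z \<in> (\<lambda>t. \<upsilon> (cis t)) ` {lo..hi}} = cis ` {lo..hi}"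
      proof -
        have "cis ` {lo..hi} \<subseteq> ?C" by auto
        from pre[OF this] show ?thesis by (simp only: image_image)
      qed
      then have "seg_int S ((\<lambda>t. \<upsilon> (cis t)) ` {lo..hi}) = (\<lambda>t. \<upsilon> (cis t)) ` {lo<..<hi}"
        unfolding int by (simp add: circle_arc_interior[OF lh] image_image)
      then have "seg_bd S ((\<lambda>t. \<upsilon> (cis t)) ` {lo..hi}) = (\<lambda>t. \<upsilon> (cis t)) ` {lo..hi} - (\<lambda>t. \<upsilon> (cis t)) ` {lo<..<hi}"
        by (simp add: seg_bd_def)
      also have "\<dots> = (\<lambda>t. \<upsilon> (cis t)) ` ({lo..hi} - {lo<..<hi})"
        by (rule inj_on_image_set_diff[OF pq(2)[unfolded cs], symmetric]) auto
      also have "{lo..hi} - {lo<..<hi} = {lo, hi}" using lh by auto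
      finally show ?thesis unfolding cs by (auto simp: lo_def hi_def min_def max_def)
    qed
    show "\<exists>e>0. \<forall>u. \<bar>u - t\<bar> < e \<longrightarrow> u \<in> UNIV \<and> \<upsilon> (cis u) \<in> A" if t: "\<upsilon> (cis t) \<in> seg_int S A" for t A
    proof -
      let ?T = "{t \<in> sphere 0 1. \<upsilon> t \<in> A}"
      obtain w where w: "w \<in> top_of_set ?C interior_of ?T" "\<upsilon> (cis t) = \<upsilon> w" using t unfolding int by blast
      then obtain W where W: "openin (top_of_set ?C) W" "w \<in> W" "W \<subseteq> ?T" unfolding interior_of_def by blast
      have "w \<in> ?C" using W(2,3) by blast
      then have "cis t = w" using inj_onD[OF inj w(2) cisC] by blast
      then obtain e where "e > 0" "\<And>u. \<bar>u - t\<bar> < e \<Longrightarrow> cis u \<in> W" using circle_near[OF W(1)] W(2) by metis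
      then show ?thesis using W(3) by blast
    qed
    show "\<upsilon> (cis t) \<in> seg_int S (points S)" for t
    proof -
      have "{t \<in> sphere 0 1. \<upsilon> t \<in> points S} = ?C" using img by blast
      moreover have "top_of_set ?C interior_of ?C = ?C" using interior_of_topspace[of "top_of_set ?C"] by simp
      ultimately show ?thesis unfolding int using cisC by simp
    qed
    show "\<exists>e>0. closed_segment p (q + sgn (q - p) * e) \<subseteq> UNIV \<and>
        inj_on (\<lambda>t. \<upsilon> (cis t)) (closed_segment p (q + sgn (q - p) * e))"
      if pq: "p \<noteq> q" "inj_on (\<lambda>t. \<upsilon> (cis t)) (closed_segment p q)" for p q
    proof -
      \<comment> \<open>Half of what is missing to a full turn, so that the prolonged arc is still
        shorter than one turn.\<close>
      define e where "e = (2 * pi - \<bar>p - q\<bar>) / 2"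
      have e: "e > 0" "e < 2 * pi - \<bar>p - q\<bar>" using short[OF pq(2)] by (auto simp: e_def)
      have "inj_on (\<lambda>t. \<upsilon> (cis t)) (closed_segment p (q + sgn (q - p) * e))"
      proof (rule inj_onI)
        fix x y assume xy: "x \<in> closed_segment p (q + sgn (q - p) * e)" "y \<in> closed_segment p (q + sgn (q - p) * e)"
          "\<upsilon> (cis x) = \<upsilon> (cis y)"
        have "\<bar>x - y\<bar> < 2 * pi" using xy(1,2) e pq(1) unfolding sgn_extend_segment[OF pq(1) e(1)]
          by (auto split: if_splits)
        then show "x = y" using near xy(3) by blast
      qed
      then show ?thesis using e(1) by auto
    qed
  qed (use action man act sub in simp_all)
qed

text \<open>Removing a point leaves a circle connected, but removing an inner point disconnects an
  interval. Since \<open>seg_int\<close> tests for the circle type before anything else, this is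
  what makes its interval clause available for intervals.\<close>

lemma not_circle_and_interval:
  assumes "circle_param S \<upsilon>" "interval_param S D \<pi>"
  shows False
proof -
  have hom: "homeomorphic_map (top_of_set (sphere 0 1)) (mtop S) \<upsilon>" using assms(1) by (simp add: circle_param_def)
  have hom': "homeomorphic_map (top_of_set D) (mtop S) \<pi>" and iv: "is_interval D"
    using assms(2) by (auto simp: interval_param_def)
  obtain a b where ab: "a \<in> D" "b \<in> D" "a < b"
    using assms(2) unfolding interval_param_def by (metis linorder_neqE_linordered_idom)
  define m where "m = (a + b) / 2"
  have m: "a < m" "m < b" using ab(3) by (simp_all add: m_def)
  then have mD: "m \<in> D" using mem_is_interval_1_I[OF iv ab(1,2)] by simp
  have img: "\<upsilon> ` sphere 0 1 = points S" using homeomorphic_imp_surjective_map[OF hom] by simp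
  have inj: "inj_on \<upsilon> (sphere 0 1)" using homeomorphic_imp_injective_map[OF hom] by simp
  have img': "\<pi> ` D = points S" using homeomorphic_imp_surjective_map[OF hom'] by simp
  have inj': "inj_on \<pi> D" using homeomorphic_imp_injective_map[OF hom'] by simp
  obtain w where w: "norm w = 1" "\<upsilon> w = \<pi> m"
  proof -
    have "\<pi> m \<in> \<upsilon> ` sphere 0 1" using mD img img' by blast
    then show ?thesis using that by auto
  qed
  define \<theta> where "\<theta> = arg_from 0 w"
  have th: "cis \<theta> = w" using cis_arg_from(1)[OF w(1)] by (simp add: \<theta>_def)
  have "sphere 0 1 - {w} = cis ` {\<theta><..<\<theta> + 2 * pi}"
  proof (intro equalityI subsetI)
    fix z assume z: "z \<in> sphere 0 1 - {w}"
    then have "norm z = 1" by simp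
    note y = cis_arg_from[OF this, of \<theta>]
    have "arg_from \<theta> z \<noteq> \<theta>" using y(1) th z by auto
    then have "arg_from \<theta> z \<in> {\<theta><..<\<theta> + 2 * pi}" using y(2,3) by auto
    then show "z \<in> cis ` {\<theta><..<\<theta> + 2 * pi}" using y(1) by (metis image_eqI)
  next
    fix z assume "z \<in> cis ` {\<theta><..<\<theta> + 2 * pi}"
    then obtain y where y: "z = cis y" "\<theta> < y" "y < \<theta> + 2 * pi" by auto
    then have "z \<noteq> w" using cis_eq_near[of y \<theta>] th by auto
    then show "z \<in> sphere 0 1 - {w}" using y(1) by simp
  qed
  then have "connected (sphere 0 1 - {w})"
    using connected_continuous_image[OF cis_continuous_on, of "{\<theta><..<\<theta> + 2 * pi}"] by simp
  then have "connectedin (mtop S) (\<upsilon> ` (sphere 0 1 - {w}))"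
    by (intro connectedin_continuous_map_image[OF homeomorphic_imp_continuous_map[OF hom]])
       (auto simp: connectedin_subtopology)
  also have "\<upsilon> ` (sphere 0 1 - {w}) = points S - {\<pi> m}"
    using inj_on_image_set_diff[OF inj, of "sphere 0 1" "{w}"] img w by simp
  finally have "connected {t \<in> D. \<pi> t \<in> points S - {\<pi> m}}"
    using interval_param_preimage(2)[OF assms(2), of "points S - {\<pi> m}"] by simp
  moreover have "{t \<in> D. \<pi> t \<in> points S - {\<pi> m}} = D - {m}"
    using img' inj_onD[OF inj'] mD by auto
  ultimately have "is_interval (D - {m})" by (simp add: is_interval_connected_1)
  moreover have "a \<in> D - {m}" "b \<in> D - {m}" using ab m by auto
  ultimately have "m \<in> D - {m}" using mem_is_interval_1_I[of "D - {m}" a b m] m by simp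
  then show False by simp
qed

section \<open>Arbitrary representatives of the first class, and the final statement\<close>

context arc_setting
begin

lemma D_nonempty:
  assumes "A \<in> maximal_segments G \<phi> M S \<iota>"
  shows "D \<noteq> {}"
proof -
  have A: "segment S A" using assms by (simp add: maximal_segments_def free_segments_def)
  obtain t s where "germ_in t s A" using segment_lift[OF A] by metis
  then show ?thesis using germ_in_point by blast
qed

text \<open>Replaces the representative \<open>g 1\<close> by any h in its class. Powers of h then
  have the same classes, because \<open>g 1\<close> normalizes the stabilizer.\<close>

lemma circle_classes:
  assumes A: "A \<in> maximal_segments G \<phi> M S \<iota>" "compactin (mtop S) A" "A \<subseteq> seg_int S (points S)"
    and S: "points S \<notin> free_segments G \<phi> M S \<iota>" "positive_submanifold G \<phi> M S \<iota>"
    and dec: "circle_decomposition G \<phi> M S \<iota> A n Sg g"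
    and h: "h \<in> coset (g 1)"
  shows "k \<le> n \<Longrightarrow> coset (g k) = coset (h [^] k)"
    and "A' \<in> maximal_segments G \<phi> M S \<iota> \<Longrightarrow> compactin (mtop S) A' \<Longrightarrow> A' \<subseteq> seg_int S (points S) \<Longrightarrow>
      oriented_circle_decomposition G \<phi> M S \<iota> n Sg g A' n' Sg' g' \<Longrightarrow> k \<le> n' \<Longrightarrow>
      coset (g' k) = coset (h [^] k)"
proof -
  have D: "D \<noteq> {}" by (rule D_nonempty[OF A(1)])
  have g: "g 1 \<in> carrier G" using circle_decompositionD(1,4)[OF dec] by blast
  have hG: "h \<in> carrier G" "coset (g 1) = coset h" using cls_mem[OF D g] h by auto
  have pow: "coset (g 1 [^] k) = coset (h [^] k)"
    by (rule cls_nat_pow[OF D circle_pow(1)[OF A S dec] hG])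
  show "coset (g k) = coset (h [^] k)" if "k \<le> n"
    using circle_pow(2)[OF A S dec that] pow by simp
  show "coset (g' k) = coset (h [^] k)"
    if "A' \<in> maximal_segments G \<phi> M S \<iota>" "compactin (mtop S) A'" "A' \<subseteq> seg_int S (points S)"
      "oriented_circle_decomposition G \<phi> M S \<iota> n Sg g A' n' Sg' g'" "k \<le> n'"
    using circle_oriented[OF A S dec that(1-4)] that(5) pow by simp
qed

lemma interval_classes:
  assumes A: "A \<in> maximal_segments G \<phi> M S \<iota>" "compactin (mtop S) A" "A \<subseteq> seg_int S (points S)"
    and S: "points S \<notin> free_segments G \<phi> M S \<iota>" "positive_submanifold G \<phi> M S \<iota>"
    and dec: "interval_decomposition G \<phi> M S \<iota> A nm np Sg g"
    and bd: "\<forall>a\<in>interior D. \<forall>b\<in>interior D. \<not> boundary_segment S (points S) (\<pi> ` closed_segment a b)"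
  shows "h \<in> coset (g 1) \<Longrightarrow> k \<in> index_set nm np \<Longrightarrow> coset (g k) = coset (h [^] k)"
    and "A' \<in> maximal_segments G \<phi> M S \<iota> \<Longrightarrow> compactin (mtop S) A' \<Longrightarrow> A' \<subseteq> seg_int S (points S) \<Longrightarrow>
      oriented_interval_decomposition G \<phi> M S \<iota> nm np Sg g A' nm' np' Sg' g' \<Longrightarrow>
      coset (g' 1) = coset (g 1) \<and>
      (h \<in> coset (g 1) \<longrightarrow> k \<in> index_set nm' np' \<longrightarrow> coset (g' k) = coset (h [^] k))"
proof -
  have D: "D \<noteq> {}" by (rule D_nonempty[OF A(1)])
  have "1 \<in> index_set nm np"
    using interval_decompositionD(1,2)[OF dec] by (cases nm; cases np) (auto simp: index_set_def)
  then have g: "g 1 \<in> carrier G" by (rule interval_decompositionD(4)[OF dec])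
  have pow: "coset (g 1 [^] k) = coset (h [^] k)" if "h \<in> coset (g 1)"
    by (rule cls_int_pow[OF D interval_pow(1)[OF A S dec]]) (use cls_mem[OF D g] that in auto)
  show "coset (g k) = coset (h [^] k)" if "h \<in> coset (g 1)" "k \<in> index_set nm np"
    using interval_pow(2)[OF A S dec that(2)] pow[OF that(1)] by simp
  show "coset (g' 1) = coset (g 1) \<and>
      (h \<in> coset (g 1) \<longrightarrow> k \<in> index_set nm' np' \<longrightarrow> coset (g' k) = coset (h [^] k))"
    if A': "A' \<in> maximal_segments G \<phi> M S \<iota>" "compactin (mtop S) A'" "A' \<subseteq> seg_int S (points S)"
      and or: "oriented_interval_decomposition G \<phi> M S \<iota> nm np Sg g A' nm' np' Sg' g'"
  proof -
    have free: "A' \<in> free_segments G \<phi> M S \<iota>" using A'(1) by (simp add: maximal_segments_def)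
    then have "segment S A'" by (simp add: free_segments_def)
    moreover have "A' \<noteq> points S" using free S(1) by auto
    ultimately obtain a b where ab: "arc a b" "A' = \<pi> ` closed_segment a b"
      using compact_segment A'(2) unfolding arc_def by metis
    have "\<pi> a \<in> A'" "\<pi> b \<in> A'" unfolding ab(2) by auto
    then have "a \<in> interior D" "b \<in> interior D"
      using seg_int_interior[of a] seg_int_interior[of b] A'(3) ab(1) by (auto simp: arc_def)
    then have "\<not> boundary_segment S (points S) A'" using bd ab(2) by simp
    then show ?thesis using interval_oriented[OF A S dec A' _ or] pow by simp
  qed
qed

end

theorem lemma31:
  fixes G :: "('g, 'b) monoid_scheme"
    and L :: "'g manifold"
    and M :: "'m manifold"
    and S :: "'s manifold"
    and \<phi> :: "'g \<Rightarrow> 'm \<Rightarrow> 'm"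
    and \<iota> :: "'s \<Rightarrow> 'm"
    and \<Sigma> :: "'s set"
  assumes "lie_group G L"
    and "analytic_manifold M"
    and "pointwise_continuous_action G L \<phi> M"
    and "non_contractive G \<phi> M"
    and "analytic_submanifold1 S M \<iota>"
    and "free_submanifold G \<phi> M S \<iota>"
    and "points S \<notin> free_segments G \<phi> M S \<iota>"
    and "positive_submanifold G \<phi> M S \<iota>"
    and "\<Sigma> \<in> maximal_segments G \<phi> M S \<iota>"
    and "compactin (mtop S) \<Sigma>"
    and "\<Sigma> \<subset> seg_int S (points S)"
  shows
    "(circle_type S \<longrightarrow>
       (\<forall>n Sg g. circle_decomposition G \<phi> M S \<iota> \<Sigma> n Sg g \<longrightarrow>
          (\<forall>h \<in> cls G \<phi> S \<iota> (g 1). \<forall>k\<le>n. cls G \<phi> S \<iota> (g k) = cls G \<phi> S \<iota> (h [^]\<^bsub>G\<^esub> k)) \<and>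
          (\<forall>\<Sigma>' n' Sg' g'.
             \<Sigma>' \<in> maximal_segments G \<phi> M S \<iota> \<longrightarrow> compactin (mtop S) \<Sigma>' \<longrightarrow>
             \<Sigma>' \<subset> seg_int S (points S) \<longrightarrow>
             oriented_circle_decomposition G \<phi> M S \<iota> n Sg g \<Sigma>' n' Sg' g' \<longrightarrow>
               cls G \<phi> S \<iota> (g' 1) = cls G \<phi> S \<iota> (g 1) \<and>
               (\<forall>h \<in> cls G \<phi> S \<iota> (g 1). \<forall>k\<le>n'.
                  cls G \<phi> S \<iota> (g' k) = cls G \<phi> S \<iota> (h [^]\<^bsub>G\<^esub> k))))) \<and>
     (interval_type S \<longrightarrow>
       (\<forall>nm np Sg g. interval_decomposition G \<phi> M S \<iota> \<Sigma> nm np Sg g \<longrightarrow>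
          (\<forall>h \<in> cls G \<phi> S \<iota> (g 1). \<forall>k \<in> index_set nm np.
             cls G \<phi> S \<iota> (g k) = cls G \<phi> S \<iota> (h [^]\<^bsub>G\<^esub> k)) \<and>
          (\<forall>\<Sigma>' nm' np' Sg' g'.
             \<Sigma>' \<in> maximal_segments G \<phi> M S \<iota> \<longrightarrow> compactin (mtop S) \<Sigma>' \<longrightarrow>
             \<Sigma>' \<subset> seg_int S (points S) \<longrightarrow>
             oriented_interval_decomposition G \<phi> M S \<iota> nm np Sg g \<Sigma>' nm' np' Sg' g' \<longrightarrow>
               cls G \<phi> S \<iota> (g' 1) = cls G \<phi> S \<iota> (g 1) \<and>
               (\<forall>h \<in> cls G \<phi> S \<iota> (g 1). \<forall>k \<in> index_set nm' np'.
                  cls G \<phi> S \<iota> (g' k) = cls G \<phi> S \<iota> (h [^]\<^bsub>G\<^esub> k)))))"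
proof -
  have action: "group_action G (points M) \<phi>"
    using assms(3) by (simp add: pointwise_continuous_action_def)
  have act: "\<And>g. g \<in> carrier G \<Longrightarrow> analytic_map M M (\<phi> g)"
    using assms(4) by (simp add: non_contractive_def)
  have \<Sigma>: "\<Sigma> \<subseteq> seg_int S (points S)" using assms(11) by (rule psubset_imp_subset)
  show ?thesis
  proof (intro conjI impI allI)
    assume circle: "circle_type S"
    define \<upsilon> where "\<upsilon> = (SOME \<upsilon>. circle_param S \<upsilon>)"
    have par: "circle_param S \<upsilon>" unfolding \<upsilon>_def using circle unfolding circle_type_def by (rule someI_ex)
    have int: "seg_int S A = \<upsilon> ` (top_of_set (sphere 0 1) interior_of {t \<in> sphere 0 1. \<upsilon> t \<in> A})" for A
      unfolding seg_int_def if_P[OF circle] Let_def \<upsilon>_def ..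
    interpret arc_setting G M S \<phi> \<iota> UNIV "\<lambda>t. \<upsilon> (cis t)"
      by (rule circle_arc_setting[OF action assms(2) act assms(5) par int])
    fix n Sg g
    assume dec: "circle_decomposition G \<phi> M S \<iota> \<Sigma> n Sg g"
    note classes = circle_classes[OF assms(9,10) \<Sigma> assms(7,8) dec]
    show "\<forall>h \<in> cls G \<phi> S \<iota> (g 1). \<forall>k\<le>n. cls G \<phi> S \<iota> (g k) = cls G \<phi> S \<iota> (h [^]\<^bsub>G\<^esub> k)"
      by (intro ballI allI impI classes(1))
    fix \<Sigma>' n' Sg' g'
    assume \<Sigma>': "\<Sigma>' \<in> maximal_segments G \<phi> M S \<iota>" "compactin (mtop S) \<Sigma>'" "\<Sigma>' \<subset> seg_int S (points S)"
      and or: "oriented_circle_decomposition G \<phi> M S \<iota> n Sg g \<Sigma>' n' Sg' g'"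
    show "cls G \<phi> S \<iota> (g' 1) = cls G \<phi> S \<iota> (g 1)"
      by (rule circle_oriented[OF assms(9,10) \<Sigma> assms(7,8) dec \<Sigma>'(1,2) psubset_imp_subset[OF \<Sigma>'(3)] or, THEN conjunct1])
    show "\<forall>h \<in> cls G \<phi> S \<iota> (g 1). \<forall>k\<le>n'. cls G \<phi> S \<iota> (g' k) = cls G \<phi> S \<iota> (h [^]\<^bsub>G\<^esub> k)"
      by (intro ballI allI impI classes(2)[OF _ \<Sigma>'(1,2) psubset_imp_subset[OF \<Sigma>'(3)] or])
  next
    assume interval: "interval_type S"
    \<comment> \<open>The very pair selected in the definition of \<open>seg_int\<close>, so that
      the interiors in the statement are taken in these parameters.\<close>
    define P where "P = (SOME (D, \<upsilon>). interval_param S D \<upsilon>)"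
    define D where "D = fst P"
    define \<upsilon> where "\<upsilon> = snd P"
    have P: "P = (D, \<upsilon>)" by (simp add: D_def \<upsilon>_def)
    have "\<exists>p. case p of (D, \<upsilon>) \<Rightarrow> interval_param S D \<upsilon>" using interval by (auto simp: interval_type_def)
    then have "case P of (D, \<upsilon>) \<Rightarrow> interval_param S D \<upsilon>" unfolding P_def by (rule someI_ex)
    then have par: "interval_param S D \<upsilon>" by (simp add: P)
    have no_circle: "\<not> circle_type S"
      using not_circle_and_interval[OF _ par] unfolding circle_type_def by blast
    have int: "seg_int S A = \<upsilon> ` interior {t \<in> D. \<upsilon> t \<in> A}" for A
      unfolding seg_int_def if_not_P[OF no_circle] P_def[symmetric] P by simp
    interpret arc_setting G M S \<phi> \<iota> D \<upsilon>
      by (rule interval_arc_setting[OF action assms(2) act assms(5) par int])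
    fix nm np Sg g
    assume dec: "interval_decomposition G \<phi> M S \<iota> \<Sigma> nm np Sg g"
    have "\<forall>a\<in>interior D. \<forall>b\<in>interior D. \<not> boundary_segment S (points S) (\<upsilon> ` closed_segment a b)"
      by (intro ballI interval_not_boundary_segment[OF par])
    note classes = interval_classes[OF assms(9,10) \<Sigma> assms(7,8) dec this]
    show "\<forall>h \<in> cls G \<phi> S \<iota> (g 1). \<forall>k \<in> index_set nm np. cls G \<phi> S \<iota> (g k) = cls G \<phi> S \<iota> (h [^]\<^bsub>G\<^esub> k)"
      by (intro ballI classes(1))
    fix \<Sigma>' nm' np' Sg' g'
    assume \<Sigma>': "\<Sigma>' \<in> maximal_segments G \<phi> M S \<iota>" "compactin (mtop S) \<Sigma>'" "\<Sigma>' \<subset> seg_int S (points S)"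
      and or: "oriented_interval_decomposition G \<phi> M S \<iota> nm np Sg g \<Sigma>' nm' np' Sg' g'"
    note classes' = classes(2)[OF \<Sigma>'(1,2) psubset_imp_subset[OF \<Sigma>'(3)] or]
    show "cls G \<phi> S \<iota> (g' 1) = cls G \<phi> S \<iota> (g 1)" by (rule classes'[THEN conjunct1])
    show "\<forall>h \<in> cls G \<phi> S \<iota> (g 1). \<forall>k \<in> index_set nm' np'. cls G \<phi> S \<iota> (g' k) = cls G \<phi> S \<iota> (h [^]\<^bsub>G\<^esub> k)"
      by (intro ballI classes'[THEN conjunct2, rule_format])
  qed
qed

end
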